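(* The fibration $p_{an}:An\to\mathbf{Set}$ of analytic functors has as its objects exactly the finitary endofunctors on the categories $\mathbf{Set}_{/Q}$ ($Q$ a set) that weakly preserve wide pullbacks, and as its morphisms exactly the weakly cartesian natural transformations between them. That is: an endofunctor $P:\mathbf{Set}_{/Q}\to\mathbf{Set}_{/Q}$ is an object of $An$ if and only if it is finitary and weakly preserves wide pullbacks; and for objects $P$ over $O$ and $R$ over $Q$ and a function $u:O\to Q$, a natural transformation $\tau:Pu^*\to u^*R$ is a morphism of $An$ over $u$ if and only if it is weakly cartesian.
   Context: Notation: $[n]=\{0,\dots,n\}$, $(n]=\{1,\dots,n\}$; $S_n$ is the group of permutations of $(n]$, acting on $[n]$ with $0$ fixed. Symmetric signatures. A symmetric set $(A,\alpha)$ is a family of sets $(A_n)_{n\in\omega}$ with right actions of $S_n$ on $A_n$, written $a\cdot\sigma$; for $a\in A_n$ put $|a|=n$. Morphisms are families of equivariant maps. For a set $O$, $O^\ddagger$ is the symmetric set with $(O^\ddagger)_n=O^{[n]}$ and $d\cdot\sigma=d\circ\sigma$; for $u:O\to Q$, $u^\ddagger(d)=u\circ d$. A symmetric signature over $O$ is $(A,\alpha,\partial^A,O)$ with $\partial^A:(A,\alpha)\to O^\ddagger$ equivariant; write $\partial^A_a:[|a|]\to O$, and $\partial^{A,+}_a$ for its restriction to $(|a|]$. A morphism $(f,u):(A,\alpha,\partial^A,O)\to(B,\beta,\partial^B,Q)$ over $u:O\to Q$ is an equivariant $f$ with $\partial^B f=u^\ddagger\partial^A$. This gives a fibration $p_s:Sig_s\to\mathbf{Set}$.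 $Exp(\mathbf{Set})$. For $u:O\to Q$, $u^*:\mathbf{Set}_{/Q}\to\mathbf{Set}_{/O}$ is the pullback functor, and $u^Y:u^*(Y)\to Y$ the projection. Objects of $Exp(\mathbf{Set})$ over $O$ are endofunctors of $\mathbf{Set}_{/O}$; a morphism from $P$ (over $O$) to $R$ (over $Q$) over $u$ is a natural transformation $Pu^*\to u^*R$; composition is by pasting, using $(vu)^*\cong u^*v^*$. The representation $rep_s:Sig_s\to Exp(\mathbf{Set})$. For $(A,\alpha,\partial^A,O)$ and $d^X:X\to O$, $A\star X$ is the quotient of $\{(a,\vec{x}):a\in A,\ \vec{x}:(|a|]\to X,\ d^X\circ\vec{x}=\partial^{A,+}_a\}$ by the equivalence $(a,\vec{x})\sim(a\cdot\sigma,\vec{x}\circ\sigma)$, $\sigma\in S_{|a|}$, with map to $O$ sending $[a,\vec{x}]$ to $\partial^A_a(0)$. Then $rep_s(A)=A\star(-)$, and for $(f,u):A\to B$ over $u:O\to Q$, $rep_s(f,u)_Y:A\star u^*(Y)\to u^*(B\star Y)$ sends $[a,\vec{x}]$ to $\langle\partial^A_a(0),[f(a),u^Y\circ\vec{x}]\rangle$. $p_{an}:An\to\mathbf{Set}$ is by definition the essential image of $rep_s$ in $Exp(\mathbf{Set})$: the objects over $O$ (analytic functors) are the endofunctors of $\mathbf{Set}_{/O}$ isomorphic to some $A\star(-)$, and the morphisms (analytic transformations) over $u$ are the natural transformations which, up to such isomorphisms, are of the form $rep_s(f,u)$. A functor weakly preserves wide pullbacks if it sends wide pullback cones to weak limit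 cones; a natural transformation is weakly cartesian if all its naturality squares are weak pullbacks. Finitary means preserving filtered colimits. *)

theory Defs
  imports "HOL-Library.FuncSet" "HOL-Library.Infinite_Set" "HOL-Combinatorics.Permutations"
begin

section \<open>Categories, functors, limits\<close>

record ('o, 'm) category =
  Obj :: "'o set"
  Arr :: "'m set"
  Dom :: "'m \<Rightarrow> 'o"
  Cod :: "'m \<Rightarrow> 'o"
  Ident :: "'o \<Rightarrow> 'm"
  Comp :: "'m \<Rightarrow> 'm \<Rightarrow> 'm"

definition hom :: "('o, 'm, 'z) category_scheme \<Rightarrow> 'o \<Rightarrow> 'o \<Rightarrow> 'm set" where
  "hom C X Y = {f \<in> Arr C. Dom C f = X \<and> Cod C f = Y}"

definition is_category :: "('o, 'm, 'z) category_scheme \<Rightarrow> bool" where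
  "is_category C \<longleftrightarrow>
     (\<forall>f\<in>Arr C. Dom C f \<in> Obj C \<and> Cod C f \<in> Obj C) \<and>
     (\<forall>X\<in>Obj C. Ident C X \<in> hom C X X) \<and>
     (\<forall>f\<in>Arr C. \<forall>g\<in>Arr C. Cod C f = Dom C g \<longrightarrow> Comp C g f \<in> hom C (Dom C f) (Cod C g)) \<and>
     (\<forall>f\<in>Arr C. Comp C f (Ident C (Dom C f)) = f \<and> Comp C (Ident C (Cod C f)) f = f) \<and>
     (\<forall>f\<in>Arr C. \<forall>g\<in>Arr C. \<forall>h\<in>Arr C. Cod C f = Dom C g \<longrightarrow> Cod C g = Dom C h \<longrightarrow>
        Comp C h (Comp C g f) = Comp C (Comp C h g) f)"

record ('o, 'm, 'p, 'n) fctr =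
  on_ob :: "'o \<Rightarrow> 'p"
  on_ar :: "'m \<Rightarrow> 'n"

definition is_functor ::
  "('o, 'm) category \<Rightarrow> ('p, 'n) category \<Rightarrow> ('o, 'm, 'p, 'n) fctr \<Rightarrow> bool" where
  "is_functor C D F \<longleftrightarrow>
     (\<forall>X\<in>Obj C. on_ob F X \<in> Obj D) \<and>
     (\<forall>f\<in>Arr C. on_ar F f \<in> hom D (on_ob F (Dom C f)) (on_ob F (Cod C f))) \<and>
     (\<forall>X\<in>Obj C. on_ar F (Ident C X) = Ident D (on_ob F X)) \<and>
     (\<forall>f\<in>Arr C. \<forall>g\<in>Arr C. Cod C f = Dom C g \<longrightarrow>
        on_ar F (Comp C g f) = Comp D (on_ar F g) (on_ar F f))"

definition fcomp :: "('p, 'n, 'q, 'k) fctr \<Rightarrow> ('o, 'm, 'p, 'n) fctr \<Rightarrow> ('o, 'm, 'q, 'k) fctr"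
  (infixl \<open>\<circ>\<^sub>F\<close> 55) where
  "G \<circ>\<^sub>F F = \<lparr> on_ob = on_ob G \<circ> on_ob F, on_ar = on_ar G \<circ> on_ar F \<rparr>"

definition is_nat_trans ::
  "('o, 'm) category \<Rightarrow> ('p, 'n) category \<Rightarrow> ('o, 'm, 'p, 'n) fctr \<Rightarrow> ('o, 'm, 'p, 'n) fctr
   \<Rightarrow> ('o \<Rightarrow> 'n) \<Rightarrow> bool" where
  "is_nat_trans C D F G \<tau> \<longleftrightarrow>
     (\<forall>X\<in>Obj C. \<tau> X \<in> hom D (on_ob F X) (on_ob G X)) \<and>
     (\<forall>f\<in>Arr C. Comp D (\<tau> (Cod C f)) (on_ar F f) = Comp D (on_ar G f) (\<tau> (Dom C f)))"

definition is_filtered :: "('o, 'm) category \<Rightarrow> bool" where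
  "is_filtered J \<longleftrightarrow>
     Obj J \<noteq> {} \<and>
     (\<forall>i\<in>Obj J. \<forall>j\<in>Obj J. \<exists>k\<in>Obj J. hom J i k \<noteq> {} \<and> hom J j k \<noteq> {}) \<and>
     (\<forall>i\<in>Obj J. \<forall>j\<in>Obj J. \<forall>f\<in>hom J i j. \<forall>g\<in>hom J i j.
        \<exists>k\<in>Obj J. \<exists>h\<in>hom J j k. Comp J h f = Comp J h g)"

definition is_cocone ::
  "('i, 'e) category \<Rightarrow> ('o, 'm) category \<Rightarrow> ('i, 'e, 'o, 'm) fctr \<Rightarrow> 'o \<Rightarrow> ('i \<Rightarrow> 'm) \<Rightarrow> bool" where
  "is_cocone J C D L c \<longleftrightarrow>
     L \<in> Obj C \<and>
     (\<forall>j\<in>Obj J. c j \<in> hom C (on_ob D j) L) \<and>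
     (\<forall>e\<in>Arr J. Comp C (c (Cod J e)) (on_ar D e) = c (Dom J e))"

definition is_colimit ::
  "('i, 'e) category \<Rightarrow> ('o, 'm) category \<Rightarrow> ('i, 'e, 'o, 'm) fctr \<Rightarrow> 'o \<Rightarrow> ('i \<Rightarrow> 'm) \<Rightarrow> bool" where
  "is_colimit J C D L c \<longleftrightarrow>
     is_cocone J C D L c \<and>
     (\<forall>M b. is_cocone J C D M b \<longrightarrow>
        (\<exists>!h. h \<in> hom C L M \<and> (\<forall>j\<in>Obj J. Comp C h (c j) = b j)))"

text \<open>Cones over a wide cospan \<open>f i : X i \<rightarrow> X\<close> (\<open>i \<in> I\<close>); \<open>p\<close> is the leg to the
  base \<open>X\<close>, \<open>q i\<close> the leg to \<open>X i\<close>.\<close>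

definition wide_cone ::
  "('o, 'm) category \<Rightarrow> 'i set \<Rightarrow> 'o \<Rightarrow> ('i \<Rightarrow> 'm) \<Rightarrow> 'o \<Rightarrow> 'm \<Rightarrow> ('i \<Rightarrow> 'm) \<Rightarrow> bool" where
  "wide_cone C I X f L p q \<longleftrightarrow>
     L \<in> Obj C \<and> p \<in> hom C L X \<and>
     (\<forall>i\<in>I. q i \<in> hom C L (Dom C (f i)) \<and> Comp C (f i) (q i) = p)"

definition is_wide_pullback ::
  "('o, 'm) category \<Rightarrow> 'i set \<Rightarrow> 'o \<Rightarrow> ('i \<Rightarrow> 'm) \<Rightarrow> 'o \<Rightarrow> 'm \<Rightarrow> ('i \<Rightarrow> 'm) \<Rightarrow> bool" where
  "is_wide_pullback C I X f L p q \<longleftrightarrow>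
     wide_cone C I X f L p q \<and>
     (\<forall>M p' q'. wide_cone C I X f M p' q' \<longrightarrow>
        (\<exists>!h. h \<in> hom C M L \<and> Comp C p h = p' \<and> (\<forall>i\<in>I. Comp C (q i) h = q' i)))"

definition is_weak_wide_pullback ::
  "('o, 'm) category \<Rightarrow> 'i set \<Rightarrow> 'o \<Rightarrow> ('i \<Rightarrow> 'm) \<Rightarrow> 'o \<Rightarrow> 'm \<Rightarrow> ('i \<Rightarrow> 'm) \<Rightarrow> bool" where
  "is_weak_wide_pullback C I X f L p q \<longleftrightarrow>
     wide_cone C I X f L p q \<and>
     (\<forall>M p' q'. wide_cone C I X f M p' q' \<longrightarrow>
        (\<exists>h. h \<in> hom C M L \<and> Comp C p h = p' \<and> (\<forall>i\<in>I. Comp C (q i) h = q' i)))"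

text \<open>The square \<open>a p = b q\<close> with \<open>p : L \<rightarrow> A\<close>, \<open>q : L \<rightarrow> B\<close>, \<open>a : A \<rightarrow> X\<close>, \<open>b : B \<rightarrow> X\<close>.\<close>

definition is_weak_pullback :: "('o, 'm) category \<Rightarrow> 'm \<Rightarrow> 'm \<Rightarrow> 'm \<Rightarrow> 'm \<Rightarrow> bool" where
  "is_weak_pullback C p q a b \<longleftrightarrow>
     p \<in> Arr C \<and> q \<in> Arr C \<and> a \<in> Arr C \<and> b \<in> Arr C \<and>
     Dom C p = Dom C q \<and> Cod C p = Dom C a \<and> Cod C q = Dom C b \<and> Cod C a = Cod C b \<and>
     Comp C a p = Comp C b q \<and>
     (\<forall>M\<in>Obj C. \<forall>p'\<in>hom C M (Dom C a). \<forall>q'\<in>hom C M (Dom C b). Comp C a p' = Comp C b q' \<longrightarrow>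
        (\<exists>h\<in>hom C M (Dom C p). Comp C p h = p' \<and> Comp C q h = q'))"

definition weakly_cartesian ::
  "('o, 'm) category \<Rightarrow> ('p, 'n) category \<Rightarrow> ('o, 'm, 'p, 'n) fctr \<Rightarrow> ('o, 'm, 'p, 'n) fctr
   \<Rightarrow> ('o \<Rightarrow> 'n) \<Rightarrow> bool" where
  "weakly_cartesian C D F G \<tau> \<longleftrightarrow>
     (\<forall>f\<in>Arr C. is_weak_pullback D (on_ar F f) (\<tau> (Dom C f)) (\<tau> (Cod C f)) (on_ar G f))"

text \<open>\<open>U\<close> is the collection of small sets: filtered colimits and wide pullbacks are the
  \<open>U\<close>-small ones. Index categories and index sets live on elements of the type underlying \<open>U\<close>.\<close>

definition finitary ::
  "'u set set \<Rightarrow> ('o, 'm) category \<Rightarrow> ('p, 'n) category \<Rightarrow> ('o, 'm, 'p, 'n) fctr \<Rightarrow> bool" where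
  "finitary U C D F \<longleftrightarrow>
     (\<forall>(J :: ('u, 'u) category) \<Delta> L c.
        is_category J \<and> Obj J \<in> U \<and> Arr J \<in> U \<and> is_filtered J \<and>
        is_functor J C \<Delta> \<and> is_colimit J C \<Delta> L c \<longrightarrow>
        is_colimit J D (F \<circ>\<^sub>F \<Delta>) (on_ob F L) (\<lambda>j. on_ar F (c j)))"

definition weakly_preserves_wide_pullbacks ::
  "'u set set \<Rightarrow> ('o, 'm) category \<Rightarrow> ('p, 'n) category \<Rightarrow> ('o, 'm, 'p, 'n) fctr \<Rightarrow> bool" where
  "weakly_preserves_wide_pullbacks U C D F \<longleftrightarrow>
     (\<forall>I X f L p q.
        I \<in> U \<and> X \<in> Obj C \<and> (\<forall>i\<in>I. f i \<in> Arr C \<and> Cod C (f i) = X) \<and>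
        is_wide_pullback C I X f L p q \<longrightarrow>
        is_weak_wide_pullback D I (on_ob F X) (\<lambda>i. on_ar F (f i))
          (on_ob F L) (on_ar F p) (\<lambda>i. on_ar F (q i)))"


section \<open>The category of sets and its slices\<close>

text \<open>
  The category of sets is the category of sets \<open>X \<in> U\<close>, where \<open>U\<close> is a collection of
  \<^emph>\<open>small\<close> subsets of a type. Every Grothendieck universe with an infinite member
  qualifies (\<open>set_universe_if_power_closed\<close>), and so does the collection of all subsets of
  any type that contains a copy of the continuum (\<open>set_universe_UNIV\<close>), so that the
  assumption is satisfiable in HOL. Closure under power sets is not required; without it
  some wide cospans have no limit, and the preservation property concerns the limit
  cones that exist. The injection \<open>pr\<close> is an arbitrary encoding of ordered
  pairs; it only serves to choose pullbacks inside \<open>U\<close>.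
\<close>

definition set_universe :: "'u set set \<Rightarrow> ('u \<times> 'u \<Rightarrow> 'u) \<Rightarrow> bool" where
  "set_universe U pr \<longleftrightarrow>
     inj pr \<and>
     (\<forall>S\<in>U. \<forall>T. T \<subseteq> S \<longrightarrow> T \<in> U) \<and>
     (\<forall>S\<in>U. \<forall>g. g ` S \<in> U) \<and>
     (\<forall>S\<in>U. \<forall>T. (\<forall>s\<in>S. T s \<in> U) \<longrightarrow> (\<Union>s\<in>S. T s) \<in> U) \<and>
     (\<exists>g :: nat set \<Rightarrow> 'u. inj g \<and> range g \<in> U)"

lemma set_universe_UNIV:
  fixes g :: "nat set \<Rightarrow> 'u"
  assumes "inj pr" "inj g"
  shows "set_universe (UNIV :: 'u set set) pr"
  using assms unfolding set_universe_def by auto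

lemma set_universe_if_power_closed:
  fixes U :: "'u set set"
  assumes "inj pr"
    and sub: "\<And>S T. S \<in> U \<Longrightarrow> T \<subseteq> S \<Longrightarrow> T \<in> U"
    and "\<And>S g. S \<in> U \<Longrightarrow> g ` S \<in> U"
    and "\<And>S T. S \<in> U \<Longrightarrow> (\<And>s. s \<in> S \<Longrightarrow> T s \<in> U) \<Longrightarrow> (\<Union>s\<in>S. T s) \<in> U"
    and pow: "\<And>S. S \<in> U \<Longrightarrow> \<exists>e. inj_on e (Pow S) \<and> e ` Pow S \<in> U"
    and inf: "S\<^sub>0 \<in> U" "infinite S\<^sub>0"
  shows "set_universe U pr"
proof -
  obtain k :: "nat \<Rightarrow> 'u" where k: "inj k" "range k \<subseteq> S\<^sub>0"
    using infinite_countable_subset[OF inf(2)] by blast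
  obtain e where e: "inj_on e (Pow S\<^sub>0)" "e ` Pow S\<^sub>0 \<in> U"
    using pow[OF inf(1)] by blast
  have kS: "k ` N \<in> Pow S\<^sub>0" for N using k(2) by blast
  have "inj (\<lambda>N. e (k ` N))"
  proof (rule injI)
    fix M N assume "e (k ` M) = e (k ` N)"
    then have "k ` M = k ` N" by (rule inj_onD[OF e(1) _ kS kS])
    then show "M = N" by (simp add: inj_image_eq_iff[OF k(1)])
  qed
  moreover have "range (\<lambda>N. e (k ` N)) \<in> U"
    using kS by (intro sub[OF e(2)]) blast
  ultimately have "\<exists>g :: nat set \<Rightarrow> 'u. inj g \<and> range g \<in> U" by blast
  with assms show ?thesis unfolding set_universe_def by auto
qed

record ('x, 'q) over =
  carr :: "'x set"
  disp :: "'x \<Rightarrow> 'q"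

record ('x, 'q) over_arr =
  src :: "('x, 'q) over"
  fn :: "'x \<Rightarrow> 'x"
  tgt :: "('x, 'q) over"

definition over_obj :: "'x set set \<Rightarrow> 'q set \<Rightarrow> ('x, 'q) over set" where
  "over_obj U Q = {X. carr X \<in> U \<and> disp X \<in> carr X \<rightarrow>\<^sub>E Q}"

definition Slice :: "'x set set \<Rightarrow> 'q set \<Rightarrow> (('x, 'q) over, ('x, 'q) over_arr) category" where
  "Slice U Q =
     \<lparr> Obj = over_obj U Q,
       Arr = {h. src h \<in> over_obj U Q \<and> tgt h \<in> over_obj U Q \<and>
                 fn h \<in> carr (src h) \<rightarrow>\<^sub>E carr (tgt h) \<and>
                 (\<forall>x\<in>carr (src h). disp (tgt h) (fn h x) = disp (src h) x)},
       Dom = src,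
       Cod = tgt,
       Ident = (\<lambda>X. \<lparr> src = X, fn = (\<lambda>x\<in>carr X. x), tgt = X \<rparr>),
       Comp = (\<lambda>g f. \<lparr> src = src f, fn = compose (carr (src f)) (fn g) (fn f), tgt = tgt g \<rparr>) \<rparr>"

lemma is_category_Slice: "is_category (Slice U Q)"
  unfolding is_category_def
proof (intro conjI ballI impI)
  note S = Slice_def hom_def over_obj_def PiE_iff
  fix f g h assume f: "f \<in> Arr (Slice U Q)" and g: "g \<in> Arr (Slice U Q)" and h: "h \<in> Arr (Slice U Q)"
    and "Cod (Slice U Q) f = Dom (Slice U Q) g" "Cod (Slice U Q) g = Dom (Slice U Q) h"
  then have "compose (carr (src f)) (fn h) (compose (carr (src f)) (fn g) (fn f)) =
             compose (carr (src f)) (compose (carr (src g)) (fn h) (fn g)) (fn f)"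
    by (intro compose_assoc) (auto simp: S)
  then show "Comp (Slice U Q) h (Comp (Slice U Q) g f) = Comp (Slice U Q) (Comp (Slice U Q) h g) f"
    by (simp add: Slice_def)
next
  fix f assume "f \<in> Arr (Slice U Q)"
  then have "fn f \<in> carr (src f) \<rightarrow> carr (tgt f)" "fn f \<in> extensional (carr (src f))"
    by (auto simp: Slice_def PiE_iff)
  then show "Comp (Slice U Q) f (Ident (Slice U Q) (Dom (Slice U Q) f)) = f"
    "Comp (Slice U Q) (Ident (Slice U Q) (Cod (Slice U Q) f)) f = f"
    by (auto simp: Slice_def compose_Id Id_compose)
qed (auto simp: Slice_def hom_def over_obj_def PiE_iff compose_def)

text \<open>
  Pullback along \<open>u : K \<rightarrow> Q\<close>, with pairs encoded by an injection \<open>e\<close> (\<open>e = id\<close> gives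
  literal pairs). The projection \<open>u\<^sup>Y : u\<^sup>*Y \<rightarrow> Y\<close> is \<open>snd \<circ> inv e\<close>.
\<close>

definition pull_ob ::
  "('k \<times> 'y \<Rightarrow> 'z) \<Rightarrow> 'k set \<Rightarrow> ('k \<Rightarrow> 'q) \<Rightarrow> ('y, 'q) over \<Rightarrow> ('z, 'k) over" where
  "pull_ob e K u Y =
     (let Z = e ` {(k, y). k \<in> K \<and> y \<in> carr Y \<and> u k = disp Y y}
      in \<lparr> carr = Z, disp = (\<lambda>z\<in>Z. fst (inv e z)) \<rparr>)"

definition pull ::
  "('k \<times> 'y \<Rightarrow> 'z) \<Rightarrow> 'k set \<Rightarrow> ('k \<Rightarrow> 'q)
   \<Rightarrow> (('y, 'q) over, ('y, 'q) over_arr, ('z, 'k) over, ('z, 'k) over_arr) fctr" where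
  "pull e K u =
     \<lparr> on_ob = pull_ob e K u,
       on_ar = (\<lambda>h. \<lparr> src = pull_ob e K u (src h),
                      fn = (\<lambda>z\<in>carr (pull_ob e K u (src h)). e (apsnd (fn h) (inv e z))),
                      tgt = pull_ob e K u (tgt h) \<rparr>) \<rparr>"


section \<open>Symmetric signatures and their representation\<close>

text \<open>The function \<open>\<partial>\<^sub>a : {0..n} \<rightarrow> K\<close> is \<open>bd A n a\<close>. A permutation in the sense of
  \<open>permutes {1..n}\<close> fixes every number outside \<open>{1..n}\<close>, in particular \<open>0\<close>.\<close>

record ('a, 'k) sym_sig =
  ops :: "nat \<Rightarrow> 'a set"
  act :: "nat \<Rightarrow> 'a \<Rightarrow> (nat \<Rightarrow> nat) \<Rightarrow> 'a"
  bd :: "nat \<Rightarrow> 'a \<Rightarrow> nat \<Rightarrow> 'k"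

definition is_sym_sig :: "'a set set \<Rightarrow> 'k set \<Rightarrow> ('a, 'k) sym_sig \<Rightarrow> bool" where
  "is_sym_sig U K A \<longleftrightarrow>
     (\<forall>n. ops A n \<in> U) \<and>
     (\<forall>n. \<forall>a\<in>ops A n. act A n a id = a) \<and>
     (\<forall>n. \<forall>a\<in>ops A n. \<forall>\<sigma>. \<sigma> permutes {1..n} \<longrightarrow> act A n a \<sigma> \<in> ops A n) \<and>
     (\<forall>n. \<forall>a\<in>ops A n. \<forall>\<sigma> \<rho>. \<sigma> permutes {1..n} \<longrightarrow> \<rho> permutes {1..n} \<longrightarrow>
        act A n (act A n a \<sigma>) \<rho> = act A n a (\<sigma> \<circ> \<rho>)) \<and>
     (\<forall>n. \<forall>a\<in>ops A n. bd A n a \<in> {0..n} \<rightarrow>\<^sub>E K) \<and>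
     (\<forall>n. \<forall>a\<in>ops A n. \<forall>\<sigma>. \<sigma> permutes {1..n} \<longrightarrow> bd A n (act A n a \<sigma>) = bd A n a \<circ> \<sigma>)"

definition is_sig_mor ::
  "('a, 'k) sym_sig \<Rightarrow> ('b, 'q) sym_sig \<Rightarrow> ('k \<Rightarrow> 'q) \<Rightarrow> (nat \<Rightarrow> 'a \<Rightarrow> 'b) \<Rightarrow> bool" where
  "is_sig_mor A B u f \<longleftrightarrow>
     (\<forall>n. \<forall>a\<in>ops A n. f n a \<in> ops B n) \<and>
     (\<forall>n. \<forall>a\<in>ops A n. \<forall>\<sigma>. \<sigma> permutes {1..n} \<longrightarrow> f n (act A n a \<sigma>) = act B n (f n a) \<sigma>) \<and>
     (\<forall>n. \<forall>a\<in>ops A n. \<forall>i\<in>{0..n}. bd B n (f n a) i = u (bd A n a i))"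

type_synonym ('a, 'x) tuple = "nat \<times> 'a \<times> (nat \<Rightarrow> 'x)"

definition star_tuples :: "('a, 'k) sym_sig \<Rightarrow> ('x, 'k) over \<Rightarrow> ('a, 'x) tuple set" where
  "star_tuples A X =
     {(n, a, x). a \<in> ops A n \<and> x \<in> {1..n} \<rightarrow>\<^sub>E carr X \<and> (\<forall>i\<in>{1..n}. disp X (x i) = bd A n a i)}"

definition star_rel :: "('a, 'k) sym_sig \<Rightarrow> ('x, 'k) over \<Rightarrow> ('a, 'x) tuple rel" where
  "star_rel A X =
     {((n, a, x), (n, act A n a \<sigma>, x \<circ> \<sigma>)) | n a x \<sigma>.
        (n, a, x) \<in> star_tuples A X \<and> \<sigma> permutes {1..n}}"

text \<open>Functions on equivalence classes are defined from representatives: \<open>the_elem\<close> and the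
  union below range over values which do not depend on the representative.\<close>

definition root_colour :: "('a, 'k) sym_sig \<Rightarrow> ('a, 'x) tuple set \<Rightarrow> 'k" where
  "root_colour A c = the_elem ((\<lambda>(n, a, x). bd A n a 0) ` c)"

definition star_ob ::
  "('a, 'k) sym_sig \<Rightarrow> ('x, 'k) over \<Rightarrow> (('a, 'x) tuple set, 'k) over" where
  "star_ob A X =
     (let Z = star_tuples A X // star_rel A X
      in \<lparr> carr = Z, disp = (\<lambda>c\<in>Z. root_colour A c) \<rparr>)"

definition star ::
  "('a, 'k) sym_sig \<Rightarrow> (('x, 'k) over, ('x, 'k) over_arr,
     (('a, 'x) tuple set, 'k) over, (('a, 'x) tuple set, 'k) over_arr) fctr" where
  "star A =
     \<lparr> on_ob = star_ob A,
       on_ar = (\<lambda>h. \<lparr> src = star_ob A (src h),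
                      fn = (\<lambda>c\<in>carr (star_ob A (src h)).
                              \<Union>(n, a, x)\<in>c. star_rel A (tgt h) `` {(n, a, compose {1..n} (fn h) x)}),
                      tgt = star_ob A (tgt h) \<rparr>) \<rparr>"

text \<open>The underlying function of \<open>rep\<^sub>s(f, u)\<^sub>Y : A \<star> u\<^sup>*Y \<rightarrow> u\<^sup>*(B \<star> Y)\<close>, where the inner
  \<open>u\<^sup>*\<close> encodes pairs by \<open>pr\<close> and the outer one is \<open>pull_ob id\<close>.\<close>

definition rep_fn ::
  "('k \<times> 'y \<Rightarrow> 'z) \<Rightarrow> ('a, 'k) sym_sig \<Rightarrow> ('b, 'q) sym_sig \<Rightarrow> (nat \<Rightarrow> 'a \<Rightarrow> 'b)
   \<Rightarrow> ('y, 'q) over \<Rightarrow> ('a, 'z) tuple set \<Rightarrow> 'k \<times> ('b, 'y) tuple set" where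
  "rep_fn pr A B f Y c =
     (root_colour A c,
      \<Union>(n, a, x)\<in>c. star_rel B Y `` {(n, f n a, compose {1..n} (snd \<circ> inv pr) x)})"


section \<open>Analytic functors and analytic transformations\<close>

text \<open>Natural isomorphism of two functors into sets over the same base. The carriers may have
  different types, since \<open>A \<star> X\<close> consists of equivalence classes.\<close>

definition is_over_iso ::
  "('o, 'm) category \<Rightarrow> ('o, 'm, ('x, 'k) over, ('x, 'k) over_arr) fctr
   \<Rightarrow> ('o, 'm, ('y, 'k) over, ('y, 'k) over_arr) fctr \<Rightarrow> ('o \<Rightarrow> 'x \<Rightarrow> 'y) \<Rightarrow> bool" where
  "is_over_iso C F G \<phi> \<longleftrightarrow>
     (\<forall>X\<in>Obj C. bij_betw (\<phi> X) (carr (on_ob F X)) (carr (on_ob G X)) \<and>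
        (\<forall>z\<in>carr (on_ob F X). disp (on_ob G X) (\<phi> X z) = disp (on_ob F X) z)) \<and>
     (\<forall>h\<in>Arr C. \<forall>z\<in>carr (on_ob F (Dom C h)).
        \<phi> (Cod C h) (fn (on_ar F h) z) = fn (on_ar G h) (\<phi> (Dom C h) z))"

type_synonym ('x, 'q) endo =
  "(('x, 'q) over, ('x, 'q) over_arr, ('x, 'q) over, ('x, 'q) over_arr) fctr"

definition analytic_functor :: "'u set set \<Rightarrow> 'u set \<Rightarrow> ('u, 'u) endo \<Rightarrow> bool" where
  "analytic_functor U Q P \<longleftrightarrow>
     is_functor (Slice U Q) (Slice U Q) P \<and>
     (\<exists>(A :: ('u, 'u) sym_sig) \<phi>. is_sym_sig U Q A \<and> is_over_iso (Slice U Q) P (star A) \<phi>)"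

text \<open>\<open>\<tau> : P u\<^sup>* \<rightarrow> u\<^sup>* R\<close> becomes \<open>rep\<^sub>s(f, u)\<close> under isomorphisms \<open>\<phi> : P \<cong> A \<star> -\<close> and
  \<open>\<psi> : R \<cong> B \<star> -\<close>, that is, \<open>u\<^sup>*\<psi> \<circ> \<tau> = rep\<^sub>s(f, u) \<circ> \<phi>u\<^sup>*\<close>.\<close>

definition analytic_transformation ::
  "'u set set \<Rightarrow> ('u \<times> 'u \<Rightarrow> 'u) \<Rightarrow> 'u set \<Rightarrow> 'u set \<Rightarrow> ('u \<Rightarrow> 'u) \<Rightarrow> ('u, 'u) endo \<Rightarrow> ('u, 'u) endo
   \<Rightarrow> (('u, 'u) over \<Rightarrow> ('u, 'u) over_arr) \<Rightarrow> bool" where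
  "analytic_transformation U pr K Q u P R \<tau> \<longleftrightarrow>
     is_nat_trans (Slice U Q) (Slice U K) (P \<circ>\<^sub>F pull pr K u) (pull pr K u \<circ>\<^sub>F R) \<tau> \<and>
     (\<exists>(A :: ('u, 'u) sym_sig) (B :: ('u, 'u) sym_sig) \<phi> \<psi> f.
        is_sym_sig U K A \<and> is_over_iso (Slice U K) P (star A) \<phi> \<and>
        is_sym_sig U Q B \<and> is_over_iso (Slice U Q) R (star B) \<psi> \<and>
        is_sig_mor A B u f \<and>
        (\<forall>Y\<in>Obj (Slice U Q). \<forall>z\<in>carr (on_ob P (pull_ob pr K u Y)).
           apsnd (\<psi> Y) (inv pr (fn (\<tau> Y) z)) = rep_fn pr A B f Y (\<phi> (pull_ob pr K u Y) z)))"

end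

(* Joyal's argument, organised around the category of elements of P. For an analytic functor
   everything is computed on tuples: an element of A * X is a pair [a, x] with x a finite tuple,
   unique up to a permutation, and finiteness of x gives the preservation of filtered colimits while
   entrywise liftings give wide pullbacks.

   Conversely, call an element a of P over a finite object generic if every arrow into it in the
   category of elements splits. If P is finitary and weakly preserves wide pullbacks, every z in P X
   is the image of a generic element: countably many elements over z have a common finite
   refinement, so the least size of a refinement is bounded on the elements over z, and an element
   where it is maximal, cut down to that size, is generic. Two generic elements over z differ by a
   permutation. Hence the generic elements over the objects (n] form a symmetric signature that
   represents P.

   For transformations, evaluating tau at the universal tuple of an operation a yields some [b, y],
   and the naturality square of y forces y to be a bijection when tau is weakly cartesian; so a
   determines an operation f(a) of the same arity. *)

theory Submission
  imports Defs "HOL-Library.Nat_Bijection"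
begin

text \<open>Carriers and index sets consist of elements of \<open>'u\<close>, so classes, tuples and
  index categories are first shown to be small and then coded in \<open>'u\<close>. Closure of
  \<open>U\<close> under power sets is not among the assumptions, so wide pullbacks have to be built
  by hand. Over countably many finite objects this works: a point is an element of the base together
  with a sequence of numbers, and \<open>U\<close> has a member of the size of the continuum.
  Equivalence classes are kept out of the arguments. An isomorphism with \<open>star A\<close> is
  restated as a naming of elements by tuples, unique up to permutation; a given isomorphism and the
  generic elements both produce such a naming. The arity of an element cannot be seen from the
  element itself: the element named by \<open>a\<close> and the tuple \<open>(x, x)\<close> already
  comes from a one-point object, and only a refinement separates the two entries. This is why the
  minimal size is maximised over everything that maps to \<open>z\<close>.\<close>

declare One_nat_def [simp del]

section \<open>Small sets\<close>

locale universe =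
  fixes U :: "'u set set" and pr :: "'u \<times> 'u \<Rightarrow> 'u"
  assumes set_universe: "set_universe U pr"
begin

lemma inj_pr: "inj pr"
  using set_universe by (simp add: set_universe_def)

lemma inv_pr [simp]: "inv pr (pr p) = p"
  by (rule inv_f_f[OF inj_pr])

lemma pr_eq_iff [simp]: "pr p = pr q \<longleftrightarrow> p = q"
  using inj_pr by (auto dest: injD)

lemma subset_in_U: "S \<in> U \<Longrightarrow> T \<subseteq> S \<Longrightarrow> T \<in> U"
  using set_universe by (auto simp: set_universe_def)

lemma image_in_U: "S \<in> U \<Longrightarrow> g ` S \<in> U"
  using set_universe by (auto simp: set_universe_def)

lemma UN_in_U: "S \<in> U \<Longrightarrow> (\<And>s. s \<in> S \<Longrightarrow> T s \<in> U) \<Longrightarrow> (\<Union>s\<in>S. T s) \<in> U"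
  using set_universe unfolding set_universe_def by blast

text \<open>Smallness for sets of any type: lists, functions and pairs can be measured before they
  are coded in \<open>'u\<close>.\<close>

definition small :: "'t set \<Rightarrow> bool" where
  "small T \<longleftrightarrow> (\<exists>S\<in>U. \<exists>h. T \<subseteq> h ` S)"

lemma small_in_U_iff: "small X \<longleftrightarrow> X \<in> U"
proof
  show "X \<in> U" if "small X" using that by (auto simp: small_def intro: subset_in_U[OF image_in_U])
  show "small X" if "X \<in> U" unfolding small_def using that by (intro bexI[of _ X] exI[of _ id]) auto
qed

lemma small_subset: "small S \<Longrightarrow> T \<subseteq> S \<Longrightarrow> small T"
  unfolding small_def by blast

lemma small_image: "small S \<Longrightarrow> small (h ` S)"
  unfolding small_def
proof (elim bexE exE)
  fix T g assume "T \<in> U" "S \<subseteq> g ` T"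
  then show "\<exists>T\<in>U. \<exists>g. h ` S \<subseteq> g ` T"
    by (intro bexI[of _ T] exI[of _ "h \<circ> g"]) auto
qed

lemma small_UN:
  assumes T: "small T" and F: "\<And>t. t \<in> T \<Longrightarrow> small (F t)"
  shows "small (\<Union>t\<in>T. F t)"
proof -
  obtain S h where S: "S \<in> U" "T \<subseteq> h ` S" using T by (auto simp: small_def)
  have "\<forall>t\<in>T. \<exists>S h. S \<in> U \<and> F t \<subseteq> h ` S" using F by (simp add: small_def Bex_def)
  then obtain S' h' where S': "\<And>t. t \<in> T \<Longrightarrow> S' t \<in> U" "\<And>t. t \<in> T \<Longrightarrow> F t \<subseteq> h' t ` S' t"
    by metis
  \<comment> \<open>The covering sets may overlap in \<open>'u\<close>; tagging a point with an
    index \<open>s\<close> tells the decoding map which \<open>h' (h s)\<close> to apply.\<close>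
  define V where "V = (\<Union>s\<in>{s\<in>S. h s \<in> T}. (\<lambda>y. pr (s, y)) ` S' (h s))"
  have "V \<in> U" unfolding V_def
    using subset_in_U[OF S(1), of "{s\<in>S. h s \<in> T}"] by (intro UN_in_U image_in_U) (auto intro: S')
  moreover have "(\<Union>t\<in>T. F t) \<subseteq> (\<lambda>v. case inv pr v of (s, y) \<Rightarrow> h' (h s) y) ` V"
  proof
    fix w assume "w \<in> (\<Union>t\<in>T. F t)"
    then obtain t y where t: "t \<in> T" "y \<in> S' t" "w = h' t y" using S'(2) by blast
    then obtain s where s: "s \<in> S" "t = h s" using S by blast
    show "w \<in> (\<lambda>v. case inv pr v of (s, y) \<Rightarrow> h' (h s) y) ` V"
      using t s by (intro image_eqI[of _ _ "pr (s, y)"]) (auto simp: V_def)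
  qed
  ultimately show ?thesis unfolding small_def by blast
qed

lemma small_Times: "small S \<Longrightarrow> small T \<Longrightarrow> small (S \<times> T)"
  by (rule small_subset[OF small_UN[of S "\<lambda>s. Pair s ` T"]]) (auto intro: small_image)

section \<open>Codes for numbers, number sequences and finite tuples\<close>

definition code :: "nat set \<Rightarrow> 'u" where
  "code = (SOME g. inj g \<and> range g \<in> U)"

lemma code: "inj code" "range code \<in> U"
proof -
  have "\<exists>g :: nat set \<Rightarrow> 'u. inj g \<and> range g \<in> U"
    using set_universe by (simp add: set_universe_def)
  from someI_ex[OF this] show "inj code" "range code \<in> U" by (auto simp: code_def)
qed

text \<open>Numbers become codes of singletons inside the continuum-sized member of
  \<open>U\<close>, so \<open>range num\<close> is available as a countable index set and as a
  supply of finite carriers.\<close>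

definition num :: "nat \<Rightarrow> 'u" where
  "num k = code {k}"

lemma inj_num: "inj num"
  by (rule injI) (use injD[OF code(1)] in \<open>fastforce simp: num_def\<close>)

lemma inv_num [simp]: "inv num (num k) = k"
  by (rule inv_f_f[OF inj_num])

lemma num_eq_iff [simp]: "num i = num j \<longleftrightarrow> i = j"
  using inj_num by (auto dest: injD)

lemma range_num: "range num \<in> U"
  using subset_in_U[OF code(2), of "range num"] by (auto simp: num_def)

lemma small_nat_sets: "small (UNIV :: nat set set)"
  unfolding small_def using code by (intro bexI[of _ "range code"] exI[of _ "inv code"]) auto

lemma small_nats: "small (A :: nat set)"
proof -
  have "A \<subseteq> the_elem ` UNIV" by (auto intro: image_eqI[of _ the_elem "{x}" for x])
  then show ?thesis by (rule small_subset[OF small_image[OF small_nat_sets]])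
qed

text \<open>A function is recovered from the coded set of pairs in its graph. This is where the size
  of the continuum pays off: points of a countable wide pullback of finite objects involve such
  functions.\<close>

lemma small_nat_funs: "small (UNIV :: (nat \<Rightarrow> nat) set)"
proof -
  let ?h = "\<lambda>(N :: nat set) i. THE k. prod_encode (i, k) \<in> N"
  have "f = ?h {prod_encode (i, f i) |i. True}" for f :: "nat \<Rightarrow> nat" by auto
  then have "UNIV \<subseteq> range ?h" by blast
  then show ?thesis by (rule small_subset[OF small_image[OF small_nat_sets]])
qed

lemma small_singleton: "small {x}"
  using small_image[OF small_nats[of "{0}"], of "\<lambda>_. x"] by simp

lemma small_lists:
  assumes "small S"
  shows "small (lists S)"
proof -
  have "small {l \<in> lists S. length l = n}" for n
  proof (induction n)
    case 0
    then show ?case by (rule small_subset[OF small_singleton[of "[]"]]) auto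
  next
    case (Suc n)
    have "{l \<in> lists S. length l = Suc n} \<subseteq> (\<lambda>(s, l). s # l) ` (S \<times> {l \<in> lists S. length l = n})"
      by (force simp: length_Suc_conv)
    then show ?case by (rule small_subset[OF small_image[OF small_Times[OF assms Suc]]])
  qed
  then have "small (\<Union>n. {l \<in> lists S. length l = n})" by (intro small_UN small_nats)
  moreover have "(\<Union>n. {l \<in> lists S. length l = n}) = lists S" by auto
  ultimately show ?thesis by simp
qed

lemma small_vectors:
  assumes "small S"
  shows "small (\<Union>n. {1..n::nat} \<rightarrow>\<^sub>E S)"
proof (intro small_UN small_nats)
  fix n :: nat
  \<comment> \<open>Tuples are indexed from 1 and lists from 0; the bounded abstraction supplies the
    default value outside \<open>{1..n}\<close>.\<close>
  have "d \<in> (\<lambda>l. \<lambda>i\<in>{1..n}. l ! (i - 1)) ` lists S" if d: "d \<in> {1..n} \<rightarrow>\<^sub>E S" for d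
  proof (rule image_eqI)
    show "d = (\<lambda>i\<in>{1..n}. map (\<lambda>i. d (Suc i)) [0..<n] ! (i - 1))"
      using d by (auto simp: fun_eq_iff restrict_def PiE_iff extensional_def)
    show "map (\<lambda>i. d (Suc i)) [0..<n] \<in> lists S"
      using d by (auto simp: PiE_iff)
  qed
  then have "({1..n} \<rightarrow>\<^sub>E S) \<subseteq> (\<lambda>l. \<lambda>i\<in>{1..n}. l ! (i - 1)) ` lists S" by blast
  then show "small ({1..n} \<rightarrow>\<^sub>E S)"
    by (rule small_subset[OF small_image[OF small_lists[OF assms]]])
qed

lemma small_coding:
  assumes "small T"
  obtains e :: "'t \<Rightarrow> 'u" where "inj_on e (T :: 't set)" "e ` T \<in> U"
proof -
  obtain S h where S: "S \<in> U" "T \<subseteq> h ` S" using assms by (auto simp: small_def)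
  show thesis
    using S by (intro that[of "inv_into S h"] inj_on_inv_into subset_in_U[OF S(1)])
      (auto intro: inv_into_into)
qed

end

section \<open>Limits and colimits in slices\<close>

text \<open>Arrows of a slice carry extensional functions. Cutting a function down to the carrier
  makes two such arrows equal exactly when the functions agree there.\<close>

definition mk :: "('x, 'q) over \<Rightarrow> ('x, 'q) over \<Rightarrow> ('x \<Rightarrow> 'x) \<Rightarrow> ('x, 'q) over_arr" where
  "mk X Y f = \<lparr> src = X, fn = restrict f (carr X), tgt = Y \<rparr>"

lemma mk_simps [simp]: "src (mk X Y f) = X" "tgt (mk X Y f) = Y"
  by (simp_all add: mk_def)

lemma fn_mk [simp]: "x \<in> carr X \<Longrightarrow> fn (mk X Y f) x = f x"
  by (simp add: mk_def)

lemma mk_eq_iff: "mk X Y f = mk X Y g \<longleftrightarrow> (\<forall>x\<in>carr X. f x = g x)"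
  by (auto simp: mk_def restrict_def fun_eq_iff)

lemma mk_cong: "(\<And>x. x \<in> carr X \<Longrightarrow> f x = g x) \<Longrightarrow> mk X Y f = mk X Y g"
  by (simp add: mk_eq_iff)

context universe
begin

definition smor :: "'q set \<Rightarrow> ('u, 'q) over \<Rightarrow> ('u, 'q) over \<Rightarrow> ('u \<Rightarrow> 'u) \<Rightarrow> bool" where
  "smor Q X Y f \<longleftrightarrow> X \<in> over_obj U Q \<and> Y \<in> over_obj U Q \<and> f \<in> carr X \<rightarrow> carr Y \<and>
     (\<forall>x\<in>carr X. disp Y (f x) = disp X x)"

lemma smor_objs: "smor Q X Y f \<Longrightarrow> X \<in> over_obj U Q" "smor Q X Y f \<Longrightarrow> Y \<in> over_obj U Q"
  by (simp_all add: smor_def)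

lemma smor_in: "smor Q X Y f \<Longrightarrow> x \<in> carr X \<Longrightarrow> f x \<in> carr Y"
  by (auto simp: smor_def)

lemma smor_disp: "smor Q X Y f \<Longrightarrow> x \<in> carr X \<Longrightarrow> disp Y (f x) = disp X x"
  by (auto simp: smor_def)

lemma smor_id: "X \<in> over_obj U Q \<Longrightarrow> smor Q X X (\<lambda>x. x)"
  by (simp add: smor_def)

lemma smor_comp: "smor Q X Y f \<Longrightarrow> smor Q Y Z g \<Longrightarrow> smor Q X Z (\<lambda>x. g (f x))"
  by (auto simp: smor_def Pi_iff)

lemma Slice_simps [simp]:
  "Obj (Slice U Q) = over_obj U Q" "Dom (Slice U Q) = src" "Cod (Slice U Q) = tgt"
  "Ident (Slice U Q) X = mk X X (\<lambda>x. x)"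
  by (simp_all add: Slice_def mk_def)

lemma mk_in_hom_iff: "mk X Y f \<in> hom (Slice U Q) X Y \<longleftrightarrow> smor Q X Y f"
  by (auto simp: hom_def smor_def Slice_def mk_def)

lemma mk_in_Arr_iff: "mk X Y f \<in> Arr (Slice U Q) \<longleftrightarrow> smor Q X Y f"
  using mk_in_hom_iff[of X Y f Q] by (simp add: hom_def)

lemma hom_Slice_mk: "h \<in> hom (Slice U Q) X Y \<Longrightarrow> h = mk X Y (fn h)"
  by (cases h) (auto simp: hom_def Slice_def mk_def PiE_def extensional_restrict)

lemma hom_SliceD: "h \<in> hom (Slice U Q) X Y \<Longrightarrow> smor Q X Y (fn h)"
  using hom_Slice_mk mk_in_hom_iff by metis

lemma hom_SliceE:
  assumes "h \<in> hom (Slice U Q) X Y"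
  obtains f where "smor Q X Y f" "h = mk X Y f"
  using assms hom_Slice_mk hom_SliceD by blast

lemma Arr_SliceE:
  assumes "h \<in> Arr (Slice U Q)"
  obtains X Y f where "smor Q X Y f" "h = mk X Y f"
proof -
  have "h \<in> hom (Slice U Q) (src h) (tgt h)" using assms by (simp add: hom_def)
  then show thesis using that by (elim hom_SliceE) blast
qed

lemma Comp_mk: "f \<in> carr X \<rightarrow> carr Y \<Longrightarrow> Comp (Slice U Q) (mk Y Z g) (mk X Y f) = mk X Z (\<lambda>x. g (f x))"
  by (auto simp: Slice_def mk_def compose_def fun_eq_iff restrict_def Pi_iff)

lemma Comp_mk_smor: "smor Q X Y f \<Longrightarrow> Comp (Slice U Q) (mk Y Z g) (mk X Y f) = mk X Z (\<lambda>x. g (f x))"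
  by (simp add: Comp_mk smor_def)

end

section \<open>Filtered colimits of sets over a base\<close>

locale filtered_diagram = universe U pr for U :: "'u set set" and pr +
  fixes J :: "('u, 'u) category" and Q :: "'q set"
    and \<Delta> :: "('u, 'u, ('u, 'q) over, ('u, 'q) over_arr) fctr"
  assumes J: "is_category J" "Obj J \<in> U" "is_filtered J"
    and \<Delta>: "is_functor J (Slice U Q) \<Delta>"
begin

abbreviation "D j \<equiv> on_ob \<Delta> j"
abbreviation "T e \<equiv> fn (on_ar \<Delta> e)"

lemma D_obj: "j \<in> Obj J \<Longrightarrow> D j \<in> over_obj U Q"
  using \<Delta> by (simp add: is_functor_def)

lemma hom_objs: "e \<in> hom J i j \<Longrightarrow> i \<in> Obj J" "e \<in> hom J i j \<Longrightarrow> j \<in> Obj J"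
  using J(1) by (auto simp: hom_def is_category_def)

lemma \<Delta>_hom: "e \<in> hom J i j \<Longrightarrow> on_ar \<Delta> e \<in> hom (Slice U Q) (D i) (D j)"
  using \<Delta> unfolding is_functor_def hom_def by force

lemma T_smor: "e \<in> hom J i j \<Longrightarrow> smor Q (D i) (D j) (T e)"
  by (rule hom_SliceD[OF \<Delta>_hom])

lemma T_in: "e \<in> hom J i j \<Longrightarrow> x \<in> carr (D i) \<Longrightarrow> T e x \<in> carr (D j)"
  by (rule smor_in[OF T_smor])

lemma comp_hom: "e \<in> hom J i j \<Longrightarrow> e' \<in> hom J j k \<Longrightarrow> Comp J e' e \<in> hom J i k"
  using J(1) by (auto simp: hom_def is_category_def)

lemma ident_hom: "i \<in> Obj J \<Longrightarrow> Ident J i \<in> hom J i i"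
  using J(1) by (auto simp: is_category_def)

lemma T_comp:
  assumes e: "e \<in> hom J i j" "e' \<in> hom J j k" and x: "x \<in> carr (D i)"
  shows "T (Comp J e' e) x = T e' (T e x)"
proof -
  have "on_ar \<Delta> (Comp J e' e) = Comp (Slice U Q) (on_ar \<Delta> e') (on_ar \<Delta> e)"
    using \<Delta> e by (auto simp: is_functor_def hom_def)
  also have "\<dots> = Comp (Slice U Q) (mk (D j) (D k) (T e')) (mk (D i) (D j) (T e))"
    using hom_Slice_mk[OF \<Delta>_hom] e by metis
  also have "\<dots> = mk (D i) (D k) (\<lambda>x. T e' (T e x))"
    by (rule Comp_mk_smor[OF T_smor[OF e(1)]])
  finally show ?thesis using x by simp
qed

lemma T_ident: "i \<in> Obj J \<Longrightarrow> x \<in> carr (D i) \<Longrightarrow> T (Ident J i) x = x"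
  using \<Delta> by (simp add: is_functor_def)

lemma upper_bound:
  assumes "i \<in> Obj J" "j \<in> Obj J"
  obtains k e e' where "e \<in> hom J i k" "e' \<in> hom J j k"
  using J(3) assms unfolding is_filtered_def by blast

lemma coequalize:
  assumes "e \<in> hom J i j" "e' \<in> hom J i j"
  obtains k h where "h \<in> hom J j k" "Comp J h e = Comp J h e'"
  using J(3) assms hom_objs unfolding is_filtered_def by metis

text \<open>Equality in the filtered colimit of the underlying sets.\<close>

definition germ_rel :: "'u \<times> 'u \<Rightarrow> 'u \<times> 'u \<Rightarrow> bool" where
  "germ_rel p q \<longleftrightarrow> (\<exists>k. \<exists>e\<in>hom J (fst p) k. \<exists>e'\<in>hom J (fst q) k. T e (snd p) = T e' (snd q))"

definition elts :: "('u \<times> 'u) set" where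
  "elts = (SIGMA j:Obj J. carr (D j))"

lemma germ_rel_refl: "p \<in> elts \<Longrightarrow> germ_rel p p"
  unfolding germ_rel_def elts_def by (auto intro!: exI[of _ "fst p"] bexI[of _ "Ident J (fst p)"] ident_hom)

lemma germ_rel_sym: "germ_rel p q \<Longrightarrow> germ_rel q p"
  unfolding germ_rel_def by metis

lemma germ_rel_trans:
  assumes pq: "germ_rel p q" and qr: "germ_rel q r" and elts: "p \<in> elts" "q \<in> elts" "r \<in> elts"
  shows "germ_rel p r"
proof -
  obtain i x j y l z where p: "p = (i, x)" "q = (j, y)" "r = (l, z)" by (metis surj_pair)
  have el: "x \<in> carr (D i)" "y \<in> carr (D j)" "z \<in> carr (D l)" using elts by (auto simp: p elts_def)
  obtain k a b where a: "a \<in> hom J i k" "b \<in> hom J j k" "T a x = T b y"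
    using pq by (auto simp: p germ_rel_def)
  obtain k' a' b' where a': "a' \<in> hom J j k'" "b' \<in> hom J l k'" "T a' y = T b' z"
    using qr by (auto simp: p germ_rel_def)
  obtain m s s' where s: "s \<in> hom J k m" "s' \<in> hom J k' m"
    using upper_bound hom_objs a(1) a'(1) by metis
  \<comment> \<open>The two routes from \<open>j\<close> to the common bound \<open>m\<close>,
    through \<open>k\<close> and through \<open>k'\<close>, may differ; one more arrow makes them
    equal.\<close>
  obtain n h where h: "h \<in> hom J m n" "Comp J h (Comp J s b) = Comp J h (Comp J s' a')"
    using coequalize[OF comp_hom[OF a(2) s(1)] comp_hom[OF a'(1) s(2)]] by blast
  have 1: "T (Comp J h (Comp J s e)) w = T h (T s (T e w))" if "e \<in> hom J i k" "w \<in> carr (D i)" for e i w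
    by (simp add: T_comp[OF comp_hom[OF that(1) s(1)] h(1) that(2)] T_comp[OF that(1) s(1) that(2)])
  have 2: "T (Comp J h (Comp J s' e)) w = T h (T s' (T e w))" if "e \<in> hom J i k'" "w \<in> carr (D i)" for e i w
    by (simp add: T_comp[OF comp_hom[OF that(1) s(2)] h(1) that(2)] T_comp[OF that(1) s(2) that(2)])
  have "T (Comp J h (Comp J s a)) x = T (Comp J h (Comp J s b)) y"
    using 1 a el by simp
  also have "\<dots> = T (Comp J h (Comp J s' b')) z"
    using 2 a' el h(2) by simp
  finally show ?thesis
    unfolding germ_rel_def p using comp_hom a(1) a'(2) s h(1) by (metis fst_conv snd_conv)
qed

lemma cocone_leg:
  assumes "is_cocone J (Slice U Q) \<Delta> L c" "j \<in> Obj J"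
  shows "smor Q (D j) L (fn (c j))" "c j = mk (D j) L (fn (c j))"
proof -
  have "c j \<in> hom (Slice U Q) (D j) L" using assms by (simp add: is_cocone_def)
  then show "smor Q (D j) L (fn (c j))" "c j = mk (D j) L (fn (c j))"
    by (rule hom_SliceD, rule hom_Slice_mk)
qed

lemma cocone_T:
  assumes c: "is_cocone J (Slice U Q) \<Delta> L c" and e: "e \<in> hom J i j" and x: "x \<in> carr (D i)"
  shows "fn (c j) (T e x) = fn (c i) x"
proof -
  have "c i = Comp (Slice U Q) (c j) (on_ar \<Delta> e)"
    using c e by (auto simp: is_cocone_def hom_def)
  also have "\<dots> = Comp (Slice U Q) (mk (D j) L (fn (c j))) (mk (D i) (D j) (T e))"
    using cocone_leg(2)[OF c hom_objs(2)[OF e]] hom_Slice_mk[OF \<Delta>_hom[OF e]] by metis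
  also have "\<dots> = mk (D i) L (\<lambda>x. fn (c j) (T e x))"
    by (rule Comp_mk_smor[OF T_smor[OF e]])
  finally show ?thesis using x by simp
qed

lemma cocone_germ_rel:
  assumes c: "is_cocone J (Slice U Q) \<Delta> L c" and pq: "p \<in> elts" "q \<in> elts" "germ_rel p q"
  shows "fn (c (fst p)) (snd p) = fn (c (fst q)) (snd q)"
proof -
  obtain k e e' where e: "e \<in> hom J (fst p) k" "e' \<in> hom J (fst q) k" "T e (snd p) = T e' (snd q)"
    using pq by (auto simp: germ_rel_def)
  then show ?thesis using cocone_T[OF c] pq by (metis elts_def mem_Sigma_iff prod.collapse)
qed

lemma coconeI:
  assumes "L \<in> over_obj U Q" "\<And>j. j \<in> Obj J \<Longrightarrow> smor Q (D j) L (b j)"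
    "\<And>i j e x. e \<in> hom J i j \<Longrightarrow> x \<in> carr (D i) \<Longrightarrow> b j (T e x) = b i x"
  shows "is_cocone J (Slice U Q) \<Delta> L (\<lambda>j. mk (D j) L (b j))"
  unfolding is_cocone_def
proof (intro conjI ballI)
  fix e assume "e \<in> Arr J"
  then have e: "e \<in> hom J (Dom J e) (Cod J e)" by (simp add: hom_def)
  show "Comp (Slice U Q) (mk (D (Cod J e)) L (b (Cod J e))) (on_ar \<Delta> e) = mk (D (Dom J e)) L (b (Dom J e))"
    apply (subst hom_Slice_mk[OF \<Delta>_hom[OF e]])
    apply (subst Comp_mk_smor[OF T_smor[OF e]])
    using assms(3)[OF e] by (rule mk_cong)
qed (use assms in \<open>auto simp: mk_in_hom_iff\<close>)

text \<open>An equivalence class would be a set of pairs, whereas carriers consist of elements of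
  \<open>'u\<close>; a chosen member of the class is coded in its place.\<close>

definition class_rep :: "'u \<times> 'u \<Rightarrow> 'u \<times> 'u" where
  "class_rep p = (SOME q. q \<in> elts \<and> germ_rel p q)"

lemma class_rep: "p \<in> elts \<Longrightarrow> class_rep p \<in> elts" "p \<in> elts \<Longrightarrow> germ_rel p (class_rep p)"
  using someI[of "\<lambda>q. q \<in> elts \<and> germ_rel p q" p] germ_rel_refl by (auto simp: class_rep_def)

lemma class_rep_eq:
  assumes "p \<in> elts" "q \<in> elts"
  shows "class_rep p = class_rep q \<longleftrightarrow> germ_rel p q"
proof
  assume "class_rep p = class_rep q"
  then show "germ_rel p q"
    using assms class_rep germ_rel_trans germ_rel_sym by metis
next
  assume "germ_rel p q"
  then have "germ_rel p r = germ_rel q r" if "r \<in> elts" for r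
    using assms that germ_rel_trans germ_rel_sym by metis
  then have "(\<lambda>r. r \<in> elts \<and> germ_rel p r) = (\<lambda>r. r \<in> elts \<and> germ_rel q r)" by blast
  then show "class_rep p = class_rep q" by (simp add: class_rep_def)
qed

definition quot :: "('u, 'q) over" where
  "quot = \<lparr> carr = (\<lambda>p. pr (class_rep p)) ` elts,
            disp = (\<lambda>v\<in>(\<lambda>p. pr (class_rep p)) ` elts. case inv pr v of (j, x) \<Rightarrow> disp (D j) x) \<rparr>"

lemma elts_small: "small elts"
proof -
  have "elts = (\<Union>j\<in>Obj J. Pair j ` carr (D j))" by (auto simp: elts_def)
  then show ?thesis
    using J(2) D_obj by (auto intro!: small_UN small_image simp: small_in_U_iff over_obj_def)
qed

lemma elt_disp: "germ_rel p q \<Longrightarrow> p \<in> elts \<Longrightarrow> q \<in> elts \<Longrightarrow> disp (D (fst p)) (snd p) = disp (D (fst q)) (snd q)"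
  unfolding germ_rel_def elts_def using smor_disp[OF T_smor] by (metis SigmaE fst_conv snd_conv)

lemma disp_quot: "p \<in> elts \<Longrightarrow> disp quot (pr (class_rep p)) = disp (D (fst p)) (snd p)"
  using elt_disp[OF class_rep(2) _ class_rep(1), of p] by (simp add: quot_def case_prod_beta)

lemma quot_obj: "quot \<in> over_obj U Q"
proof -
  have "disp quot (pr (class_rep p)) \<in> Q" if p: "p \<in> elts" for p
    using D_obj[of "fst p"] p by (subst disp_quot[OF p]) (auto simp: over_obj_def elts_def PiE_iff)
  moreover have "carr quot \<in> U"
    using small_image[OF elts_small] by (simp add: quot_def flip: small_in_U_iff)
  ultimately show ?thesis by (auto simp: over_obj_def PiE_iff quot_def extensional_def)
qed

lemma quot_cocone:
  "is_cocone J (Slice U Q) \<Delta> quot (\<lambda>j. mk (D j) quot (\<lambda>x. pr (class_rep (j, x))))"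
proof (rule coconeI)
  show "smor Q (D j) quot (\<lambda>x. pr (class_rep (j, x)))" if j: "j \<in> Obj J" for j
    unfolding smor_def using j D_obj quot_obj disp_quot[of "(j, _)"]
    by (auto simp: quot_def elts_def)
  show "pr (class_rep (j, T e x)) = pr (class_rep (i, x))" if e: "e \<in> hom J i j" and x: "x \<in> carr (D i)" for i j e x
  proof -
    have 1: "(j, T e x) \<in> elts" "(i, x) \<in> elts" using e x hom_objs T_in by (auto simp: elts_def)
    have "germ_rel (j, T e x) (i, x)"
      unfolding germ_rel_def using e x ident_hom[OF hom_objs(2)[OF e]] T_ident[OF hom_objs(2)[OF e] T_in[OF e x]]
      by (intro exI[of _ j] bexI[of _ e] bexI[of _ "Ident J j"]) auto
    with 1 show ?thesis by (simp add: class_rep_eq)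
  qed
qed (rule quot_obj)

text \<open>Both statements are read off the explicit colimit \<open>quot\<close>: the universal map
  \<open>h\<close> sends the value of a leg to its germ, and it has a left inverse \<open>g\<close>
  built from the legs.\<close>

lemma colimit_imp:
  assumes col: "is_colimit J (Slice U Q) \<Delta> L c"
  shows "x \<in> carr L \<Longrightarrow> \<exists>j\<in>Obj J. \<exists>y\<in>carr (D j). fn (c j) y = x"
    and "j \<in> Obj J \<Longrightarrow> y \<in> carr (D j) \<Longrightarrow> y' \<in> carr (D j) \<Longrightarrow> fn (c j) y = fn (c j) y' \<Longrightarrow>
      \<exists>k. \<exists>h\<in>hom J j k. T h y = T h y'"
proof -
  have c: "is_cocone J (Slice U Q) \<Delta> L c" using col by (simp add: is_colimit_def)
  let ?b = "\<lambda>j. mk (D j) quot (\<lambda>x. pr (class_rep (j, x)))"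
  have "\<exists>!h. h \<in> hom (Slice U Q) L quot \<and> (\<forall>j\<in>Obj J. Comp (Slice U Q) h (c j) = ?b j)"
    using col[unfolded is_colimit_def, THEN conjunct2, rule_format, OF quot_cocone] .
  then obtain h0 where h0: "h0 \<in> hom (Slice U Q) L quot" "\<And>j. j \<in> Obj J \<Longrightarrow> Comp (Slice U Q) h0 (c j) = ?b j"
    by blast
  obtain h where h: "smor Q L quot h" "h0 = mk L quot h" using h0(1) by (rule hom_SliceE)
  have hc: "Comp (Slice U Q) (mk L quot h) (c j) = ?b j" if "j \<in> Obj J" for j using h0(2)[OF that] h(2) by simp
  have hc': "h (fn (c j) y) = pr (class_rep (j, y))" if j: "j \<in> Obj J" and y: "y \<in> carr (D j)" for j y
  proof -
    have "mk (D j) quot (\<lambda>x. h (fn (c j) x)) = Comp (Slice U Q) (mk L quot h) (mk (D j) L (fn (c j)))"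
      by (rule Comp_mk_smor[symmetric, OF cocone_leg(1)[OF c j]])
    also have "\<dots> = ?b j" using hc[OF j] cocone_leg(2)[OF c j] by metis
    finally show ?thesis using y by (simp add: mk_eq_iff)
  qed
  define g where "g v = (case inv pr v of (j, x) \<Rightarrow> fn (c j) x)" for v
  have L: "L \<in> over_obj U Q" using smor_objs(1)[OF h(1)] .
  have g_rep: "g (pr (class_rep p)) = fn (c (fst p)) (snd p)" if p: "p \<in> elts" for p
    using cocone_germ_rel[OF c class_rep(1)[OF p] p germ_rel_sym[OF class_rep(2)[OF p]]]
    by (simp add: g_def case_prod_beta)
  have g: "smor Q quot L g"
    unfolding smor_def
  proof (intro conjI ballI quot_obj L)
    show "g \<in> carr quot \<rightarrow> carr L"
      using g_rep smor_in[OF cocone_leg(1)[OF c]] by (auto simp: quot_def elts_def)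
    fix v assume "v \<in> carr quot"
    then obtain p where p: "p \<in> elts" "v = pr (class_rep p)" by (auto simp: quot_def)
    then show "disp L (g v) = disp quot v"
      using smor_disp[OF cocone_leg(1)[OF c]] by (auto simp: g_rep disp_quot elts_def)
  qed
  \<comment> \<open>The composite of \<open>g\<close> after \<open>h\<close> and the identity are
    both compatible with the legs, so uniqueness in the universal property of \<open>L\<close> makes
    them equal.\<close>
  have "Comp (Slice U Q) (mk L L (\<lambda>x. g (h x))) (c j) = c j" if j: "j \<in> Obj J" for j
  proof -
    have "Comp (Slice U Q) (mk L L (\<lambda>x. g (h x))) (c j) = mk (D j) L (\<lambda>y. g (h (fn (c j) y)))"
      by (subst cocone_leg(2)[OF c j]) (rule Comp_mk_smor[OF cocone_leg(1)[OF c j]])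
    also have "\<dots> = mk (D j) L (fn (c j))"
      using j g_rep by (intro mk_cong) (auto simp: hc' elts_def)
    finally show ?thesis using cocone_leg(2)[OF c j] by simp
  qed
  moreover have "Comp (Slice U Q) (mk L L (\<lambda>x. x)) (c j) = c j" if j: "j \<in> Obj J" for j
  proof -
    have "Comp (Slice U Q) (mk L L (\<lambda>x. x)) (mk (D j) L (fn (c j))) = mk (D j) L (fn (c j))"
      by (rule Comp_mk_smor[OF cocone_leg(1)[OF c j]])
    then show ?thesis using cocone_leg(2)[OF c j] by simp
  qed
  moreover have "mk L L (\<lambda>x. g (h x)) \<in> hom (Slice U Q) L L" "mk L L (\<lambda>x. x) \<in> hom (Slice U Q) L L"
    using smor_comp[OF h(1) g] smor_id[OF L] by (simp_all add: mk_in_hom_iff)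
  ultimately have "mk L L (\<lambda>x. g (h x)) = mk L L (\<lambda>x. x)"
    using col[unfolded is_colimit_def, THEN conjunct2, rule_format, OF c] by blast
  then have gh: "g (h x) = x" if "x \<in> carr L" for x using that by (simp add: mk_eq_iff)
  show "\<exists>j\<in>Obj J. \<exists>y\<in>carr (D j). fn (c j) y = x" if x: "x \<in> carr L"
  proof -
    obtain p where p: "p \<in> elts" "h x = pr (class_rep p)"
      using smor_in[OF h(1) x] by (auto simp: quot_def)
    then have "fn (c (fst p)) (snd p) = x" using gh[OF x] g_rep by simp
    moreover have "fst p \<in> Obj J" "snd p \<in> carr (D (fst p))" using p by (auto simp: elts_def)
    ultimately show ?thesis by blast
  qed
  show "\<exists>k. \<exists>h\<in>hom J j k. T h y = T h y'"
    if j: "j \<in> Obj J" and y: "y \<in> carr (D j)" "y' \<in> carr (D j)" and eq: "fn (c j) y = fn (c j) y'"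
  proof -
    have "class_rep (j, y) = class_rep (j, y')" using hc'[OF j] y eq by (metis pr_eq_iff)
    then have "germ_rel (j, y) (j, y')" using j y by (simp add: class_rep_eq elts_def)
    then obtain k e e' where e: "e \<in> hom J j k" "e' \<in> hom J j k" "T e y = T e' y'"
      by (auto simp: germ_rel_def)
    \<comment> \<open>Equality of germs allows two different arrows from \<open>j\<close> to
      \<open>k\<close>; coequalizing them leaves a single arrow.\<close>
    obtain n h where h: "h \<in> hom J k n" "Comp J h e = Comp J h e'" using coequalize[OF e(1,2)] .
    have "T (Comp J h e) y = T (Comp J h e) y'"
      using T_comp[OF e(1) h(1) y(1)] T_comp[OF e(2) h(1) y(2)] e(3) h(2) by simp
    then show ?thesis using comp_hom[OF e(1) h(1)] by blast
  qed
qed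

text \<open>The mediating map sends \<open>x\<close> to the value of \<open>b\<close> at any
  preimage of \<open>x\<close> under a leg. Two preimages become equal at a later stage by
  \<open>ident\<close>, hence have the same value.\<close>

lemma colimitI:
  assumes c: "is_cocone J (Slice U Q) \<Delta> L c"
    and surj: "\<And>x. x \<in> carr L \<Longrightarrow> \<exists>j\<in>Obj J. \<exists>y\<in>carr (D j). fn (c j) y = x"
    and ident: "\<And>j y y'. j \<in> Obj J \<Longrightarrow> y \<in> carr (D j) \<Longrightarrow> y' \<in> carr (D j) \<Longrightarrow> fn (c j) y = fn (c j) y' \<Longrightarrow>
      \<exists>k. \<exists>h\<in>hom J j k. T h y = T h y'"
  shows "is_colimit J (Slice U Q) \<Delta> L c"
  unfolding is_colimit_def
proof (intro conjI allI impI c)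
  fix M b assume b: "is_cocone J (Slice U Q) \<Delta> M b"
  have "\<forall>x\<in>carr L. \<exists>j y. j \<in> Obj J \<and> y \<in> carr (D j) \<and> fn (c j) y = x" using surj by blast
  then obtain js ys where sel: "\<And>x. x \<in> carr L \<Longrightarrow> js x \<in> Obj J \<and> ys x \<in> carr (D (js x)) \<and> fn (c (js x)) (ys x) = x"
    by metis
  define h where "h x = fn (b (js x)) (ys x)" for x
  have L: "L \<in> over_obj U Q" and M: "M \<in> over_obj U Q" using b c by (auto simp: is_cocone_def)
  have wd: "fn (b i) y = fn (b j) y'"
    if ij: "i \<in> Obj J" "j \<in> Obj J" and y: "y \<in> carr (D i)" "y' \<in> carr (D j)" and eq: "fn (c i) y = fn (c j) y'" for i j y y'
  proof -
    obtain k e e' where e: "e \<in> hom J i k" "e' \<in> hom J j k" using upper_bound[OF ij] .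
    have "fn (c k) (T e y) = fn (c k) (T e' y')" using cocone_T[OF c] e y eq by metis
    then obtain n s where s: "s \<in> hom J k n" "T s (T e y) = T s (T e' y')"
      using ident[OF hom_objs(2)[OF e(1)] T_in[OF e(1) y(1)] T_in[OF e(2) y(2)]] by blast
    have "fn (b i) y = fn (b k) (T e y)" using cocone_T[OF b e(1) y(1)] by simp
    also have "\<dots> = fn (b n) (T s (T e y))" using cocone_T[OF b s(1) T_in[OF e(1) y(1)]] by simp
    also have "\<dots> = fn (b k) (T e' y')" using cocone_T[OF b s(1) T_in[OF e(2) y(2)]] s(2) by simp
    also have "\<dots> = fn (b j) y'" using cocone_T[OF b e(2) y(2)] by simp
    finally show ?thesis .
  qed
  have hc: "h (fn (c j) y) = fn (b j) y" if j: "j \<in> Obj J" and y: "y \<in> carr (D j)" for j y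
    unfolding h_def using sel[OF smor_in[OF cocone_leg(1)[OF c j] y]] j y by (intro wd) auto
  have h: "smor Q L M h"
    unfolding smor_def
  proof (intro conjI ballI L M)
    show "h \<in> carr L \<rightarrow> carr M"
      using sel smor_in[OF cocone_leg(1)[OF b]] by (auto simp: h_def)
    show "disp M (h x) = disp L x" if x: "x \<in> carr L" for x
      using sel[OF x] smor_disp[OF cocone_leg(1)[OF b]] smor_disp[OF cocone_leg(1)[OF c]]
      by (metis h_def)
  qed
  show "\<exists>!h. h \<in> hom (Slice U Q) L M \<and> (\<forall>j\<in>Obj J. Comp (Slice U Q) h (c j) = b j)"
  proof (rule ex1I[of _ "mk L M h"], intro conjI ballI)
    show "mk L M h \<in> hom (Slice U Q) L M" using h by (simp add: mk_in_hom_iff)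
    show "Comp (Slice U Q) (mk L M h) (c j) = b j" if j: "j \<in> Obj J" for j
    proof -
      have "Comp (Slice U Q) (mk L M h) (c j) = mk (D j) M (\<lambda>y. h (fn (c j) y))"
        by (subst cocone_leg(2)[OF c j]) (rule Comp_mk_smor[OF cocone_leg(1)[OF c j]])
      also have "\<dots> = mk (D j) M (fn (b j))" by (intro mk_cong hc j)
      finally show ?thesis using cocone_leg(2)[OF b j] by simp
    qed
    fix h' assume h': "h' \<in> hom (Slice U Q) L M \<and> (\<forall>j\<in>Obj J. Comp (Slice U Q) h' (c j) = b j)"
    then obtain f where f: "smor Q L M f" "h' = mk L M f" by (auto elim: hom_SliceE)
    have "f x = h x" if x: "x \<in> carr L" for x
    proof -
      have j: "js x \<in> Obj J" and y: "ys x \<in> carr (D (js x))" using sel[OF x] by auto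
      have "b (js x) = Comp (Slice U Q) (mk L M f) (c (js x))" using h' j f by simp
      also have "\<dots> = mk (D (js x)) M (\<lambda>y. f (fn (c (js x)) y))"
        by (subst cocone_leg(2)[OF c j]) (rule Comp_mk_smor[OF cocone_leg(1)[OF c j]])
      finally have "b (js x) = mk (D (js x)) M (\<lambda>y. f (fn (c (js x)) y))" .
      then show ?thesis using sel[OF x] by (simp add: h_def)
    qed
    then show "h' = mk L M h" using f by (simp add: mk_eq_iff)
  qed
qed

end

section \<open>Wide pullbacks and weak pullbacks in terms of elements\<close>

context universe
begin

text \<open>Arrows out of this object are the elements of the target that lie over \<open>q\<close>.
  Testing a universal property against such objects turns it into a statement about
  elements.\<close>

definition point :: "'q \<Rightarrow> ('u, 'q) over" where
  "point q = \<lparr> carr = {num 0}, disp = (\<lambda>x\<in>{num 0}. q) \<rparr>"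

lemma point_obj: "q \<in> Q \<Longrightarrow> point q \<in> over_obj U Q"
  using subset_in_U[OF range_num] by (auto simp: point_def over_obj_def)

lemma point_smor: "X \<in> over_obj U Q \<Longrightarrow> x \<in> carr X \<Longrightarrow> disp X x = q \<Longrightarrow> smor Q (point q) X (\<lambda>_. x)"
  unfolding smor_def using point_obj[of q Q]
  by (auto simp: point_def over_obj_def PiE_iff)

lemma num_in_point [simp]: "num 0 \<in> carr (point q)"
  by (simp add: point_def)

lemma carr_disp: "X \<in> over_obj U Q \<Longrightarrow> x \<in> carr X \<Longrightarrow> disp X x \<in> Q"
  by (auto simp: over_obj_def)

lemma over_obj_in_U: "X \<in> over_obj U Q \<Longrightarrow> carr X \<in> U"
  by (auto simp: over_obj_def)

lemma wide_cone_iff: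
  assumes f: "\<And>i. i \<in> I \<Longrightarrow> smor Q (Y i) X (f i)"
  shows "wide_cone (Slice U Q) I X (\<lambda>i. mk (Y i) X (f i)) L (mk L X p) (\<lambda>i. mk L (Y i) (q i)) \<longleftrightarrow>
    smor Q L X p \<and> (\<forall>i\<in>I. smor Q L (Y i) (q i) \<and> (\<forall>x\<in>carr L. f i (q i x) = p x))"
  unfolding wide_cone_def
  by (auto simp: mk_in_hom_iff Comp_mk_smor mk_eq_iff smor_objs)

lemma wide_cone_mk:
  assumes "wide_cone (Slice U Q) I X (\<lambda>i. mk (Y i) X (f i)) L p q"
  shows "p = mk L X (fn p)" "i \<in> I \<Longrightarrow> q i = mk L (Y i) (fn (q i))"
    and "wide_cone (Slice U Q) I X (\<lambda>i. mk (Y i) X (f i)) L (mk L X (fn p)) (\<lambda>i. mk L (Y i) (fn (q i)))"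
proof -
  show p: "p = mk L X (fn p)" using assms by (intro hom_Slice_mk[where Q = Q]) (simp add: wide_cone_def)
  have q: "q i = mk L (Y i) (fn (q i))" if "i \<in> I" for i
    using assms that by (intro hom_Slice_mk[where Q = Q]) (simp add: wide_cone_def)
  then show "i \<in> I \<Longrightarrow> q i = mk L (Y i) (fn (q i))" .
  show "wide_cone (Slice U Q) I X (\<lambda>i. mk (Y i) X (f i)) L (mk L X (fn p)) (\<lambda>i. mk L (Y i) (fn (q i)))"
    using assms by (simp add: wide_cone_def p[symmetric] q[symmetric])
qed

lemma wide_pullback_imp:
  assumes f: "\<And>i. i \<in> I \<Longrightarrow> smor Q (Y i) X (f i)"
    and pb: "is_wide_pullback (Slice U Q) I X (\<lambda>i. mk (Y i) X (f i)) L (mk L X p) (\<lambda>i. mk L (Y i) (q i))"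
    and x: "X \<in> over_obj U Q" "x \<in> carr X" "\<And>i. i \<in> I \<Longrightarrow> y i \<in> carr (Y i)" "\<And>i. i \<in> I \<Longrightarrow> f i (y i) = x"
  shows "\<exists>l\<in>carr L. p l = x \<and> (\<forall>i\<in>I. q i l = y i)"
proof -
  let ?M = "point (disp X x)"
  have y: "smor Q ?M (Y i) (\<lambda>_. y i)" if i: "i \<in> I" for i
    using smor_disp[OF f[OF i] x(3)[OF i]] x(4)[OF i] by (intro point_smor smor_objs(1)[OF f[OF i]] x i) simp
  have cone: "smor Q L X p \<and> (\<forall>i\<in>I. smor Q L (Y i) (q i) \<and> (\<forall>x\<in>carr L. f i (q i x) = p x))"
    using pb wide_cone_iff[where I = I and Y = Y and f = f, OF f] by (simp add: is_wide_pullback_def)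
  have cone': "wide_cone (Slice U Q) I X (\<lambda>i. mk (Y i) X (f i)) ?M (mk ?M X (\<lambda>_. x)) (\<lambda>i. mk ?M (Y i) (\<lambda>_. y i))"
    using f y x by (subst wide_cone_iff) (auto intro: point_smor)
  obtain h where h: "h \<in> hom (Slice U Q) ?M L" "Comp (Slice U Q) (mk L X p) h = mk ?M X (\<lambda>_. x)"
    "\<And>i. i \<in> I \<Longrightarrow> Comp (Slice U Q) (mk L (Y i) (q i)) h = mk ?M (Y i) (\<lambda>_. y i)"
    using pb[unfolded is_wide_pullback_def, THEN conjunct2, rule_format, OF cone'] by blast
  obtain g where g: "smor Q ?M L g" "h = mk ?M L g" using h(1) by (rule hom_SliceE)
  have "p (g (num 0)) = x" "\<And>i. i \<in> I \<Longrightarrow> q i (g (num 0)) = y i"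
    using h g by (simp_all add: Comp_mk_smor mk_eq_iff)
  then show ?thesis using smor_in[OF g(1), of "num 0"] by auto
qed

lemma wide_pullbackI:
  assumes f: "\<And>i. i \<in> I \<Longrightarrow> smor Q (Y i) X (f i)"
    and p: "smor Q L X p" and q: "\<And>i. i \<in> I \<Longrightarrow> smor Q L (Y i) (q i)"
    and fq: "\<And>i x. i \<in> I \<Longrightarrow> x \<in> carr L \<Longrightarrow> f i (q i x) = p x"
    and ex: "\<And>x y. x \<in> carr X \<Longrightarrow> (\<And>i. i \<in> I \<Longrightarrow> y i \<in> carr (Y i)) \<Longrightarrow> (\<And>i. i \<in> I \<Longrightarrow> f i (y i) = x) \<Longrightarrow>
        \<exists>l\<in>carr L. p l = x \<and> (\<forall>i\<in>I. q i l = y i)"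
    and uniq: "\<And>l l'. l \<in> carr L \<Longrightarrow> l' \<in> carr L \<Longrightarrow> p l = p l' \<Longrightarrow> (\<And>i. i \<in> I \<Longrightarrow> q i l = q i l') \<Longrightarrow> l = l'"
  shows "is_wide_pullback (Slice U Q) I X (\<lambda>i. mk (Y i) X (f i)) L (mk L X p) (\<lambda>i. mk L (Y i) (q i))"
  unfolding is_wide_pullback_def
proof (intro conjI allI impI)
  show "wide_cone (Slice U Q) I X (\<lambda>i. mk (Y i) X (f i)) L (mk L X p) (\<lambda>i. mk L (Y i) (q i))"
    using f p q fq by (subst wide_cone_iff) auto
  fix M p0 q0 assume "wide_cone (Slice U Q) I X (\<lambda>i. mk (Y i) X (f i)) M p0 q0"
  moreover define p' q' where "p' = fn p0" "q' = (\<lambda>i. fn (q0 i))"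
  ultimately have p0: "p0 = mk M X p'" "\<And>i. i \<in> I \<Longrightarrow> q0 i = mk M (Y i) (q' i)"
    and "wide_cone (Slice U Q) I X (\<lambda>i. mk (Y i) X (f i)) M (mk M X p') (\<lambda>i. mk M (Y i) (q' i))"
    using wide_cone_mk[of Q I X Y f M p0 q0] by auto
  then have p': "smor Q M X p'" and q': "\<And>i. i \<in> I \<Longrightarrow> smor Q M (Y i) (q' i)"
    and fq': "\<And>i x. i \<in> I \<Longrightarrow> x \<in> carr M \<Longrightarrow> f i (q' i x) = p' x"
    using wide_cone_iff[where I = I and Y = Y and f = f, OF f] by auto
  have "\<forall>x\<in>carr M. \<exists>l\<in>carr L. p l = p' x \<and> (\<forall>i\<in>I. q i l = q' i x)"
    using ex smor_in[OF p'] smor_in[OF q'] fq' by auto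
  then obtain h where h: "\<And>x. x \<in> carr M \<Longrightarrow> h x \<in> carr L" "\<And>x. x \<in> carr M \<Longrightarrow> p (h x) = p' x"
    "\<And>x i. x \<in> carr M \<Longrightarrow> i \<in> I \<Longrightarrow> q i (h x) = q' i x" by metis
  have h_smor: "smor Q M L h"
    unfolding smor_def
  proof (intro conjI ballI smor_objs(1)[OF p'] smor_objs(1)[OF p] Pi_I h)
    show "disp L (h x) = disp M x" if "x \<in> carr M" for x
      using smor_disp[OF p h(1)[OF that]] smor_disp[OF p' that] h(2)[OF that] by simp
  qed
  show "\<exists>!h. h \<in> hom (Slice U Q) M L \<and> Comp (Slice U Q) (mk L X p) h = p0 \<and>
     (\<forall>i\<in>I. Comp (Slice U Q) (mk L (Y i) (q i)) h = q0 i)"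
  proof (rule ex1I[of _ "mk M L h"])
    show "mk M L h \<in> hom (Slice U Q) M L \<and> Comp (Slice U Q) (mk L X p) (mk M L h) = p0 \<and>
      (\<forall>i\<in>I. Comp (Slice U Q) (mk L (Y i) (q i)) (mk M L h) = q0 i)"
      using h_smor h by (simp add: mk_in_hom_iff Comp_mk_smor p0 mk_eq_iff)
    fix h' assume h': "h' \<in> hom (Slice U Q) M L \<and> Comp (Slice U Q) (mk L X p) h' = p0 \<and>
      (\<forall>i\<in>I. Comp (Slice U Q) (mk L (Y i) (q i)) h' = q0 i)"
    then obtain g where g: "smor Q M L g" "h' = mk M L g" using hom_SliceE by metis
    have pg: "mk M X (\<lambda>x. p (g x)) = mk M X p'"
      using h' by (simp only: g(2) Comp_mk_smor[OF g(1)] p0(1))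
    have qg: "mk M (Y i) (\<lambda>x. q i (g x)) = mk M (Y i) (q' i)" if "i \<in> I" for i
    proof -
      have "Comp (Slice U Q) (mk L (Y i) (q i)) h' = q0 i" using h' that by blast
      then show ?thesis by (simp only: g(2) Comp_mk_smor[OF g(1)] p0(2)[OF that])
    qed
    have "g x = h x" if x: "x \<in> carr M" for x
    proof (rule uniq)
      show "p (g x) = p (h x)" using pg x h(2) by (simp add: mk_eq_iff)
      show "q i (g x) = q i (h x)" if "i \<in> I" for i using qg[OF that] x h(3)[OF x that] by (simp add: mk_eq_iff)
    qed (use smor_in[OF g(1) x] h(1)[OF x] in auto)
    then show "h' = mk M L h" using g by (simp add: mk_eq_iff)
  qed
qed

text \<open>A matching family of elements is a cone with a one-point vertex. Conversely, lifts are
  chosen separately for each element of the vertex, and the resulting function respects the base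
  because \<open>p\<close> does.\<close>

lemma weak_wide_pullback_iff:
  assumes f: "\<And>i. i \<in> I \<Longrightarrow> smor Q (Y i) X (f i)" and X: "X \<in> over_obj U Q"
    and p: "smor Q L X p" and q: "\<And>i. i \<in> I \<Longrightarrow> smor Q L (Y i) (q i)"
    and fq: "\<And>i x. i \<in> I \<Longrightarrow> x \<in> carr L \<Longrightarrow> f i (q i x) = p x"
  shows "is_weak_wide_pullback (Slice U Q) I X (\<lambda>i. mk (Y i) X (f i)) L (mk L X p) (\<lambda>i. mk L (Y i) (q i)) \<longleftrightarrow>
    (\<forall>x\<in>carr X. \<forall>y. (\<forall>i\<in>I. y i \<in> carr (Y i) \<and> f i (y i) = x) \<longrightarrow>
        (\<exists>l\<in>carr L. p l = x \<and> (\<forall>i\<in>I. q i l = y i)))" (is "?W \<longleftrightarrow> ?E")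
proof
  assume W: ?W
  show ?E
  proof (intro ballI allI impI)
    fix x y assume x: "x \<in> carr X" and y: "\<forall>i\<in>I. y i \<in> carr (Y i) \<and> f i (y i) = x"
    let ?M = "point (disp X x)"
    have ysm: "smor Q ?M (Y i) (\<lambda>_. y i)" if i: "i \<in> I" for i
      using smor_disp[OF f[OF i], of "y i"] y i by (intro point_smor smor_objs(1)[OF f[OF i]]) auto
    have cone': "wide_cone (Slice U Q) I X (\<lambda>i. mk (Y i) X (f i)) ?M (mk ?M X (\<lambda>_. x)) (\<lambda>i. mk ?M (Y i) (\<lambda>_. y i))"
      using f y x X ysm by (subst wide_cone_iff) (auto intro: point_smor)
    obtain h where h: "h \<in> hom (Slice U Q) ?M L" "Comp (Slice U Q) (mk L X p) h = mk ?M X (\<lambda>_. x)"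
      "\<And>i. i \<in> I \<Longrightarrow> Comp (Slice U Q) (mk L (Y i) (q i)) h = mk ?M (Y i) (\<lambda>_. y i)"
      using W[unfolded is_weak_wide_pullback_def, THEN conjunct2, rule_format, OF cone'] by blast
    obtain g where g: "smor Q ?M L g" "h = mk ?M L g" using h(1) by (rule hom_SliceE)
    have "p (g (num 0)) = x" "\<And>i. i \<in> I \<Longrightarrow> q i (g (num 0)) = y i"
      using h g by (simp_all add: Comp_mk_smor mk_eq_iff)
    then show "\<exists>l\<in>carr L. p l = x \<and> (\<forall>i\<in>I. q i l = y i)" using smor_in[OF g(1), of "num 0"] by auto
  qed
next
  assume E: ?E
  show ?W
    unfolding is_weak_wide_pullback_def
  proof (intro conjI allI impI)
    show "wide_cone (Slice U Q) I X (\<lambda>i. mk (Y i) X (f i)) L (mk L X p) (\<lambda>i. mk L (Y i) (q i))"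
      using f p q fq by (subst wide_cone_iff) auto
    fix M p0 q0 assume "wide_cone (Slice U Q) I X (\<lambda>i. mk (Y i) X (f i)) M p0 q0"
    moreover define p' q' where "p' = fn p0" "q' = (\<lambda>i. fn (q0 i))"
    ultimately have p0: "p0 = mk M X p'" "\<And>i. i \<in> I \<Longrightarrow> q0 i = mk M (Y i) (q' i)"
      and "wide_cone (Slice U Q) I X (\<lambda>i. mk (Y i) X (f i)) M (mk M X p') (\<lambda>i. mk M (Y i) (q' i))"
      using wide_cone_mk[of Q I X Y f M p0 q0] by auto
    then have p': "smor Q M X p'" and q': "\<And>i. i \<in> I \<Longrightarrow> smor Q M (Y i) (q' i)"
      and fq': "\<And>i x. i \<in> I \<Longrightarrow> x \<in> carr M \<Longrightarrow> f i (q' i x) = p' x"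
      using wide_cone_iff[where I = I and Y = Y and f = f, OF f] by auto
    have "\<exists>l\<in>carr L. p l = p' x \<and> (\<forall>i\<in>I. q i l = q' i x)" if x: "x \<in> carr M" for x
      using E[rule_format, of "p' x" "\<lambda>i. q' i x"] smor_in[OF p' x] smor_in[OF q' x] fq' x by auto
    then obtain h where h: "\<And>x. x \<in> carr M \<Longrightarrow> h x \<in> carr L" "\<And>x. x \<in> carr M \<Longrightarrow> p (h x) = p' x"
      "\<And>x i. x \<in> carr M \<Longrightarrow> i \<in> I \<Longrightarrow> q i (h x) = q' i x" by metis
    have h_smor: "smor Q M L h"
      unfolding smor_def
    proof (intro conjI ballI smor_objs(1)[OF p'] smor_objs(1)[OF p] Pi_I h)
      show "disp L (h x) = disp M x" if "x \<in> carr M" for x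
        using smor_disp[OF p h(1)[OF that]] smor_disp[OF p' that] h(2)[OF that] by simp
    qed
    then show "\<exists>h. h \<in> hom (Slice U Q) M L \<and> Comp (Slice U Q) (mk L X p) h = p0 \<and>
      (\<forall>i\<in>I. Comp (Slice U Q) (mk L (Y i) (q i)) h = q0 i)"
      using h by (intro exI[of _ "mk M L h"]) (simp add: mk_in_hom_iff Comp_mk_smor p0 mk_eq_iff)
  qed
qed

lemma weak_pullback_iff:
  assumes p: "smor Q L A p" and q: "smor Q L B q" and a: "smor Q A X a" and b: "smor Q B X b"
    and comm: "\<And>x. x \<in> carr L \<Longrightarrow> a (p x) = b (q x)"
  shows "is_weak_pullback (Slice U Q) (mk L A p) (mk L B q) (mk A X a) (mk B X b) \<longleftrightarrow>
    (\<forall>y\<in>carr A. \<forall>z\<in>carr B. a y = b z \<longrightarrow> (\<exists>l\<in>carr L. p l = y \<and> q l = z))" (is "?W \<longleftrightarrow> ?E")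
proof
  assume W: ?W
  show ?E
  proof (intro ballI impI)
    fix y z assume y: "y \<in> carr A" and z: "z \<in> carr B" and eq: "a y = b z"
    let ?M = "point (disp A y)"
    have "disp B z = disp A y" using smor_disp[OF a y] smor_disp[OF b z] eq by simp
    then have M: "smor Q ?M A (\<lambda>_. y)" "smor Q ?M B (\<lambda>_. z)"
      using y z smor_objs(1)[OF a] smor_objs(1)[OF b] by (auto intro: point_smor)
    have "Comp (Slice U Q) (mk A X a) (mk ?M A (\<lambda>_. y)) = Comp (Slice U Q) (mk B X b) (mk ?M B (\<lambda>_. z))"
      using M eq by (simp add: Comp_mk_smor)
    moreover have "?M \<in> over_obj U Q" using smor_objs(1)[OF M(1)] .
    ultimately obtain h where h: "h \<in> hom (Slice U Q) ?M L"
      "Comp (Slice U Q) (mk L A p) h = mk ?M A (\<lambda>_. y)" "Comp (Slice U Q) (mk L B q) h = mk ?M B (\<lambda>_. z)"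
      using W M unfolding is_weak_pullback_def Slice_simps mk_simps by (meson mk_in_hom_iff)
    obtain g where g: "smor Q ?M L g" "h = mk ?M L g" using h(1) by (rule hom_SliceE)
    have "p (g (num 0)) = y" "q (g (num 0)) = z"
      using h g by (simp_all add: Comp_mk_smor mk_eq_iff)
    then show "\<exists>l\<in>carr L. p l = y \<and> q l = z" using smor_in[OF g(1), of "num 0"] by auto
  qed
next
  assume E: ?E
  show ?W
    unfolding is_weak_pullback_def
  proof (intro conjI ballI impI)
    show "Comp (Slice U Q) (mk A X a) (mk L A p) = Comp (Slice U Q) (mk B X b) (mk L B q)"
      using p q comm by (simp add: Comp_mk_smor mk_eq_iff)
    fix M p0 q0 assume M: "M \<in> Obj (Slice U Q)"
      and p0: "p0 \<in> hom (Slice U Q) M (Dom (Slice U Q) (mk A X a))"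
      and q0: "q0 \<in> hom (Slice U Q) M (Dom (Slice U Q) (mk B X b))"
      and eq: "Comp (Slice U Q) (mk A X a) p0 = Comp (Slice U Q) (mk B X b) q0"
    obtain p' where p': "smor Q M A p'" "p0 = mk M A p'" using p0 by (auto elim: hom_SliceE)
    obtain q' where q': "smor Q M B q'" "q0 = mk M B q'" using q0 by (auto elim: hom_SliceE)
    have "\<forall>x\<in>carr M. a (p' x) = b (q' x)" using eq p' q' by (simp add: Comp_mk_smor mk_eq_iff)
    then have "\<forall>x\<in>carr M. \<exists>l\<in>carr L. p l = p' x \<and> q l = q' x"
      using E smor_in[OF p'(1)] smor_in[OF q'(1)] by auto
    then obtain h where h: "\<And>x. x \<in> carr M \<Longrightarrow> h x \<in> carr L" "\<And>x. x \<in> carr M \<Longrightarrow> p (h x) = p' x"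
      "\<And>x. x \<in> carr M \<Longrightarrow> q (h x) = q' x" by metis
    have h_smor: "smor Q M L h"
      unfolding smor_def
    proof (intro conjI ballI smor_objs(1)[OF p'(1)] smor_objs(1)[OF p] Pi_I h)
      show "disp L (h x) = disp M x" if "x \<in> carr M" for x
        using smor_disp[OF p h(1)[OF that]] smor_disp[OF p'(1) that] h(2)[OF that] by simp
    qed
    then show "\<exists>h\<in>hom (Slice U Q) M (Dom (Slice U Q) (mk L A p)).
        Comp (Slice U Q) (mk L A p) h = p0 \<and> Comp (Slice U Q) (mk L B q) h = q0"
      using h p' q' by (intro bexI[of _ "mk M L h"]) (simp_all add: mk_in_hom_iff Comp_mk_smor mk_eq_iff)
  qed (use p q a b in \<open>auto simp: mk_in_Arr_iff\<close>)
qed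

end

section \<open>Presentations of functors by symmetric signatures\<close>

locale slice_functor = universe U pr for U :: "'u set set" and pr +
  fixes Q :: "'u set" and P :: "('u, 'u) endo"
  assumes P: "is_functor (Slice U Q) (Slice U Q) P"
begin

abbreviation "PO X \<equiv> on_ob P X"
abbreviation "PC X \<equiv> carr (on_ob P X)"

definition Pm :: "('u, 'u) over \<Rightarrow> ('u, 'u) over \<Rightarrow> ('u \<Rightarrow> 'u) \<Rightarrow> 'u \<Rightarrow> 'u" where
  "Pm X Y f = fn (on_ar P (mk X Y f))"

lemma P_obj: "X \<in> over_obj U Q \<Longrightarrow> PO X \<in> over_obj U Q"
  using P by (simp add: is_functor_def)

lemma P_hom: "smor Q X Y f \<Longrightarrow> on_ar P (mk X Y f) \<in> hom (Slice U Q) (PO X) (PO Y)"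
  using P[unfolded is_functor_def, THEN conjunct2, THEN conjunct1, rule_format, of "mk X Y f"]
  by (simp add: mk_in_Arr_iff)

lemma P_mk: "smor Q X Y f \<Longrightarrow> on_ar P (mk X Y f) = mk (PO X) (PO Y) (Pm X Y f)"
  unfolding Pm_def by (rule hom_Slice_mk[OF P_hom])

lemma Pm_smor: "smor Q X Y f \<Longrightarrow> smor Q (PO X) (PO Y) (Pm X Y f)"
  unfolding Pm_def by (rule hom_SliceD[OF P_hom])

lemma Pm_in: "smor Q X Y f \<Longrightarrow> z \<in> PC X \<Longrightarrow> Pm X Y f z \<in> PC Y"
  by (rule smor_in[OF Pm_smor])

lemma Pm_cong: "(\<And>x. x \<in> carr X \<Longrightarrow> f x = g x) \<Longrightarrow> Pm X Y f = Pm X Y g"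
  unfolding Pm_def by (simp cong: mk_cong)

lemma Pm_id: "X \<in> over_obj U Q \<Longrightarrow> z \<in> PC X \<Longrightarrow> Pm X X (\<lambda>x. x) z = z"
  using P unfolding is_functor_def Pm_def by simp

lemma Pm_comp:
  assumes f: "smor Q X Y f" and g: "smor Q Y Z g" and z: "z \<in> PC X"
  shows "Pm Y Z g (Pm X Y f z) = Pm X Z (\<lambda>x. g (f x)) z"
proof -
  have "on_ar P (mk X Z (\<lambda>x. g (f x))) = on_ar P (Comp (Slice U Q) (mk Y Z g) (mk X Y f))"
    by (simp add: Comp_mk_smor[OF f])
  also have "\<dots> = Comp (Slice U Q) (on_ar P (mk Y Z g)) (on_ar P (mk X Y f))"
    using P f g by (simp add: is_functor_def mk_in_Arr_iff)
  also have "\<dots> = mk (PO X) (PO Z) (\<lambda>x. Pm Y Z g (Pm X Y f x))"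
    by (simp add: P_mk f g Comp_mk_smor Pm_smor)
  finally show ?thesis using z by (simp add: Pm_def)
qed

end

section \<open>Tuples of a symmetric signature and their classes\<close>

locale signature = universe U pr for U :: "'u set set" and pr +
  fixes Q :: "'u set" and A :: "('u, 'u) sym_sig"
  assumes A: "is_sym_sig U Q A"
begin

lemma act_id: "a \<in> ops A n \<Longrightarrow> act A n a id = a"
  and act_in: "a \<in> ops A n \<Longrightarrow> \<sigma> permutes {1..n} \<Longrightarrow> act A n a \<sigma> \<in> ops A n"
  and act_act: "a \<in> ops A n \<Longrightarrow> \<sigma> permutes {1..n} \<Longrightarrow> \<rho> permutes {1..n} \<Longrightarrow>
    act A n (act A n a \<sigma>) \<rho> = act A n a (\<sigma> \<circ> \<rho>)"
  and bd_in: "a \<in> ops A n \<Longrightarrow> bd A n a \<in> {0..n} \<rightarrow>\<^sub>E Q"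
  and bd_act: "a \<in> ops A n \<Longrightarrow> \<sigma> permutes {1..n} \<Longrightarrow> bd A n (act A n a \<sigma>) = bd A n a \<circ> \<sigma>"
  using A by (simp_all add: is_sym_sig_def)

lemma bd_act_0: "a \<in> ops A n \<Longrightarrow> \<sigma> permutes {1..n} \<Longrightarrow> bd A n (act A n a \<sigma>) 0 = bd A n a 0"
  by (simp add: bd_act permutes_not_in)

abbreviation "cls X n a x \<equiv> star_rel A X `` {(n, a, x)}"

lemma tuplesI:
  "a \<in> ops A n \<Longrightarrow> x \<in> {1..n} \<rightarrow>\<^sub>E carr X \<Longrightarrow> (\<And>i. i \<in> {1..n} \<Longrightarrow> disp X (x i) = bd A n a i) \<Longrightarrow>
    (n, a, x) \<in> star_tuples A X"
  by (simp add: star_tuples_def)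

lemma tuplesD:
  assumes "(n, a, x) \<in> star_tuples A X"
  shows "a \<in> ops A n" "x \<in> {1..n} \<rightarrow>\<^sub>E carr X" "i \<in> {1..n} \<Longrightarrow> x i \<in> carr X"
    "i \<in> {1..n} \<Longrightarrow> disp X (x i) = bd A n a i"
  using assms by (auto simp: star_tuples_def)

lemma tuples_act:
  assumes t: "(n, a, x) \<in> star_tuples A X" and \<sigma>: "\<sigma> permutes {1..n}"
  shows "(n, act A n a \<sigma>, x \<circ> \<sigma>) \<in> star_tuples A X"
proof (rule tuplesI)
  have \<sigma>_in: "\<sigma> i \<in> {1..n} \<longleftrightarrow> i \<in> {1..n}" for i using permutes_in_image[OF \<sigma>] .
  show "x \<circ> \<sigma> \<in> {1..n} \<rightarrow>\<^sub>E carr X"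
  proof (rule PiE_I)
    show "(x \<circ> \<sigma>) i \<in> carr X" if "i \<in> {1..n}" for i using that \<sigma>_in tuplesD(3)[OF t] by simp
    show "(x \<circ> \<sigma>) i = undefined" if "i \<notin> {1..n}" for i
      using that tuplesD(2)[OF t] permutes_not_in[OF \<sigma> that] by (auto simp: PiE_def extensional_def)
  qed
  show "disp X ((x \<circ> \<sigma>) i) = bd A n (act A n a \<sigma>) i" if "i \<in> {1..n}" for i
    using that \<sigma>_in tuplesD(4)[OF t] by (simp add: bd_act[OF tuplesD(1)[OF t] \<sigma>])
qed (rule act_in[OF tuplesD(1)[OF t] \<sigma>])

lemma tuples_map:
  assumes t: "(n, a, x) \<in> star_tuples A X" and f: "smor Q X Y f"
  shows "(n, a, compose {1..n} f x) \<in> star_tuples A Y"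
  using tuplesD[OF t] smor_in[OF f] smor_disp[OF f]
  by (intro tuplesI) (auto simp: compose_def)

lemma star_rel_iff:
  "((n, a, x), (m, b, y)) \<in> star_rel A X \<longleftrightarrow> (n, a, x) \<in> star_tuples A X \<and> m = n \<and>
    (\<exists>\<sigma>. \<sigma> permutes {1..n} \<and> b = act A n a \<sigma> \<and> y = x \<circ> \<sigma>)"
  by (auto simp: star_rel_def)

lemma equiv_star_rel: "equiv (star_tuples A X) (star_rel A X)"
proof (rule equivI)
  show "star_rel A X \<subseteq> star_tuples A X \<times> star_tuples A X"
    using tuples_act by (auto simp: star_rel_def)
  show "refl_on (star_tuples A X) (star_rel A X)"
  proof (rule refl_onI)
    fix t assume t: "t \<in> star_tuples A X"
    obtain n a x where nax: "t = (n, a, x)" by (metis surj_pair)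
    have "act A n a id = a" using act_id[OF tuplesD(1)] t nax by blast
    then show "(t, t) \<in> star_rel A X"
      using t permutes_id[of "{1..n}"] unfolding nax star_rel_iff by (intro conjI refl exI[of _ id]) auto
  qed
  show "sym (star_rel A X)"
  proof (rule symI)
    fix s t assume "(s, t) \<in> star_rel A X"
    then obtain n a x \<sigma> where s: "s = (n, a, x)" "t = (n, act A n a \<sigma>, x \<circ> \<sigma>)"
      "(n, a, x) \<in> star_tuples A X" and \<sigma>: "\<sigma> permutes {1..n}"
      by (auto simp: star_rel_def)
    have "act A n (act A n a \<sigma>) (inv \<sigma>) = a"
      using act_act[OF tuplesD(1)[OF s(3)] \<sigma> permutes_inv[OF \<sigma>]] permutes_inv_o(1)[OF \<sigma>]
        act_id[OF tuplesD(1)[OF s(3)]] by simp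
    moreover have "x \<circ> \<sigma> \<circ> inv \<sigma> = x" using permutes_inv_o(1)[OF \<sigma>] by (simp add: o_assoc[symmetric])
    ultimately show "(t, s) \<in> star_rel A X"
      unfolding s star_rel_iff using tuples_act[OF s(3) \<sigma>] permutes_inv[OF \<sigma>] by metis
  qed
  show "trans (star_rel A X)"
  proof (rule transI)
    fix r s t assume "(r, s) \<in> star_rel A X" "(s, t) \<in> star_rel A X"
    then obtain n a x \<sigma> \<rho> where s: "r = (n, a, x)" "s = (n, act A n a \<sigma>, x \<circ> \<sigma>)"
      "t = (n, act A n (act A n a \<sigma>) \<rho>, x \<circ> \<sigma> \<circ> \<rho>)" "(n, a, x) \<in> star_tuples A X"
      and \<sigma>: "\<sigma> permutes {1..n}" and \<rho>: "\<rho> permutes {1..n}"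
      by (auto simp: star_rel_def)
    have "act A n (act A n a \<sigma>) \<rho> = act A n a (\<sigma> \<circ> \<rho>)" by (rule act_act[OF tuplesD(1)[OF s(4)] \<sigma> \<rho>])
    then show "(r, t) \<in> star_rel A X"
      unfolding s star_rel_iff using s(4) permutes_compose[OF \<rho> \<sigma>] by (metis o_assoc)
  qed
qed

lemma cls_eq_iff:
  assumes "(n, a, x) \<in> star_tuples A X" "(m, b, y) \<in> star_tuples A X"
  shows "cls X n a x = cls X m b y \<longleftrightarrow>
    m = n \<and> (\<exists>\<sigma>. \<sigma> permutes {1..n} \<and> b = act A n a \<sigma> \<and> y = x \<circ> \<sigma>)"
  using eq_equiv_class_iff[OF equiv_star_rel assms] assms by (simp add: star_rel_iff)

lemma cls_in: "(n, a, x) \<in> star_tuples A X \<Longrightarrow> cls X n a x \<in> carr (star_ob A X)"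
  by (simp add: star_ob_def Let_def quotientI)

lemma cls_self: "(n, a, x) \<in> star_tuples A X \<Longrightarrow> (n, a, x) \<in> cls X n a x"
  by (rule equiv_class_self[OF equiv_star_rel])

lemma star_obE:
  assumes "c \<in> carr (star_ob A X)"
  obtains n a x where "(n, a, x) \<in> star_tuples A X" "c = cls X n a x"
  using assms unfolding star_ob_def Let_def by (auto elim!: quotientE)

lemma root_colour_cls:
  assumes t: "(n, a, x) \<in> star_tuples A X"
  shows "root_colour A (cls X n a x) = bd A n a 0"
proof -
  have "(\<lambda>(n, a, x). bd A n a 0) ` cls X n a x = {bd A n a 0}"
  proof
    show "(\<lambda>(n, a, x). bd A n a 0) ` cls X n a x \<subseteq> {bd A n a 0}"
      using tuplesD(1)[OF t] by (auto simp: star_rel_iff bd_act_0)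
    show "{bd A n a 0} \<subseteq> (\<lambda>(n, a, x). bd A n a 0) ` cls X n a x"
      using cls_self[OF t] by force
  qed
  then show ?thesis by (simp add: root_colour_def)
qed

lemma disp_cls: "(n, a, x) \<in> star_tuples A X \<Longrightarrow> disp (star_ob A X) (cls X n a x) = bd A n a 0"
  using cls_in[of n a x X] by (simp add: star_ob_def Let_def root_colour_cls)

text \<open>Every representative of the class yields the same value, so the union in the definition
  of \<open>star\<close> runs over a constant family.\<close>

lemma star_map_cls:
  assumes f: "smor Q X Y f" and t: "(n, a, x) \<in> star_tuples A X"
  shows "fn (on_ar (star A) (mk X Y f)) (cls X n a x) = cls Y n a (compose {1..n} f x)"
proof -
  have *: "cls Y m b (compose {1..m} (fn (mk X Y f)) y) = cls Y n a (compose {1..n} f x)"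
    if "(m, b, y) \<in> cls X n a x" for m b y
  proof -
    obtain \<sigma> where \<sigma>: "\<sigma> permutes {1..n}" and m: "m = n" "b = act A n a \<sigma>" "y = x \<circ> \<sigma>"
      using \<open>(m, b, y) \<in> cls X n a x\<close> by (auto simp: star_rel_iff)
    have "compose {1..m} (fn (mk X Y f)) y = compose {1..n} f x \<circ> \<sigma>"
    proof
      fix i show "compose {1..m} (fn (mk X Y f)) y i = (compose {1..n} f x \<circ> \<sigma>) i"
        using permutes_in_image[OF \<sigma>, of i] tuplesD(3)[OF t, of "\<sigma> i"] by (simp add: compose_def m)
    qed
    then show ?thesis
      using tuples_map[OF t f] tuples_act[OF tuples_map[OF t f] \<sigma>] \<sigma> m
      by (subst eq_commute, subst cls_eq_iff) auto
  qed
  have "fn (on_ar (star A) (mk X Y f)) (cls X n a x) =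
    (\<Union>(m, b, y)\<in>cls X n a x. cls Y m b (compose {1..m} (fn (mk X Y f)) y))"
    using cls_in[OF t] by (simp add: star_def)
  also have "\<dots> = (\<Union>t\<in>cls X n a x. cls Y n a (compose {1..n} f x))"
    using * by (intro SUP_cong) auto
  also have "\<dots> = cls Y n a (compose {1..n} f x)" using cls_self[OF t] by blast
  finally show ?thesis .
qed

end

text \<open>An isomorphism of \<open>P\<close> with \<open>star A\<close>, expressed on
  representatives: \<open>val X n a x\<close> is the element of \<open>P X\<close> named by the
  class of \<open>(n, a, x)\<close>. The arguments below then serve both for a given isomorphism and
  for the generic elements.\<close>

locale presentation = slice_functor U pr Q P + signature U pr Q A
  for U :: "'u set set" and pr Q P A +
  fixes val :: "('u, 'u) over \<Rightarrow> nat \<Rightarrow> 'u \<Rightarrow> (nat \<Rightarrow> 'u) \<Rightarrow> 'u"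
  assumes val_in: "X \<in> over_obj U Q \<Longrightarrow> (n, a, x) \<in> star_tuples A X \<Longrightarrow> val X n a x \<in> PC X"
    and disp_val: "X \<in> over_obj U Q \<Longrightarrow> (n, a, x) \<in> star_tuples A X \<Longrightarrow> disp (PO X) (val X n a x) = bd A n a 0"
    and ex_val: "X \<in> over_obj U Q \<Longrightarrow> z \<in> PC X \<Longrightarrow> \<exists>n a x. (n, a, x) \<in> star_tuples A X \<and> val X n a x = z"
    and val_eq_iff: "X \<in> over_obj U Q \<Longrightarrow> (n, a, x) \<in> star_tuples A X \<Longrightarrow> (m, b, y) \<in> star_tuples A X \<Longrightarrow>
      val X n a x = val X m b y \<longleftrightarrow> m = n \<and> (\<exists>\<sigma>. \<sigma> permutes {1..n} \<and> b = act A n a \<sigma> \<and> y = x \<circ> \<sigma>)"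
    and Pm_val: "smor Q X Y f \<Longrightarrow> (n, a, x) \<in> star_tuples A X \<Longrightarrow>
      Pm X Y f (val X n a x) = val Y n a (compose {1..n} f x)"
begin

lemma valE:
  assumes "X \<in> over_obj U Q" "z \<in> PC X"
  obtains n a x where "(n, a, x) \<in> star_tuples A X" "z = val X n a x"
  using ex_val[OF assms] by blast

text \<open>Makes the isomorphism explicit: an element corresponds to the set of all its
  names.\<close>

lemma fibre_val:
  assumes X: "X \<in> over_obj U Q" and t: "(n, a, x) \<in> star_tuples A X"
  shows "{(m, b, y) \<in> star_tuples A X. val X m b y = val X n a x} = cls X n a x"
proof -
  have "t' \<in> {(m, b, y) \<in> star_tuples A X. val X m b y = val X n a x} \<longleftrightarrow> t' \<in> cls X n a x" for t'
  proof -
    obtain m b y where t': "t' = (m, b, y)" by (metis surj_pair)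
    have "t' \<in> cls X n a x \<longleftrightarrow> (m, b, y) \<in> star_tuples A X \<and> ((n, a, x), (m, b, y)) \<in> star_rel A X"
      using equiv_star_rel[of X] unfolding t' by (auto simp: equiv_def)
    then show ?thesis
      using val_eq_iff[OF X t, of m b y] t unfolding t' star_rel_iff by auto
  qed
  then show ?thesis by blast
qed

lemma is_over_iso: "is_over_iso (Slice U Q) P (star A) (\<lambda>X z. {(n, a, x) \<in> star_tuples A X. val X n a x = z})"
  (is "is_over_iso _ _ _ ?\<phi>")
  unfolding is_over_iso_def
proof (intro conjI ballI)
  fix X assume "X \<in> Obj (Slice U Q)"
  then have X: "X \<in> over_obj U Q" by simp
  have "inj_on (?\<phi> X) (PC X)"
  proof (rule inj_onI)
    fix z z' assume z: "z \<in> PC X" and eq: "?\<phi> X z = ?\<phi> X z'"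
    obtain n a x where "(n, a, x) \<in> star_tuples A X" "z = val X n a x" using valE[OF X z] .
    then have "(n, a, x) \<in> ?\<phi> X z" by simp
    then show "z = z'" unfolding eq using \<open>z = val X n a x\<close> by simp
  qed
  moreover have "?\<phi> X ` PC X = carr (on_ob (star A) X)"
  proof
    show "?\<phi> X ` PC X \<subseteq> carr (on_ob (star A) X)"
    proof
      fix c assume "c \<in> ?\<phi> X ` PC X"
      then obtain z where z: "z \<in> PC X" "c = ?\<phi> X z" by blast
      obtain n a x where t: "(n, a, x) \<in> star_tuples A X" "z = val X n a x" using valE[OF X z(1)] .
      show "c \<in> carr (on_ob (star A) X)" using cls_in[OF t(1)] by (simp add: star_def z(2) t(2) fibre_val[OF X t(1)])
    qed
    show "carr (on_ob (star A) X) \<subseteq> ?\<phi> X ` PC X"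
    proof
      fix c assume "c \<in> carr (on_ob (star A) X)"
      then obtain n a x where t: "(n, a, x) \<in> star_tuples A X" "c = cls X n a x"
        by (auto simp: star_def elim: star_obE)
      then show "c \<in> ?\<phi> X ` PC X"
        using fibre_val[OF X t(1)] val_in[OF X t(1)] by (intro image_eqI[of _ _ "val X n a x"]) simp_all
    qed
  qed
  ultimately show "bij_betw (?\<phi> X) (carr (on_ob P X)) (carr (on_ob (star A) X))" by (simp add: bij_betw_def)
  fix z assume z: "z \<in> PC X"
  obtain n a x where t: "(n, a, x) \<in> star_tuples A X" "z = val X n a x" using valE[OF X z] .
  then show "disp (on_ob (star A) X) (?\<phi> X z) = disp (on_ob P X) z"
    using disp_cls[OF t(1)] disp_val[OF X t(1)] by (simp add: fibre_val[OF X t(1)] star_def)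
next
  fix h z assume h: "h \<in> Arr (Slice U Q)" and z: "z \<in> carr (on_ob P (Dom (Slice U Q) h))"
  obtain X Y f where f: "smor Q X Y f" "h = mk X Y f" using h by (rule Arr_SliceE)
  have X: "X \<in> over_obj U Q" "Y \<in> over_obj U Q" using smor_objs[OF f(1)] .
  obtain n a x where t: "(n, a, x) \<in> star_tuples A X" "z = val X n a x"
    using valE[OF X(1), of z] z f by auto
  have "fn (on_ar P h) z = val Y n a (compose {1..n} f x)"
    using Pm_val[OF f(1) t(1)] by (simp add: f t(2) Pm_def)
  then show "?\<phi> (Cod (Slice U Q) h) (fn (on_ar P h) z) = fn (on_ar (star A) h) (?\<phi> (Dom (Slice U Q) h) z)"
    by (simp add: f(2) t(2) fibre_val[OF X(1) t(1)] fibre_val[OF X(2) tuples_map[OF t(1) f(1)]] star_map_cls[OF f(1) t(1)])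
qed

end

text \<open>Names are obtained by pulling classes back along the bijections \<open>\<phi> X\<close>.
  The second part keeps the link with \<open>\<phi>\<close>, through which transformations are
  compared with \<open>rep_fn\<close>.\<close>

lemma (in slice_functor) presentation_of_iso:
  assumes A: "is_sym_sig U Q A" and \<phi>: "is_over_iso (Slice U Q) P (star A) \<phi>"
  defines "val \<equiv> \<lambda>X n a x. inv_into (PC X) (\<phi> X) (star_rel A X `` {(n, a, x)})"
  shows "presentation U pr Q P A val"
    and "X \<in> over_obj U Q \<Longrightarrow> (n, a, x) \<in> star_tuples A X \<Longrightarrow> \<phi> X (val X n a x) = star_rel A X `` {(n, a, x)}"
proof -
  interpret signature U pr Q A by unfold_locales (rule A)
  have bij: "bij_betw (\<phi> X) (PC X) (carr (star_ob A X))" if "X \<in> over_obj U Q" for X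
    using \<phi> that by (simp add: is_over_iso_def star_def)
  have \<phi>_val: "\<phi> X (val X n a x) = cls X n a x" if "X \<in> over_obj U Q" "(n, a, x) \<in> star_tuples A X" for X n a x
    unfolding val_def by (rule bij_betw_inv_into_right[OF bij[OF that(1)] cls_in[OF that(2)]])
  then show "X \<in> over_obj U Q \<Longrightarrow> (n, a, x) \<in> star_tuples A X \<Longrightarrow> \<phi> X (val X n a x) = star_rel A X `` {(n, a, x)}" .
  have val_in: "val X n a x \<in> PC X" if "X \<in> over_obj U Q" "(n, a, x) \<in> star_tuples A X" for X n a x
    unfolding val_def by (rule bij_betw_apply[OF bij_betw_inv_into[OF bij[OF that(1)]] cls_in[OF that(2)]])
  have inj: "\<phi> X z = \<phi> X z' \<longleftrightarrow> z = z'" if "X \<in> over_obj U Q" "z \<in> PC X" "z' \<in> PC X" for X z z'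
    using bij_betw_imp_inj_on[OF bij[OF that(1)]] that(2,3) by (auto dest: inj_onD)
  show "presentation U pr Q P A val"
  proof unfold_locales
    fix X n a x assume X: "X \<in> over_obj U Q" and t: "(n, a, x) \<in> star_tuples A X"
    show "val X n a x \<in> PC X" by (rule val_in[OF X t])
    have "disp (star_ob A X) (\<phi> X (val X n a x)) = disp (PO X) (val X n a x)"
      using \<phi> X val_in[OF X t] by (simp add: is_over_iso_def star_def)
    then show "disp (PO X) (val X n a x) = bd A n a 0" by (simp add: \<phi>_val[OF X t] disp_cls[OF t])
    fix m b y assume t': "(m, b, y) \<in> star_tuples A X"
    show "val X n a x = val X m b y \<longleftrightarrow> m = n \<and> (\<exists>\<sigma>. \<sigma> permutes {1..n} \<and> b = act A n a \<sigma> \<and> y = x \<circ> \<sigma>)"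
      using inj[OF X val_in[OF X t] val_in[OF X t']] \<phi>_val[OF X] t t' cls_eq_iff[OF t t'] by simp
  next
    fix X z assume X: "X \<in> over_obj U Q" and z: "z \<in> PC X"
    obtain n a x where t: "(n, a, x) \<in> star_tuples A X" "\<phi> X z = cls X n a x"
      using bij_betw_apply[OF bij[OF X] z] by (rule star_obE)
    then have "val X n a x = z" using inj[OF X val_in[OF X t(1)] z] \<phi>_val[OF X t(1)] by simp
    with t show "\<exists>n a x. (n, a, x) \<in> star_tuples A X \<and> val X n a x = z" by blast
  next
    fix X Y f n a x assume f: "smor Q X Y f" and t: "(n, a, x) \<in> star_tuples A X"
    have X: "X \<in> over_obj U Q" "Y \<in> over_obj U Q" using smor_objs[OF f] .
    have nat: "\<forall>z\<in>PC X. \<phi> Y (Pm X Y f z) = fn (on_ar (star A) (mk X Y f)) (\<phi> X z)"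
      using \<phi>[unfolded is_over_iso_def, THEN conjunct2, rule_format, of "mk X Y f"] f
      by (simp add: mk_in_Arr_iff Pm_def)
    have "\<phi> Y (Pm X Y f (val X n a x)) = cls Y n a (compose {1..n} f x)"
      using nat val_in[OF X(1) t] by (simp add: \<phi>_val[OF X(1) t] star_map_cls[OF f t])
    then show "Pm X Y f (val X n a x) = val Y n a (compose {1..n} f x)"
      using inj[OF X(2) Pm_in[OF f val_in[OF X(1) t]] val_in[OF X(2) tuples_map[OF t f]]]
        \<phi>_val[OF X(2) tuples_map[OF t f]] by simp
  qed
qed

section \<open>Analytic functors are finitary and weakly preserve wide pullbacks\<close>

lemma is_functor_fcomp:
  assumes F: "is_functor B C F" and G: "is_functor C D G"
  shows "is_functor B D (G \<circ>\<^sub>F F)"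
proof -
  have F_ar: "on_ar F f \<in> Arr C" "Dom C (on_ar F f) = on_ob F (Dom B f)" "Cod C (on_ar F f) = on_ob F (Cod B f)"
    if "f \<in> Arr B" for f using F that by (auto simp: is_functor_def hom_def)
  have G_ar: "on_ar G f \<in> hom D (on_ob G (Dom C f)) (on_ob G (Cod C f))" if "f \<in> Arr C" for f
    using G that by (simp add: is_functor_def)
  have G_comp: "on_ar G (Comp C g f) = Comp D (on_ar G g) (on_ar G f)"
    if "f \<in> Arr C" "g \<in> Arr C" "Cod C f = Dom C g" for f g using G that by (simp add: is_functor_def)
  show ?thesis
    unfolding is_functor_def
  proof (intro conjI ballI impI)
    fix f assume f: "f \<in> Arr B"
    show "on_ar (G \<circ>\<^sub>F F) f \<in> hom D (on_ob (G \<circ>\<^sub>F F) (Dom B f)) (on_ob (G \<circ>\<^sub>F F) (Cod B f))"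
      using G_ar[OF F_ar(1)[OF f]] F_ar[OF f] by (simp add: fcomp_def)
    fix g assume g: "g \<in> Arr B" "Cod B f = Dom B g"
    have "on_ar F (Comp B g f) = Comp C (on_ar F g) (on_ar F f)" using F f g by (simp add: is_functor_def)
    then show "on_ar (G \<circ>\<^sub>F F) (Comp B g f) = Comp D (on_ar (G \<circ>\<^sub>F F) g) (on_ar (G \<circ>\<^sub>F F) f)"
      using G_comp[OF F_ar(1)[OF f] F_ar(1)[OF g(1)]] F_ar f g by (simp add: fcomp_def)
  qed (use F G in \<open>auto simp: is_functor_def fcomp_def\<close>)
qed

lemma (in filtered_diagram) finite_upper_bound:
  assumes "finite S" "S \<subseteq> Obj J"
  shows "\<exists>k\<in>Obj J. \<forall>j\<in>S. hom J j k \<noteq> {}"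
  using assms
proof (induction S)
  case empty
  then show ?case using J(3) by (auto simp: is_filtered_def)
next
  case (insert i S)
  then obtain k where k: "k \<in> Obj J" "\<forall>j\<in>S. hom J j k \<noteq> {}" by auto
  have i: "i \<in> Obj J" using insert.prems by simp
  obtain m e e' where e: "e \<in> hom J k m" "e' \<in> hom J i m" by (rule upper_bound[OF k(1) i])
  have "hom J j m \<noteq> {}" if "j \<in> S" for j using k(2) that comp_hom[OF _ e(1)] by fast
  then show ?case using e(2) hom_objs(2)[OF e(1)] by auto
qed

text \<open>The finiteness of arities enters here: pairs of entries are identified one after the
  other, each time by a further arrow that preserves the identifications already made.\<close>

lemma (in filtered_diagram) finite_coequalize:
  assumes ident: "\<And>j y y'. j \<in> Obj J \<Longrightarrow> y \<in> carr (D j) \<Longrightarrow> y' \<in> carr (D j) \<Longrightarrow> fn (c j) y = fn (c j) y' \<Longrightarrow>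
      \<exists>k. \<exists>h\<in>hom J j k. T h y = T h y'"
    and c: "is_cocone J (Slice U Q) \<Delta> L c" and j: "j \<in> Obj J"
    and S: "finite S" "\<And>s. s \<in> S \<Longrightarrow> y s \<in> carr (D j) \<and> y' s \<in> carr (D j) \<and> fn (c j) (y s) = fn (c j) (y' s)"
  shows "\<exists>k. \<exists>h\<in>hom J j k. \<forall>s\<in>S. T h (y s) = T h (y' s)"
  using S
proof (induction S)
  case empty
  then show ?case using ident_hom[OF j] by auto
next
  case (insert s S)
  then obtain k h where h: "h \<in> hom J j k" "\<forall>s\<in>S. T h (y s) = T h (y' s)" by auto
  have s: "y s \<in> carr (D j)" "y' s \<in> carr (D j)" "fn (c j) (y s) = fn (c j) (y' s)" using insert.prems by auto
  have "fn (c k) (T h (y s)) = fn (c k) (T h (y' s))"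
    using cocone_T[OF c h(1)] s by simp
  then obtain m g where g: "g \<in> hom J k m" "T g (T h (y s)) = T g (T h (y' s))"
    using ident[OF hom_objs(2)[OF h(1)] T_in[OF h(1) s(1)] T_in[OF h(1) s(2)]] by blast
  have "T (Comp J g h) (y t) = T (Comp J g h) (y' t)" if "t \<in> insert s S" for t
    using that insert.prems[of t] h g by (auto simp: T_comp[OF h(1) g(1)])
  then show ?case using comp_hom[OF h(1) g(1)] by blast
qed

context presentation
begin

lemma compose_eqI:
  "(\<And>i. i \<in> {1..n} \<Longrightarrow> f (x i) = y i) \<Longrightarrow> y \<in> {1..n} \<rightarrow>\<^sub>E B \<Longrightarrow> compose {1..n} f x = y"
  by (fastforce simp: compose_def fun_eq_iff PiE_def extensional_def)

text \<open>A name of the image lifts to a name of the element with the same operation: any name of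
  \<open>z\<close> is carried to a name of the image, which differs from \<open>(a, y)\<close> by a
  permutation, and acting by that permutation corrects the choice. The lift need not be unique,
  which is why only weak limits result.\<close>

lemma val_lift:
  assumes f: "smor Q X Y f" and z: "z \<in> PC X" and t: "(n, a, y) \<in> star_tuples A Y"
    and eq: "Pm X Y f z = val Y n a y"
  obtains x where "(n, a, x) \<in> star_tuples A X" "z = val X n a x" "compose {1..n} f x = y"
proof -
  have X: "X \<in> over_obj U Q" "Y \<in> over_obj U Q" using smor_objs[OF f] .
  obtain m b x where t': "(m, b, x) \<in> star_tuples A X" "z = val X m b x" using valE[OF X(1) z] .
  have "val Y m b (compose {1..m} f x) = val Y n a y" using eq Pm_val[OF f t'(1)] t'(2) by metis
  then obtain \<sigma> where m: "n = m" and \<sigma>: "\<sigma> permutes {1..m}" "a = act A m b \<sigma>" "y = compose {1..m} f x \<circ> \<sigma>"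
    using val_eq_iff[OF X(2) tuples_map[OF t'(1) f] t] by blast
  have "(n, a, x \<circ> \<sigma>) \<in> star_tuples A X" using tuples_act[OF t'(1) \<sigma>(1)] \<sigma> m by simp
  moreover have "z = val X n a (x \<circ> \<sigma>)"
    using val_eq_iff[OF X(1) t'(1) tuples_act[OF t'(1) \<sigma>(1)]] \<sigma> m t'(2) by auto
  moreover have "compose {1..n} f (x \<circ> \<sigma>) = y"
    using permutes_in_image[OF \<sigma>(1)] permutes_not_in[OF \<sigma>(1)] unfolding \<sigma>(3) m
    by (auto simp: compose_def fun_eq_iff)
  ultimately show thesis by (rule that)
qed

lemma finitary_P: "finitary U (Slice U Q) (Slice U Q) P"
  unfolding finitary_def
proof (intro allI impI, elim conjE)
  fix J :: "('u, 'u) category" and \<Delta> L c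
  assume J: "is_category J" "Obj J \<in> U" "Arr J \<in> U" "is_filtered J" "is_functor J (Slice U Q) \<Delta>"
    and col: "is_colimit J (Slice U Q) \<Delta> L c"
  interpret F: filtered_diagram U pr J Q \<Delta> by unfold_locales (use J in auto)
  have c: "is_cocone J (Slice U Q) \<Delta> L c" using col by (simp add: is_colimit_def)
  have L: "L \<in> over_obj U Q" using c by (simp add: is_cocone_def)
  have \<Delta>_mk: "on_ar \<Delta> e = mk (F.D i) (F.D j) (F.T e)" if "e \<in> hom J i j" for e i j
    by (rule hom_Slice_mk[OF F.\<Delta>_hom[OF that]])
  have P\<Delta>: "is_functor J (Slice U Q) (P \<circ>\<^sub>F \<Delta>)"
    by (rule is_functor_fcomp[OF F.\<Delta> P])
  interpret G: filtered_diagram U pr J Q "P \<circ>\<^sub>F \<Delta>" by unfold_locales (use J P\<Delta> in auto)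
  have GD: "G.D j = PO (F.D j)" for j by (simp add: fcomp_def)
  have GT: "G.T e = Pm (F.D i) (F.D j) (F.T e)" if "e \<in> hom J i j" for e i j
    using \<Delta>_mk[OF that] by (simp add: fcomp_def Pm_def)
  have leg: "smor Q (F.D j) L (fn (c j))" "c j = mk (F.D j) L (fn (c j))" if "j \<in> Obj J" for j
    by (rule F.cocone_leg[OF c that])+
  have Pleg: "on_ar P (c j) = mk (PO (F.D j)) (PO L) (Pm (F.D j) L (fn (c j)))" if "j \<in> Obj J" for j
    using P_mk[OF leg(1)[OF that]] leg(2)[OF that] by simp
  then have fnPleg: "fn (on_ar P (c j)) z = Pm (F.D j) L (fn (c j)) z" if "j \<in> Obj J" "z \<in> PC (F.D j)" for j z
    using that by simp
  have cocone: "is_cocone J (Slice U Q) (P \<circ>\<^sub>F \<Delta>) (PO L) (\<lambda>j. on_ar P (c j))"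
  proof -
    have "is_cocone J (Slice U Q) (P \<circ>\<^sub>F \<Delta>) (PO L) (\<lambda>j. mk (G.D j) (PO L) (Pm (F.D j) L (fn (c j))))"
    proof (rule G.coconeI)
      show "smor Q (G.D j) (PO L) (Pm (F.D j) L (fn (c j)))" if "j \<in> Obj J" for j
        using Pm_smor[OF leg(1)[OF that]] by (simp add: GD)
      show "Pm (F.D j) L (fn (c j)) (G.T e x) = Pm (F.D i) L (fn (c i)) x"
        if e: "e \<in> hom J i j" and x: "x \<in> carr (G.D i)" for i j e x
        using Pm_comp[OF F.T_smor[OF e] leg(1)[OF F.hom_objs(2)[OF e]], of x] x
          Pm_cong[of "F.D i" "\<lambda>x. fn (c j) (F.T e x)" "fn (c i)" L] F.cocone_T[OF c e]
        by (simp add: GT[OF e] GD)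
    qed (rule P_obj[OF L])
    then show ?thesis unfolding is_cocone_def using Pleg F.J(1) by (simp add: GD is_category_def)
  qed
  show "is_colimit J (Slice U Q) (P \<circ>\<^sub>F \<Delta>) (PO L) (\<lambda>j. on_ar P (c j))"
  proof (rule G.colimitI[OF cocone])
    fix w assume "w \<in> PC L"
    then obtain n a x where t: "(n, a, x) \<in> star_tuples A L" "w = val L n a x" using valE[OF L] by blast
    have "\<forall>i\<in>{1..n}. \<exists>j\<in>Obj J. \<exists>y\<in>carr (F.D j). fn (c j) y = x i"
      using F.colimit_imp(1)[OF col] tuplesD(3)[OF t(1)] by blast
    then obtain j y where jy: "\<And>i. i \<in> {1..n} \<Longrightarrow> j i \<in> Obj J \<and> y i \<in> carr (F.D (j i)) \<and> fn (c (j i)) (y i) = x i"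
      by metis
    \<comment> \<open>The entries come from finitely many stages, so a single stage \<open>k\<close>
      carries a lift of the whole tuple.\<close>
    obtain k where k: "k \<in> Obj J" "\<forall>i\<in>{1..n}. hom J (j i) k \<noteq> {}"
      using F.finite_upper_bound[of "j ` {1..n}"] jy by (metis finite_atLeastAtMost finite_imageI image_eqI image_subsetI)
    then have "\<forall>i\<in>{1..n}. \<exists>e. e \<in> hom J (j i) k" by blast
    then obtain e where e: "\<And>i. i \<in> {1..n} \<Longrightarrow> e i \<in> hom J (j i) k" by metis
    define v where "v = (\<lambda>i\<in>{1..n}. F.T (e i) (y i))"
    have v: "v i \<in> carr (F.D k)" "fn (c k) (v i) = x i" if "i \<in> {1..n}" for i
      using F.T_in[OF e[OF that]] F.cocone_T[OF c e[OF that]] jy[OF that] that by (auto simp: v_def)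
    have tv: "(n, a, v) \<in> star_tuples A (F.D k)"
    proof (rule tuplesI)
      show "v \<in> {1..n} \<rightarrow>\<^sub>E carr (F.D k)" using v by (auto simp: v_def)
      show "disp (F.D k) (v i) = bd A n a i" if "i \<in> {1..n}" for i
        using smor_disp[OF leg(1)[OF k(1)] v(1)[OF that]] v(2)[OF that] tuplesD(4)[OF t(1) that] by simp
    qed (rule tuplesD(1)[OF t(1)])
    have "Pm (F.D k) L (fn (c k)) (val (F.D k) n a v) = w"
      using Pm_val[OF leg(1)[OF k(1)] tv] compose_eqI[of n "fn (c k)" v x] v(2) tuplesD(2)[OF t(1)] t(2) by simp
    moreover have "val (F.D k) n a v \<in> PC (F.D k)" by (rule val_in[OF F.D_obj[OF k(1)] tv])
    ultimately show "\<exists>j\<in>Obj J. \<exists>z\<in>carr (G.D j). fn (on_ar P (c j)) z = w"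
      using k(1) fnPleg GD by metis
  next
    fix j z z'
    assume j: "j \<in> Obj J" and z: "z \<in> carr (G.D j)" "z' \<in> carr (G.D j)"
      and eq: "fn (on_ar P (c j)) z = fn (on_ar P (c j)) z'"
    have Dj: "F.D j \<in> over_obj U Q" using F.D_obj[OF j] .
    obtain n a x where t: "(n, a, x) \<in> star_tuples A (F.D j)" "z = val (F.D j) n a x"
      using valE[OF Dj] z(1) GD by metis
    have "Pm (F.D j) L (fn (c j)) z' = val L n a (compose {1..n} (fn (c j)) x)"
      using Pm_val[OF leg(1)[OF j] t(1)] eq fnPleg[OF j] z by (simp add: GD t(2))
    \<comment> \<open>Since the images agree, \<open>z'\<close> can be named with the same operation
      \<open>a\<close> as \<open>z\<close>; it remains to identify two tuples entry by
      entry.\<close>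
    then obtain y where t': "(n, a, y) \<in> star_tuples A (F.D j)" "z' = val (F.D j) n a y"
      and y: "compose {1..n} (fn (c j)) y = compose {1..n} (fn (c j)) x"
      using val_lift[OF leg(1)[OF j] _ tuples_map[OF t(1) leg(1)[OF j]]] z(2) GD by metis
    have y: "fn (c j) (x i) = fn (c j) (y i)" if "i \<in> {1..n}" for i
      using fun_cong[OF y, of i] that by (simp add: compose_def)
    have "\<exists>k. \<exists>h\<in>hom J j k. \<forall>i\<in>{1..n}. F.T h (x i) = F.T h (y i)"
      using y tuplesD(3)[OF t(1)] tuplesD(3)[OF t'(1)]
      by (intro F.finite_coequalize[OF F.colimit_imp(2)[OF col] c j]) auto
    then obtain k h where h: "h \<in> hom J j k" "\<And>i. i \<in> {1..n} \<Longrightarrow> F.T h (x i) = F.T h (y i)" by blast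
    have "compose {1..n} (F.T h) x = compose {1..n} (F.T h) y"
      using h(2) by (auto simp: compose_def fun_eq_iff)
    then have "Pm (F.D j) (F.D k) (F.T h) z = Pm (F.D j) (F.D k) (F.T h) z'"
      using Pm_val[OF F.T_smor[OF h(1)] t(1)] Pm_val[OF F.T_smor[OF h(1)] t'(1)] by (simp add: t(2) t'(2))
    then show "\<exists>k. \<exists>h\<in>hom J j k. G.T h z = G.T h z'" using h(1) GT[OF h(1)] by metis
  qed
qed

lemma weakly_preserves_P: "weakly_preserves_wide_pullbacks U (Slice U Q) (Slice U Q) P"
  unfolding weakly_preserves_wide_pullbacks_def
proof (intro allI impI, elim conjE)
  fix I :: "'u set" and X f0 L p0 q0
  assume X: "X \<in> Obj (Slice U Q)" and f0: "\<forall>i\<in>I. f0 i \<in> Arr (Slice U Q) \<and> Cod (Slice U Q) (f0 i) = X"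
    and pb0: "is_wide_pullback (Slice U Q) I X f0 L p0 q0"
  have X: "X \<in> over_obj U Q" using X by simp
  define Y f p q where "Y i = src (f0 i)" "f i = fn (f0 i)" "p = fn p0" "q i = fn (q0 i)" for i
  have f0_hom: "f0 i \<in> hom (Slice U Q) (Y i) X" if "i \<in> I" for i
    using f0 that by (simp add: hom_def Y_f_p_q_def)
  have f: "smor Q (Y i) X (f i)" "f0 i = mk (Y i) X (f i)" if "i \<in> I" for i
    using hom_SliceD[OF f0_hom[OF that]] hom_Slice_mk[OF f0_hom[OF that]] by (auto simp: Y_f_p_q_def)
  have p0_hom: "p0 \<in> hom (Slice U Q) L X" and q0_hom: "\<And>i. i \<in> I \<Longrightarrow> q0 i \<in> hom (Slice U Q) L (Y i)"
    and fq0: "\<And>i. i \<in> I \<Longrightarrow> Comp (Slice U Q) (f0 i) (q0 i) = p0"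
    using pb0 by (auto simp: is_wide_pullback_def wide_cone_def Y_f_p_q_def)
  have p: "smor Q L X p" "p0 = mk L X p"
    using hom_SliceD[OF p0_hom] hom_Slice_mk[OF p0_hom] by (auto simp: Y_f_p_q_def)
  have q: "smor Q L (Y i) (q i)" "q0 i = mk L (Y i) (q i)" if "i \<in> I" for i
    using hom_SliceD[OF q0_hom[OF that]] hom_Slice_mk[OF q0_hom[OF that]] by (auto simp: Y_f_p_q_def)
  have L: "L \<in> over_obj U Q" using smor_objs(1)[OF p(1)] .
  have fq: "f i (q i l) = p l" if "i \<in> I" "l \<in> carr L" for i l
  proof -
    have "mk L X (\<lambda>l. f i (q i l)) = mk L X p"
      using fq0[OF that(1)] by (simp only: f(2)[OF that(1)] q(2)[OF that(1)] p(2) Comp_mk_smor[OF q(1)[OF that(1)]])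
    then show ?thesis using that(2) by (simp add: mk_eq_iff)
  qed
  have pb: "is_wide_pullback (Slice U Q) I X (\<lambda>i. mk (Y i) X (f i)) L (mk L X p) (\<lambda>i. mk L (Y i) (q i))"
    using pb0 unfolding is_wide_pullback_def wide_cone_def p(2) by (simp add: f(2) q(2))
  have "is_weak_wide_pullback (Slice U Q) I (PO X) (\<lambda>i. mk (PO (Y i)) (PO X) (Pm (Y i) X (f i))) (PO L)
    (mk (PO L) (PO X) (Pm L X p)) (\<lambda>i. mk (PO L) (PO (Y i)) (Pm L (Y i) (q i)))"
  proof (subst weak_wide_pullback_iff)
    show "\<forall>z\<in>PC X. \<forall>w. (\<forall>i\<in>I. w i \<in> PC (Y i) \<and> Pm (Y i) X (f i) (w i) = z) \<longrightarrow>
      (\<exists>l\<in>PC L. Pm L X p l = z \<and> (\<forall>i\<in>I. Pm L (Y i) (q i) l = w i))"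
    proof (intro ballI allI impI)
      fix z w assume z: "z \<in> PC X" and w: "\<forall>i\<in>I. w i \<in> PC (Y i) \<and> Pm (Y i) X (f i) (w i) = z"
      obtain n a x where t: "(n, a, x) \<in> star_tuples A X" "z = val X n a x" using valE[OF X z] .
      \<comment> \<open>One name \<open>(n, a, x)\<close> of the base element is fixed and lifted
        along every \<open>f i\<close>. All \<open>w i\<close> thus share the operation
        \<open>a\<close>, and their entries in each position form a matching family, which lifts to
        \<open>L\<close>.\<close>
      have "\<exists>y. (n, a, y) \<in> star_tuples A (Y i) \<and> val (Y i) n a y = w i \<and> compose {1..n} (f i) y = x"
        if i: "i \<in> I" for i
        using val_lift[OF f(1)[OF i] _ t(1)] w i t(2) by metis
      then obtain y where y: "\<And>i. i \<in> I \<Longrightarrow> (n, a, y i) \<in> star_tuples A (Y i)"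
        "\<And>i. i \<in> I \<Longrightarrow> val (Y i) n a (y i) = w i" "\<And>i. i \<in> I \<Longrightarrow> compose {1..n} (f i) (y i) = x" by metis
      have "\<exists>l\<in>carr L. p l = x j \<and> (\<forall>i\<in>I. q i l = y i j)" if j: "j \<in> {1..n}" for j
      proof (rule wide_pullback_imp[OF f(1) pb X tuplesD(3)[OF t(1) j]])
        show "y i j \<in> carr (Y i)" if "i \<in> I" for i using tuplesD(3)[OF y(1)[OF that] j] .
        show "f i (y i j) = x j" if "i \<in> I" for i using fun_cong[OF y(3)[OF that], of j] j by (simp add: compose_def)
      qed
      then obtain l0 where l0: "\<And>j. j \<in> {1..n} \<Longrightarrow> l0 j \<in> carr L \<and> p (l0 j) = x j \<and> (\<forall>i\<in>I. q i (l0 j) = y i j)" by metis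
      define l where "l = restrict l0 {1..n}"
      have l: "l j \<in> carr L" "p (l j) = x j" "\<And>i. i \<in> I \<Longrightarrow> q i (l j) = y i j" if "j \<in> {1..n}" for j
        using l0[OF that] that by (auto simp: l_def)
      have tl: "(n, a, l) \<in> star_tuples A L"
      proof (rule tuplesI)
        show "l \<in> {1..n} \<rightarrow>\<^sub>E carr L" using l(1) by (auto simp: l_def)
        show "disp L (l j) = bd A n a j" if "j \<in> {1..n}" for j
          using smor_disp[OF p(1) l(1)[OF that]] l(2)[OF that] tuplesD(4)[OF t(1) that] by simp
      qed (rule tuplesD(1)[OF t(1)])
      have "Pm L X p (val L n a l) = z"
        using Pm_val[OF p(1) tl] compose_eqI[of n p l x, OF l(2) tuplesD(2)[OF t(1)]] t(2) by simp
      moreover have "Pm L (Y i) (q i) (val L n a l) = w i" if i: "i \<in> I" for i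
        using Pm_val[OF q(1)[OF i] tl] compose_eqI[of n "q i" l "y i", OF l(3)[OF _ i] tuplesD(2)[OF y(1)[OF i]]] y(2)[OF i] by simp
      ultimately show "\<exists>l\<in>PC L. Pm L X p l = z \<and> (\<forall>i\<in>I. Pm L (Y i) (q i) l = w i)"
        using val_in[OF L tl] by blast
    qed
    show "Pm (Y i) X (f i) (Pm L (Y i) (q i) l) = Pm L X p l" if "i \<in> I" "l \<in> PC L" for i l
      using Pm_comp[OF q(1)[OF that(1)] f(1)[OF that(1)] that(2)] Pm_cong[of L "\<lambda>l. f i (q i l)" p X] fq[OF that(1)] by simp
  qed (use Pm_smor f p q P_obj X in auto)
  then show "is_weak_wide_pullback (Slice U Q) I (PO X) (\<lambda>i. on_ar P (f0 i)) (PO L) (on_ar P p0) (\<lambda>i. on_ar P (q0 i))"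
    unfolding is_weak_wide_pullback_def wide_cone_def p(2)
    by (simp add: f(2) q(2) P_mk[OF f(1)] P_mk[OF q(1)] P_mk[OF p(1)])
qed

end

section \<open>Finite elements and generic elements\<close>

context slice_functor
begin

text \<open>The finite object \<open>(n]\<close> with colours \<open>d\<close>; its points are codes
  of numbers because carriers consist of elements of \<open>'u\<close>.\<close>

definition std :: "nat \<Rightarrow> (nat \<Rightarrow> 'u) \<Rightarrow> ('u, 'u) over" where
  "std n d = \<lparr> carr = num ` {1..n}, disp = (\<lambda>v\<in>num ` {1..n}. d (inv num v)) \<rparr>"

lemma carr_std [simp]: "carr (std n d) = num ` {1..n}"
  by (simp add: std_def)

lemma disp_std [simp]: "i \<in> {1..n} \<Longrightarrow> disp (std n d) (num i) = d i"
  by (simp add: std_def)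

lemma std_obj: "(\<And>i. i \<in> {1..n} \<Longrightarrow> d i \<in> Q) \<Longrightarrow> std n d \<in> over_obj U Q"
  using subset_in_U[OF range_num, of "num ` {1..n}"] by (auto simp: over_obj_def std_def)

text \<open>\<open>x\<close> is an arrow from \<open>(std n d, a)\<close> to \<open>(X, z)\<close> in the category of elements of \<open>P\<close>.\<close>

definition rep :: "('u, 'u) over \<Rightarrow> 'u \<Rightarrow> nat \<Rightarrow> (nat \<Rightarrow> 'u) \<Rightarrow> 'u \<Rightarrow> (nat \<Rightarrow> 'u) \<Rightarrow> bool" where
  "rep X z n d a x \<longleftrightarrow> X \<in> over_obj U Q \<and> d \<in> {1..n} \<rightarrow>\<^sub>E Q \<and> a \<in> PC (std n d) \<and>
     (\<forall>i\<in>{1..n}. x i \<in> carr X \<and> disp X (x i) = d i) \<and> Pm (std n d) X (\<lambda>v. x (inv num v)) a = z"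

lemma repD:
  assumes "rep X z n d a x"
  shows "X \<in> over_obj U Q" "d \<in> {1..n} \<rightarrow>\<^sub>E Q" "a \<in> PC (std n d)"
    "i \<in> {1..n} \<Longrightarrow> x i \<in> carr X" "i \<in> {1..n} \<Longrightarrow> disp X (x i) = d i"
    "Pm (std n d) X (\<lambda>v. x (inv num v)) a = z"
  using assms by (simp_all add: rep_def)

lemma std_smor:
  assumes "X \<in> over_obj U Q" "\<And>i. i \<in> {1..n} \<Longrightarrow> x i \<in> carr X" "\<And>i. i \<in> {1..n} \<Longrightarrow> disp X (x i) = d i"
  shows "smor Q (std n d) X (\<lambda>v. x (inv num v))"
proof -
  have "d i \<in> Q" if "i \<in> {1..n}" for i
    using assms(2)[OF that] assms(3)[OF that, symmetric] carr_disp[OF assms(1)] by simp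
  then show ?thesis using assms std_obj[of n d] by (auto simp: smor_def)
qed

lemma rep_smor: "rep X z n d a x \<Longrightarrow> smor Q (std n d) X (\<lambda>v. x (inv num v))"
  by (rule std_smor) (auto dest: repD)

lemma rep_in: "rep X z n d a x \<Longrightarrow> z \<in> PC X"
  using Pm_in[OF rep_smor repD(3)] repD(6) by metis

lemma rep_push:
  assumes r: "rep X z n d a x" and f: "smor Q X Y f"
  shows "rep Y (Pm X Y f z) n d a (\<lambda>i. f (x i))"
  unfolding rep_def
proof (intro conjI ballI)
  show "Pm (std n d) Y (\<lambda>v. f (x (inv num v))) a = Pm X Y f z"
    using Pm_comp[OF rep_smor[OF r] f repD(3)[OF r]] repD(6)[OF r] by simp
qed (use repD[OF r] smor_in[OF f] smor_disp[OF f] smor_objs[OF f] in auto)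

lemma rep_comp:
  assumes r: "rep X z n d a x" and s: "rep (std n d) a m e c y"
  shows "rep X z m e c (\<lambda>i. x (inv num (y i)))"
  using rep_push[OF s rep_smor[OF r]] repD(6)[OF r] by simp

lemma rep_cong:
  assumes "rep X z n d a x" "\<And>i. i \<in> {1..n} \<Longrightarrow> x i = x' i"
  shows "rep X z n d a x'"
proof -
  have "Pm (std n d) X (\<lambda>v. x (inv num v)) = Pm (std n d) X (\<lambda>v. x' (inv num v))"
    using assms(2) by (intro Pm_cong) auto
  then show ?thesis using assms by (simp add: rep_def)
qed

definition sub :: "('u, 'u) over \<Rightarrow> 'u set \<Rightarrow> ('u, 'u) over" where
  "sub X T = \<lparr> carr = T, disp = restrict (disp X) T \<rparr>"

lemma carr_sub [simp]: "carr (sub X T) = T"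
  by (simp add: sub_def)

lemma disp_sub [simp]: "x \<in> T \<Longrightarrow> disp (sub X T) x = disp X x"
  by (simp add: sub_def)

lemma sub_obj: "X \<in> over_obj U Q \<Longrightarrow> T \<subseteq> carr X \<Longrightarrow> sub X T \<in> over_obj U Q"
  using subset_in_U[of "carr X" T] by (auto simp: over_obj_def sub_def)

lemma sub_smor: "X \<in> over_obj U Q \<Longrightarrow> S \<subseteq> T \<Longrightarrow> T \<subseteq> carr X \<Longrightarrow> smor Q (sub X S) (sub X T) (\<lambda>x. x)"
  using sub_obj[of X S] sub_obj[of X T] by (auto simp: smor_def)

lemma sub_incl: "X \<in> over_obj U Q \<Longrightarrow> T \<subseteq> carr X \<Longrightarrow> smor Q (sub X T) X (\<lambda>x. x)"
  using sub_obj[of X T] by (auto simp: smor_def)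

lemma rep_of_finite_sub:
  assumes X: "X \<in> over_obj U Q" and T: "finite T" "T \<subseteq> carr X" and z: "z \<in> PC (sub X T)"
  shows "\<exists>d a x. rep X (Pm (sub X T) X (\<lambda>x. x) z) (card T) d a x"
proof -
  obtain b where b: "bij_betw b {1..card T} T"
    using ex_bij_betw_nat_finite_1[OF T(1)] by blast
  define n where "n = card T"
  define d where "d = (\<lambda>i\<in>{1..n}. disp X (b i))"
  define g where "g = inv_into {1..n} b"
  have b_in: "b i \<in> T" if "i \<in> {1..n}" for i using bij_betw_apply[OF b] that by (simp add: n_def)
  have g: "g x \<in> {1..n}" "b (g x) = x" if "x \<in> T" for x
    using that bij_betw_inv_into_right[OF b] bij_betw_apply[OF bij_betw_inv_into[OF b]] by (auto simp: g_def n_def)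
  have d: "d \<in> {1..n} \<rightarrow>\<^sub>E Q" using carr_disp[OF X subsetD[OF T(2) b_in]] by (auto simp: d_def)
  have "std n d \<in> over_obj U Q" using d by (intro std_obj) auto
  then have g_smor: "smor Q (sub X T) (std n d) (\<lambda>x. num (g x))"
    using sub_obj[OF X T(2)] g by (auto simp: smor_def d_def)
  let ?a = "Pm (sub X T) (std n d) (\<lambda>x. num (g x)) z"
  have a: "?a \<in> PC (std n d)" by (rule Pm_in[OF g_smor z])
  have b_smor: "smor Q (std n d) X (\<lambda>v. b (inv num v))"
    using b_in T(2) by (intro std_smor X) (auto simp: d_def)
  have "Pm (std n d) X (\<lambda>v. b (inv num v)) ?a = Pm (sub X T) X (\<lambda>x. b (inv num (num (g x)))) z"
    by (rule Pm_comp[OF g_smor b_smor z])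
  also have "\<dots> = Pm (sub X T) X (\<lambda>x. x) z"
    using Pm_cong[of "sub X T" "\<lambda>x. b (inv num (num (g x)))" "\<lambda>x. x" X] g by simp
  finally have "rep X (Pm (sub X T) X (\<lambda>x. x) z) n d ?a b"
    unfolding rep_def using X d a b_in T(2) by (auto simp: d_def)
  then show ?thesis unfolding n_def by blast
qed

lemma rep_image:
  assumes r: "rep X z n d a x"
  shows "\<exists>d a y. rep X z (card (x ` {1..n})) d a y"
proof -
  let ?T = "x ` {1..n}"
  have X: "X \<in> over_obj U Q" using repD(1)[OF r] .
  have T: "?T \<subseteq> carr X" using repD(4)[OF r] by auto
  have x: "smor Q (std n d) (sub X ?T) (\<lambda>v. x (inv num v))"
    using repD[OF r] sub_obj[OF X T] by (intro std_smor) auto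
  have "z = Pm (sub X ?T) X (\<lambda>x. x) (Pm (std n d) (sub X ?T) (\<lambda>v. x (inv num v)) a)"
    using Pm_comp[OF x sub_incl[OF X T] repD(3)[OF r]] repD(6)[OF r] by simp
  then show ?thesis
    using rep_of_finite_sub[OF X _ T Pm_in[OF x repD(3)[OF r]]] by simp
qed

end

section \<open>Finite representations, common refinements and generic elements\<close>

locale joyal_functor = slice_functor U pr Q P for U :: "'u set set" and pr Q P +
  assumes Q: "Q \<in> U"
    and finitary: "finitary U (Slice U Q) (Slice U Q) P"
    and wide_pullbacks: "weakly_preserves_wide_pullbacks U (Slice U Q) (Slice U Q) P"
begin

text \<open>\<open>X\<close> is the filtered colimit of its finite subobjects, and \<open>P\<close>
  preserves it. The subobjects are indexed by codes of lists, whose smallness is known, so several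
  indices may stand for the same subset.\<close>

lemma ex_rep:
  assumes X: "X \<in> over_obj U Q" and z: "z \<in> PC X"
  shows "\<exists>n d a x. rep X z n d a x"
proof -
  have "small (lists (carr X))"
    using X by (intro small_lists) (simp add: small_in_U_iff over_obj_in_U)
  then obtain e where e: "inj_on e (lists (carr X))" "e ` lists (carr X) \<in> U" by (rule small_coding)
  define els where "els i = set (inv_into (lists (carr X)) e i)" for i
  have els_e: "els (e l) = set l" if "l \<in> lists (carr X)" for l using e(1) that by (simp add: els_def)
  define Ob where "Ob = e ` lists (carr X)"
  have els_sub: "els i \<subseteq> carr X" if "i \<in> Ob" for i using that els_e by (auto simp: Ob_def)
  have finite_els: "finite (els i)" for i by (simp add: els_def)
  have ex_els: "\<exists>i\<in>Ob. els i = T" if T: "finite T" "T \<subseteq> carr X" for T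
  proof -
    obtain l where "set l = T" using finite_list[OF T(1)] by blast
    then show ?thesis using els_e[of l] T(2) by (intro bexI[of _ "e l"]) (auto simp: Ob_def)
  qed
  \<comment> \<open>A preorder: an arrow is the code of the pair of its ends, so parallel arrows are
    equal.\<close>
  define J :: "('u, 'u) category" where
    "J = \<lparr> Obj = Ob, Arr = pr ` {(i, j). i \<in> Ob \<and> j \<in> Ob \<and> els i \<subseteq> els j},
           Dom = (\<lambda>h. fst (inv pr h)), Cod = (\<lambda>h. snd (inv pr h)),
           Ident = (\<lambda>i. pr (i, i)), Comp = (\<lambda>h g. pr (fst (inv pr g), snd (inv pr h))) \<rparr>"
  define \<Delta> :: "('u, 'u, ('u, 'u) over, ('u, 'u) over_arr) fctr" where
    "\<Delta> = \<lparr> on_ob = (\<lambda>i. sub X (els i)),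
            on_ar = (\<lambda>h. mk (sub X (els (fst (inv pr h)))) (sub X (els (snd (inv pr h)))) (\<lambda>x. x)) \<rparr>"
  have hom_J: "h \<in> hom J i j \<longleftrightarrow> i \<in> Ob \<and> j \<in> Ob \<and> els i \<subseteq> els j \<and> h = pr (i, j)" for h i j
    by (auto simp: hom_def J_def)
  have cat: "is_category J"
    unfolding is_category_def by (auto simp: hom_def J_def)
  have Obj: "Obj J \<in> U" using e(2) by (simp add: J_def Ob_def)
  have "small (Ob \<times> Ob)" using Obj by (intro small_Times) (simp_all add: small_in_U_iff J_def)
  then have "small (Arr J)"
    by (rule small_subset[OF small_image[of _ pr]]) (auto simp: J_def)
  then have Arr: "Arr J \<in> U" by (simp add: small_in_U_iff)
  have filt: "is_filtered J"
    unfolding is_filtered_def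
  proof (intro conjI ballI)
    show "Obj J \<noteq> {}" by (auto simp: J_def Ob_def)
    fix i j assume ij: "i \<in> Obj J" "j \<in> Obj J"
    then have Ob: "i \<in> Ob" "j \<in> Ob" by (simp_all add: J_def)
    have "els i \<union> els j \<subseteq> carr X" using els_sub Ob by blast
    then obtain k where k: "k \<in> Ob" "els k = els i \<union> els j"
      using ex_els finite_els by (metis finite_Un)
    then have "pr (i, k) \<in> hom J i k" "pr (j, k) \<in> hom J j k" using Ob by (simp_all add: hom_J)
    then show "\<exists>k\<in>Obj J. hom J i k \<noteq> {} \<and> hom J j k \<noteq> {}" using k(1) by (intro bexI[of _ k]) (auto simp: J_def)
    fix f g assume "f \<in> hom J i j" "g \<in> hom J i j"
    then have "f = g" by (simp add: hom_J)
    moreover have "pr (j, j) \<in> hom J j j" using Ob by (simp add: hom_J)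
    ultimately show "\<exists>k\<in>Obj J. \<exists>h\<in>hom J j k. Comp J h f = Comp J h g" using ij by blast
  qed
  have func: "is_functor J (Slice U Q) \<Delta>"
    unfolding is_functor_def
  proof (intro conjI ballI impI)
    fix i assume "i \<in> Obj J"
    then have "i \<in> Ob" by (simp add: J_def)
    then show "on_ob \<Delta> i \<in> Obj (Slice U Q)" using sub_obj[OF X els_sub] by (simp add: \<Delta>_def)
    show "on_ar \<Delta> (Ident J i) = Ident (Slice U Q) (on_ob \<Delta> i)" by (simp add: \<Delta>_def J_def)
  next
    fix f assume "f \<in> Arr J"
    then obtain i j where f: "f = pr (i, j)" "i \<in> Ob" "j \<in> Ob" "els i \<subseteq> els j" by (auto simp: J_def)
    show "on_ar \<Delta> f \<in> hom (Slice U Q) (on_ob \<Delta> (Dom J f)) (on_ob \<Delta> (Cod J f))"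
      using sub_smor[OF X f(4) els_sub[OF f(3)]] by (simp add: \<Delta>_def J_def f(1) mk_in_hom_iff)
    fix g assume "g \<in> Arr J" "Cod J f = Dom J g"
    then obtain k where g: "g = pr (j, k)" by (auto simp: J_def f(1))
    show "on_ar \<Delta> (Comp J g f) = Comp (Slice U Q) (on_ar \<Delta> g) (on_ar \<Delta> f)"
      using Comp_mk_smor[OF sub_smor[OF X f(4) els_sub[OF f(3)]]] by (simp add: \<Delta>_def J_def f(1) g)
  qed
  interpret F: filtered_diagram U pr J Q \<Delta> by unfold_locales (fact cat Obj filt func)+
  have D: "F.D i = sub X (els i)" for i by (simp add: \<Delta>_def)
  define c where "c i = mk (sub X (els i)) X (\<lambda>x. x)" for i
  have "is_cocone J (Slice U Q) \<Delta> X (\<lambda>i. mk (F.D i) X (\<lambda>x. x))"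
  proof (rule F.coconeI)
    show "smor Q (F.D i) X (\<lambda>x. x)" if "i \<in> Obj J" for i
      using sub_incl[OF X els_sub] that by (simp add: D J_def)
    show "F.T h x = x" if "h \<in> hom J i j" "x \<in> carr (F.D i)" for h i j x
      using that by (simp add: \<Delta>_def hom_J)
  qed (rule X)
  then have cocone: "is_cocone J (Slice U Q) \<Delta> X c" by (simp add: c_def[abs_def] D)
  have "is_colimit J (Slice U Q) \<Delta> X c"
  proof (rule F.colimitI[OF cocone])
    fix x assume x: "x \<in> carr X"
    then obtain i where "i \<in> Ob" "els i = {x}" using ex_els[of "{x}"] by auto
    then show "\<exists>j\<in>Obj J. \<exists>y\<in>carr (F.D j). fn (c j) y = x"
      by (intro bexI[of _ i] bexI[of _ x]) (simp_all add: c_def D J_def)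
  next
    fix j y y' assume j: "j \<in> Obj J" and y: "y \<in> carr (F.D j)" "y' \<in> carr (F.D j)" "fn (c j) y = fn (c j) y'"
    then have "y = y'" by (simp add: c_def D)
    then show "\<exists>k. \<exists>h\<in>hom J j k. F.T h y = F.T h y'" using F.ident_hom[OF j] by blast
  qed
  then have Pcol: "is_colimit J (Slice U Q) (P \<circ>\<^sub>F \<Delta>) (PO X) (\<lambda>j. on_ar P (c j))"
    using finitary cat Obj Arr filt func unfolding finitary_def by blast
  interpret G: filtered_diagram U pr J Q "P \<circ>\<^sub>F \<Delta>"
    by unfold_locales (fact cat Obj filt is_functor_fcomp[OF func P])+
  obtain i w where i: "i \<in> Obj J" "w \<in> carr (G.D i)" "fn (on_ar P (c i)) w = z"
    using G.colimit_imp(1)[OF Pcol z] by blast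
  have "i \<in> Ob" using i(1) by (simp add: J_def)
  moreover have "w \<in> PC (sub X (els i))" using i(2) by (simp add: fcomp_def \<Delta>_def)
  moreover have "Pm (sub X (els i)) X (\<lambda>x. x) w = z" using i(3) by (simp add: c_def Pm_def)
  ultimately show ?thesis using rep_of_finite_sub[OF X finite_els els_sub] by metis
qed

text \<open>Only countable wide pullbacks of finite objects are needed: their carriers are small
  because \<open>U\<close> contains a set of the size of the continuum.\<close>

lemma common_refinement:
  fixes n :: "nat \<Rightarrow> nat"
  assumes r: "\<And>k. rep X z (n k) (d k) (a k) (x k)"
  shows "\<exists>m e c y. (\<forall>k. rep (std (n k) (d k)) (a k) m e c (y k)) \<and>
    (\<forall>k l. \<forall>i\<in>{1..m}. x k (inv num (y k i)) = x l (inv num (y l i)))"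
proof -
  have X: "X \<in> over_obj U Q" using repD(1)[OF r] .
  \<comment> \<open>The points of the wide pullback: an element \<open>s\<close> of the base and,
    for each \<open>k\<close>, the index \<open>v k\<close> of an entry of \<open>x k\<close> equal
    to \<open>s\<close>.\<close>
  define T where "T = {(s, v). s \<in> carr X \<and> (\<forall>k. v k \<in> {1..n k} \<and> x k (v k) = s)}"
  have "small (carr X \<times> (UNIV :: (nat \<Rightarrow> nat) set))"
    using X by (intro small_Times small_nat_funs) (simp add: small_in_U_iff over_obj_in_U)
  then have "small T" by (rule small_subset) (auto simp: T_def)
  then obtain e where e: "inj_on e T" "e ` T \<in> U" by (rule small_coding)
  define dec where "dec = inv_into T e"
  have dec_e [simp]: "dec (e t) = t" if "t \<in> T" for t using that e(1) by (simp add: dec_def)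
  define W where "W = \<lparr> carr = e ` T, disp = (\<lambda>w\<in>e ` T. disp X (fst (dec w))) \<rparr>"
  \<comment> \<open>Index sets of wide pullbacks are subsets of \<open>'u\<close>, so the member
    \<open>k\<close> of the family is indexed by \<open>num k\<close>.\<close>
  define Y f q where "Y v = std (n (inv num v)) (d (inv num v))"
    "f v = (\<lambda>w. x (inv num v) (inv num w))"
    "q v = (\<lambda>w. num (snd (dec w) (inv num v)))" for v
  define p where "p w = fst (dec w)" for w
  have W_obj: "W \<in> over_obj U Q"
    using e(2) carr_disp[OF X] by (auto simp: W_def over_obj_def T_def)
  have f: "smor Q (Y v) X (f v)" for v unfolding Y_f_q_def by (rule rep_smor[OF r])
  have Y_obj: "Y v \<in> over_obj U Q" for v using smor_objs(1)[OF f] .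
  have p: "smor Q W X p"
    using W_obj X by (auto simp: smor_def p_def W_def T_def)
  have q: "smor Q W (Y v) (q v)" for v
    unfolding smor_def
  proof (intro conjI W_obj Y_obj ballI)
    show "q v \<in> carr W \<rightarrow> carr (Y v)" by (auto simp: W_def Y_f_q_def T_def)
    show "disp (Y v) (q v w) = disp W w" if w: "w \<in> carr W" for w
    proof -
      obtain t where "t \<in> T" "w = e t" using w by (auto simp: W_def)
      moreover obtain s u where "t = (s, u)" by (metis surj_pair)
      ultimately have t: "(s, u) \<in> T" "w = e (s, u)" by auto
      then have "u k \<in> {1..n k}" "x k (u k) = s" for k by (auto simp: T_def)
      then show ?thesis
        using t repD(5)[OF r[of "inv num v"], of "u (inv num v)"] by (simp add: Y_f_q_def W_def)
    qed
  qed
  have fq: "f v (q v w) = p w" if "w \<in> carr W" for v w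
    using that by (auto simp: W_def Y_f_q_def p_def T_def)
  have "is_wide_pullback (Slice U Q) (range num) X (\<lambda>v. mk (Y v) X (f v)) W (mk W X p) (\<lambda>v. mk W (Y v) (q v))"
  proof (rule wide_pullbackI[OF f p q fq])
    fix s y assume s: "s \<in> carr X" and y: "\<And>v. v \<in> range num \<Longrightarrow> y v \<in> carr (Y v)"
      "\<And>v. v \<in> range num \<Longrightarrow> f v (y v) = s"
    define u where "u k = inv num (y (num k))" for k
    have u: "u k \<in> {1..n k}" "num (u k) = y (num k)" "x k (u k) = s" for k
      using y[of "num k"] by (auto simp: u_def Y_f_q_def)
    then have t: "(s, u) \<in> T" using s by (simp add: T_def)
    then show "\<exists>l\<in>carr W. p l = s \<and> (\<forall>v\<in>range num. q v l = y v)"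
      using u(2) by (intro bexI[of _ "e (s, u)"]) (auto simp: W_def p_def Y_f_q_def)
  next
    fix w w' assume w: "w \<in> carr W" "w' \<in> carr W" and eq: "p w = p w'" "\<And>v. v \<in> range num \<Longrightarrow> q v w = q v w'"
    have "snd (dec w) k = snd (dec w') k" for k using eq(2)[of "num k"] by (simp add: Y_f_q_def)
    then have "dec w = dec w'" using eq(1) by (auto simp: p_def prod_eq_iff)
    moreover obtain t t' where "t \<in> T" "t' \<in> T" "w = e t" "w' = e t'" using w by (auto simp: W_def)
    ultimately show "w = w'" by simp
  qed
  then have "is_weak_wide_pullback (Slice U Q) (range num) (PO X) (\<lambda>v. on_ar P (mk (Y v) X (f v)))
      (PO W) (on_ar P (mk W X p)) (\<lambda>v. on_ar P (mk W (Y v) (q v)))"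
    using wide_pullbacks[unfolded weakly_preserves_wide_pullbacks_def, rule_format,
        of "range num" X "\<lambda>v. mk (Y v) X (f v)" W "mk W X p" "\<lambda>v. mk W (Y v) (q v)"] X f range_num
    by (simp add: mk_in_Arr_iff)
  then have weak: "is_weak_wide_pullback (Slice U Q) (range num) (PO X) (\<lambda>v. mk (PO (Y v)) (PO X) (Pm (Y v) X (f v)))
      (PO W) (mk (PO W) (PO X) (Pm W X p)) (\<lambda>v. mk (PO W) (PO (Y v)) (Pm W (Y v) (q v)))"
    by (simp add: P_mk[OF f] P_mk[OF p] P_mk[OF q])
  have Pfq: "Pm (Y v) X (f v) (Pm W (Y v) (q v) l) = Pm W X p l" if "l \<in> PC W" for v l
    using Pm_comp[OF q f that] Pm_cong[of W "\<lambda>w. f v (q v w)" p X] fq by simp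
  have z: "z \<in> PC X" "\<forall>v\<in>range num. a (inv num v) \<in> PC (Y v) \<and> Pm (Y v) X (f v) (a (inv num v)) = z"
    using rep_in[OF r] repD(3,6)[OF r] by (auto simp: Y_f_q_def)
  have E: "\<forall>z\<in>PC X. \<forall>y. (\<forall>v\<in>range num. y v \<in> PC (Y v) \<and> Pm (Y v) X (f v) (y v) = z) \<longrightarrow>
      (\<exists>l\<in>PC W. Pm W X p l = z \<and> (\<forall>v\<in>range num. Pm W (Y v) (q v) l = y v))"
    using weak by (subst (asm) weak_wide_pullback_iff) (simp_all add: Pm_smor f p q P_obj X Pfq)
  have "\<exists>l\<in>PC W. Pm W X p l = z \<and> (\<forall>v\<in>range num. Pm W (Y v) (q v) l = a (inv num v))"
    by (rule mp[OF spec[OF bspec[OF E z(1)], of "\<lambda>v. a (inv num v)"] z(2)])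
  then obtain w where w: "w \<in> PC W" "\<And>v. v \<in> range num \<Longrightarrow> Pm W (Y v) (q v) w = a (inv num v)" by blast
  \<comment> \<open>\<open>W\<close> may be infinite, but a finite element that maps to
    \<open>w\<close> maps on to every \<open>a k\<close>.\<close>
  obtain m e' c y where y: "rep W w m e' c y" using ex_rep[OF W_obj w(1)] by blast
  have "rep (std (n k) (d k)) (a k) m e' c (\<lambda>i. q (num k) (y i))" for k
    using rep_push[OF y q[of "num k"]] w(2)[of "num k"] by (simp add: Y_f_q_def)
  moreover have "x k (inv num (q (num k) (y i))) = p (y i)" if "i \<in> {1..m}" for k i
    using fq[OF repD(4)[OF y that], of "num k"] by (simp add: Y_f_q_def)
  ultimately show ?thesis by (intro exI[of _ m] exI[of _ e'] exI[of _ c] exI[of _ "\<lambda>k i. q (num k) (y i)"]) simp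
qed

definition min_size :: "('u, 'u) over \<Rightarrow> 'u \<Rightarrow> nat" where
  "min_size X z = (LEAST m. \<exists>d a x. rep X z m d a x)"

lemma min_size_le: "rep X z m d a x \<Longrightarrow> min_size X z \<le> m"
  unfolding min_size_def by (rule Least_le) blast

lemma min_sizeE:
  assumes "X \<in> over_obj U Q" "z \<in> PC X"
  obtains d a x where "rep X z (min_size X z) d a x"
proof -
  have "\<exists>m d a x. rep X z m d a x" using ex_rep[OF assms] .
  then show thesis
    using LeastI_ex[of "\<lambda>m. \<exists>d a x. rep X z m d a x"] that unfolding min_size_def by blast
qed

text \<open>Whatever maps to \<open>a\<close> maps on to \<open>z\<close>, so passing to a
  refinement can only increase the minimal size.\<close>

lemma min_size_mono:
  assumes "rep X z n d a x"
  shows "min_size X z \<le> min_size (std n d) a"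
proof -
  have "std n d \<in> over_obj U Q" using repD(2)[OF assms] by (intro std_obj) auto
  then obtain e c y where "rep (std n d) a (min_size (std n d) a) e c y"
    using min_sizeE repD(3)[OF assms] by metis
  then show ?thesis using rep_comp[OF assms] min_size_le by blast
qed

text \<open>Every arrow into \<open>(std n d, a)\<close> in the category of elements of \<open>P\<close> splits.\<close>

definition generic :: "nat \<Rightarrow> (nat \<Rightarrow> 'u) \<Rightarrow> 'u \<Rightarrow> bool" where
  "generic n d a \<longleftrightarrow> d \<in> {1..n} \<rightarrow>\<^sub>E Q \<and> a \<in> PC (std n d) \<and>
     (\<forall>m e c s. rep (std n d) a m e c s \<longrightarrow>
        (\<exists>t. rep (std m e) c n d a t \<and> (\<forall>i\<in>{1..n}. s (inv num (t i)) = num i)))"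

text \<open>A refinement \<open>c\<close> of \<open>a\<close> again has minimal size
  \<open>n\<close>, so some \<open>c'\<close> of size \<open>n\<close> maps to it. The composite
  \<open>q\<close> from \<open>c'\<close> to \<open>a\<close> is injective, hence a bijection, and
  its inverse followed by \<open>s'\<close> splits \<open>s\<close>.\<close>

lemma genericI_min_size:
  assumes d: "d \<in> {1..n} \<rightarrow>\<^sub>E Q" and a: "a \<in> PC (std n d)" and n: "min_size (std n d) a = n"
    and max: "\<And>m e c s. rep (std n d) a m e c s \<Longrightarrow> min_size (std m e) c \<le> n"
  shows "generic n d a"
  unfolding generic_def
proof (intro conjI d a allI impI)
  fix m e c s assume s: "rep (std n d) a m e c s"
  have "min_size (std m e) c = n"
    using max[OF s] min_size_mono[OF s] n by simp
  moreover have "std m e \<in> over_obj U Q" using repD(2)[OF s] by (intro std_obj) auto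
  ultimately obtain e' c' s' where s': "rep (std m e) c n e' c' s'"
    using min_sizeE repD(3)[OF s] by metis
  define q where "q i = s (inv num (s' i))" for i
  have q: "rep (std n d) a n e' c' q" using rep_comp[OF s s'] by (simp add: q_def[abs_def])
  \<comment> \<open>With fewer distinct entries, \<open>rep_image\<close> would represent
    \<open>a\<close> by an element smaller than its minimal size.\<close>
  have "card (q ` {1..n}) \<ge> n"
    using rep_image[OF q] min_size_le n by metis
  then have "inj_on q {1..n}"
    by (intro eq_card_imp_inj_on) (simp_all add: card_image_le le_antisym[OF card_image_le])
  define \<pi> where "\<pi> i = inv num (q i)" for i
  have \<pi>: "\<pi> i \<in> {1..n}" "num (\<pi> i) = q i" if "i \<in> {1..n}" for i
    using repD(4)[OF q that] by (auto simp: \<pi>_def)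
  have "inj_on \<pi> {1..n}" using \<open>inj_on q {1..n}\<close> \<pi>(2) by (metis inj_onD inj_onI)
  then have bij: "bij_betw \<pi> {1..n} {1..n}"
    using endo_inj_surj[of "{1..n}" \<pi>] image_subsetI[of "{1..n}" \<pi>, OF \<pi>(1)] by (simp add: bij_betw_def)
  define \<kappa> where "\<kappa> = inv_into {1..n} \<pi>"
  have \<kappa>: "\<kappa> i \<in> {1..n}" "\<pi> (\<kappa> i) = i" if "i \<in> {1..n}" for i
    using bij_betw_apply[OF bij_betw_inv_into[OF bij] that] bij_betw_inv_into_right[OF bij that] by (auto simp: \<kappa>_def)
  have \<kappa>\<pi>: "\<kappa> (\<pi> i) = i" if "i \<in> {1..n}" for i using bij_betw_inv_into_left[OF bij that] by (simp add: \<kappa>_def)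
  have e': "std n e' \<in> over_obj U Q" using repD(2)[OF s'] by (intro std_obj) auto
  have e'd: "e' (\<kappa> i) = d i" if "i \<in> {1..n}" for i
    using repD(5)[OF q \<kappa>(1)[OF that]] \<pi>(2)[OF \<kappa>(1)[OF that]] \<kappa>(2)[OF that] that by (metis disp_std)
  have "rep (std n e') c' n d a (\<lambda>i. num (\<kappa> i))"
    unfolding rep_def
  proof (intro conjI ballI e' d a)
    have \<kappa>_smor: "smor Q (std n d) (std n e') (\<lambda>v. num (\<kappa> (inv num v)))"
      using \<kappa>(1) e'd by (intro std_smor e') auto
    have "a = Pm (std n e') (std n d) (\<lambda>v. q (inv num v)) c'" using repD(6)[OF q] by simp
    then have "Pm (std n d) (std n e') (\<lambda>v. num (\<kappa> (inv num v))) a =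
      Pm (std n e') (std n e') (\<lambda>v. num (\<kappa> (inv num (q (inv num v))))) c'"
      using Pm_comp[OF rep_smor[OF q] \<kappa>_smor repD(3)[OF q]] by simp
    also have "\<dots> = Pm (std n e') (std n e') (\<lambda>v. v) c'"
    proof -
      have "Pm (std n e') (std n e') (\<lambda>v. num (\<kappa> (inv num (q (inv num v))))) = Pm (std n e') (std n e') (\<lambda>v. v)"
        using \<kappa>\<pi> by (intro Pm_cong) (auto simp flip: \<pi>_def)
      then show ?thesis by simp
    qed
    also have "\<dots> = c'" by (rule Pm_id[OF e' repD(3)[OF q]])
    finally show "Pm (std n d) (std n e') (\<lambda>v. num (\<kappa> (inv num v))) a = c'" .
  qed (use \<kappa>(1) e'd in auto)
  from rep_comp[OF s' this] have "rep (std m e) c n d a (\<lambda>i. s' (\<kappa> i))" by simp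
  moreover have "s (inv num (s' (\<kappa> i))) = num i" if "i \<in> {1..n}" for i
    using \<pi>(2)[OF \<kappa>(1)[OF that]] \<kappa>(2)[OF that] by (simp add: q_def)
  ultimately show "\<exists>t. rep (std m e) c n d a t \<and> (\<forall>i\<in>{1..n}. s (inv num (t i)) = num i)" by blast
qed

text \<open>The minimal sizes above \<open>z\<close> are bounded, since a common refinement of elements of
  unbounded minimal size would be infinite; one where the maximum is attained is generic.\<close>

lemma ex_generic:
  assumes X: "X \<in> over_obj U Q" and z: "z \<in> PC X"
  shows "\<exists>n d a x. rep X z n d a x \<and> generic n d a"
proof -
  define M where "M k \<longleftrightarrow> (\<exists>n d a x. rep X z n d a x \<and> min_size (std n d) a = k)" for k
  have "\<exists>b. \<forall>k. M k \<longrightarrow> k \<le> b"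
  proof (rule ccontr)
    assume "\<not> ?thesis"
    then have "\<forall>b. \<exists>n d a x. rep X z n d a x \<and> b < min_size (std n d) a" unfolding M_def by (metis not_le)
    then obtain n d a x where nd: "\<And>b. rep X z (n b) (d b) (a b) (x b)" "\<And>b. b < min_size (std (n b) (d b)) (a b)"
      by metis
    obtain m e c y where "\<And>k. rep (std (n k) (d k)) (a k) m e c (y k)"
      using common_refinement[of X z n d a x, OF nd(1)] by blast
    \<comment> \<open>The refinement has size \<open>m\<close>, yet the member of the sequence with
      index \<open>m\<close> was chosen with minimal size above \<open>m\<close>.\<close>
    then show False using min_size_le nd(2)[of m] by (metis not_le)
  qed
  then obtain b where b: "\<And>k. M k \<Longrightarrow> k \<le> b" by blast
  have "\<exists>k. M k" using ex_rep[OF X z] by (auto simp: M_def)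
  then obtain N where N: "M N" "\<And>k. M k \<Longrightarrow> k \<le> N" using b GreatestI_ex_nat[of M b] Greatest_le_nat[of M _ b] by blast
  obtain n d a x where r: "rep X z n d a x" "min_size (std n d) a = N" using N(1) by (auto simp: M_def)
  have "std n d \<in> over_obj U Q" using repD(2)[OF r(1)] by (intro std_obj) auto
  \<comment> \<open>The arity \<open>n\<close> may exceed the minimal size \<open>N\<close> of
    \<open>a\<close>. The element \<open>c\<close> that maps to \<open>a\<close> has arity exactly
    \<open>N\<close>, and its minimal size can neither drop nor exceed the maximum.\<close>
  then obtain e c y where y: "rep (std n d) a N e c y" using min_sizeE repD(3)[OF r(1)] r(2) by metis
  have rc: "rep X z N e c (\<lambda>i. x (inv num (y i)))" by (rule rep_comp[OF r(1) y])
  have "generic N e c"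
  proof (rule genericI_min_size)
    show "min_size (std N e) c = N"
      using min_size_mono[OF y] r(2) N(2)[of "min_size (std N e) c"] rc unfolding M_def by fastforce
    show "min_size (std m e') c' \<le> N" if "rep (std N e) c m e' c' s" for m e' c' s
      using N(2) rep_comp[OF rc that] unfolding M_def by blast
  qed (use repD[OF rc] in auto)
  then show ?thesis using rc by blast
qed

text \<open>A common refinement splits over both elements, which gives arrows \<open>h\<close> and
  \<open>k\<close> between them in the two directions. Their composites are endomorphisms of generic
  elements, hence surjective, and finiteness makes \<open>h\<close> a bijection.\<close>

lemma generic_unique:
  assumes r: "rep X z n d a x" "rep X z m e b y" and gen: "generic n d a" "generic m e b"
  shows "m = n \<and> (\<exists>\<tau>. \<tau> permutes {1..n} \<and> rep (std m e) b n d a (\<lambda>i. num (\<tau> i)) \<and> (\<forall>i\<in>{1..n}. y (\<tau> i) = x i))"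
proof -
  \<comment> \<open>An endomorphism of a generic element is an arrow into it and therefore has a
    section.\<close>
  have surj: "g ` {1..k} = num ` {1..k}" if ru: "rep (std k f) u k f u g" and gu: "generic k f u" for k f u g
  proof -
    obtain t where t: "rep (std k f) u k f u t" "\<forall>i\<in>{1..k}. g (inv num (t i)) = num i"
      using gu ru unfolding generic_def by blast
    have "inv num (t i) \<in> {1..k}" if "i \<in> {1..k}" for i using repD(4)[OF t(1) that] by auto
    then have "num ` {1..k} \<subseteq> g ` {1..k}" using t(2) by (metis image_eqI image_subsetI)
    then show ?thesis using repD(4)[OF ru] by auto
  qed
  \<comment> \<open>\<open>common_refinement\<close> takes sequences, so the pair is padded: the
    first element at index 0, the second at all other indices.\<close>
  have "rep X z (if k = 0 then n else m) (if k = 0 then d else e) (if k = 0 then a else b) (if k = 0 then x else y)"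
    for k :: nat using r by simp
  from common_refinement[of X z "\<lambda>k. if k = 0 then n else m" "\<lambda>k. if k = 0 then d else e" "\<lambda>k. if k = 0 then a else b"
      "\<lambda>k. if k = 0 then x else y", OF this]
  obtain l e' c w where w: "\<forall>k::nat. rep (std (if k = 0 then n else m) (if k = 0 then d else e)) (if k = 0 then a else b) l e' c (w k)"
    "\<forall>(k::nat) (j::nat). \<forall>i\<in>{1..l}. (if k = 0 then x else y) (inv num (w k i)) = (if j = 0 then x else y) (inv num (w j i))"
    by (elim exE conjE) (rule that, assumption, assumption)
  have p: "rep (std n d) a l e' c (w 0)" and q: "rep (std m e) b l e' c (w 1)"
    using spec[OF w(1), of 0] spec[OF w(1), of 1] by simp_all
  have pq: "x (inv num (w 0 i)) = y (inv num (w 1 i))" if "i \<in> {1..l}" for i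
    using w(2)[rule_format, OF that, of 0 1] by simp
  obtain s where s: "rep (std l e') c n d a s" "\<And>i. i \<in> {1..n} \<Longrightarrow> w 0 (inv num (s i)) = num i"
    using gen(1) p unfolding generic_def by blast
  obtain t where t: "rep (std l e') c m e b t" "\<And>i. i \<in> {1..m} \<Longrightarrow> w 1 (inv num (t i)) = num i"
    using gen(2) q unfolding generic_def by blast
  define h where "h i = w 1 (inv num (s i))" for i
  define k where "k i = w 0 (inv num (t i))" for i
  have h: "rep (std m e) b n d a h" using rep_comp[OF q s(1)] by (simp add: h_def[abs_def])
  have k: "rep (std n d) a m e b k" using rep_comp[OF p t(1)] by (simp add: k_def[abs_def])
  have yh: "y (inv num (h i)) = x i" if i: "i \<in> {1..n}" for i
  proof -
    have "inv num (s i) \<in> {1..l}" using repD(4)[OF s(1) i] by auto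
    then show ?thesis using pq s(2)[OF i] by (simp flip: h_def) (metis inv_num h_def)
  qed
  have h_in: "inv num (h i) \<in> {1..m}" "num (inv num (h i)) = h i" if "i \<in> {1..n}" for i
    using repD(4)[OF h that] by auto
  have k_in: "inv num (k i) \<in> {1..n}" "num (inv num (k i)) = k i" if "i \<in> {1..m}" for i
    using repD(4)[OF k that] by auto
  have "num ` {1..n} \<subseteq> k ` {1..m}"
    using surj[OF rep_comp[OF k h] gen(1)] h_in(1) by blast
  from card_mono[OF _ this] have "n \<le> m"
    using card_image_le[of "{1..m}" k] inj_on_subset[OF inj_num] by (simp add: card_image)
  moreover have hsurj: "num ` {1..m} \<subseteq> h ` {1..n}"
    using surj[OF rep_comp[OF h k] gen(2)] k_in(1) by blast
  from card_mono[OF _ this] have "m \<le> n"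
    using card_image_le[of "{1..n}" h] inj_on_subset[OF inj_num] by (simp add: card_image)
  ultimately have m: "m = n" by simp
  define \<tau> where "\<tau> i = (if i \<in> {1..n} then inv num (h i) else i)" for i
  have "{1..n} \<subseteq> \<tau> ` {1..n}"
  proof
    fix j assume "j \<in> {1..n}"
    then have "num j \<in> h ` {1..n}" using hsurj m by blast
    then obtain i where "i \<in> {1..n}" "num j = h i" by blast
    then have "i \<in> {1..n}" "\<tau> i = j" by (simp_all add: \<tau>_def flip: \<open>num j = h i\<close>)
    then show "j \<in> \<tau> ` {1..n}" by blast
  qed
  moreover have "\<tau> ` {1..n} \<subseteq> {1..n}" using h_in(1) by (auto simp: \<tau>_def m)
  ultimately have "\<tau> ` {1..n} = {1..n}" by blast
  then have "bij_betw \<tau> {1..n} {1..n}" by (simp add: bij_betw_def eq_card_imp_inj_on)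
  then have "\<tau> permutes {1..n}" by (rule bij_imp_permutes) (simp only: \<tau>_def if_False)
  moreover have "rep (std m e) b n d a (\<lambda>i. num (\<tau> i))"
    by (rule rep_cong[OF h]) (simp add: \<tau>_def h_in)
  moreover have "\<forall>i\<in>{1..n}. y (\<tau> i) = x i" using yh by (simp add: \<tau>_def)
  ultimately show ?thesis using m by blast
qed

end

section \<open>The symmetric signature of generic elements\<close>

context joyal_functor
begin

text \<open>The action is from the right while \<open>P\<close> is covariant, whence the inverse.
  Colours are respected because \<open>(d \<circ> \<sigma>) (inv \<sigma> i) = d i\<close>.\<close>

definition perm_act :: "nat \<Rightarrow> (nat \<Rightarrow> 'u) \<Rightarrow> 'u \<Rightarrow> (nat \<Rightarrow> nat) \<Rightarrow> 'u" where
  "perm_act n d a \<sigma> = Pm (std n d) (std n (d \<circ> \<sigma>)) (\<lambda>v. num (inv \<sigma> (inv num v))) a"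

lemma vector_perm:
  assumes d: "d \<in> {1..n} \<rightarrow>\<^sub>E Q" and \<sigma>: "\<sigma> permutes {1..n}"
  shows "d \<circ> \<sigma> \<in> {1..n} \<rightarrow>\<^sub>E Q"
  using d permutes_in_image[OF \<sigma>] permutes_not_in[OF \<sigma>] by (auto simp: PiE_iff extensional_def)

lemma std_vector_obj: "d \<in> {1..n} \<rightarrow>\<^sub>E Q \<Longrightarrow> std n d \<in> over_obj U Q"
  by (intro std_obj) auto

lemma perm_smor:
  assumes d: "d \<in> {1..n} \<rightarrow>\<^sub>E Q" and \<sigma>: "\<sigma> permutes {1..n}"
  shows "smor Q (std n d) (std n (d \<circ> \<sigma>)) (\<lambda>v. num (inv \<sigma> (inv num v)))"
proof (rule std_smor[OF std_vector_obj[OF vector_perm[OF d \<sigma>]]])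
  fix i assume "i \<in> {1..n}"
  then have "inv \<sigma> i \<in> {1..n}" using permutes_in_image[OF permutes_inv[OF \<sigma>]] by blast
  with permutes_inverses(1)[OF \<sigma>, of i] show "num (inv \<sigma> i) \<in> carr (std n (d \<circ> \<sigma>))" "disp (std n (d \<circ> \<sigma>)) (num (inv \<sigma> i)) = d i"
    by simp_all
qed

lemma rep_perm_act:
  assumes d: "d \<in> {1..n} \<rightarrow>\<^sub>E Q" and a: "a \<in> PC (std n d)" and \<sigma>: "\<sigma> permutes {1..n}"
  shows "rep (std n (d \<circ> \<sigma>)) (perm_act n d a \<sigma>) n d a (\<lambda>i. num (inv \<sigma> i))"
    and "rep (std n d) a n (d \<circ> \<sigma>) (perm_act n d a \<sigma>) (\<lambda>i. num (\<sigma> i))"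
proof -
  have in_iff: "inv \<sigma> i \<in> {1..n} \<longleftrightarrow> i \<in> {1..n}" "\<sigma> i \<in> {1..n} \<longleftrightarrow> i \<in> {1..n}" for i
    using permutes_in_image[OF permutes_inv[OF \<sigma>]] permutes_in_image[OF \<sigma>] by auto
  show "rep (std n (d \<circ> \<sigma>)) (perm_act n d a \<sigma>) n d a (\<lambda>i. num (inv \<sigma> i))"
    unfolding rep_def perm_act_def using d a in_iff std_vector_obj[OF vector_perm[OF d \<sigma>]]
    by (simp add: permutes_inverses(1)[OF \<sigma>])
  have \<sigma>_smor: "smor Q (std n (d \<circ> \<sigma>)) (std n d) (\<lambda>v. num (\<sigma> (inv num v)))"
    using in_iff(2) by (intro std_smor std_vector_obj d) (simp_all add: imageI)
  have "Pm (std n (d \<circ> \<sigma>)) (std n d) (\<lambda>v. num (\<sigma> (inv num v))) (perm_act n d a \<sigma>) =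
      Pm (std n d) (std n d) (\<lambda>v. num (\<sigma> (inv num (num (inv \<sigma> (inv num v)))))) a"
    unfolding perm_act_def by (rule Pm_comp[OF perm_smor[OF d \<sigma>] \<sigma>_smor a])
  also have "\<dots> = Pm (std n d) (std n d) (\<lambda>v. v) a"
  proof -
    have "Pm (std n d) (std n d) (\<lambda>v. num (\<sigma> (inv num (num (inv \<sigma> (inv num v)))))) = Pm (std n d) (std n d) (\<lambda>v. v)"
      by (intro Pm_cong) (auto simp: permutes_inverses(1)[OF \<sigma>])
    then show ?thesis by simp
  qed
  also have "\<dots> = a" by (rule Pm_id[OF std_vector_obj[OF d] a])
  finally show "rep (std n d) a n (d \<circ> \<sigma>) (perm_act n d a \<sigma>) (\<lambda>i. num (\<sigma> i))"
    unfolding rep_def using d in_iff vector_perm[OF d \<sigma>] std_vector_obj[OF d] Pm_in[OF perm_smor[OF d \<sigma>] a]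
    by (simp add: perm_act_def)
qed

text \<open>Genericity is invariant under isomorphism: sections are transported along the two arrows
  of \<open>rep_perm_act\<close>.\<close>

lemma generic_perm_act:
  assumes g: "generic n d a" and \<sigma>: "\<sigma> permutes {1..n}"
  shows "generic n (d \<circ> \<sigma>) (perm_act n d a \<sigma>)"
proof -
  have d: "d \<in> {1..n} \<rightarrow>\<^sub>E Q" and a: "a \<in> PC (std n d)" using g by (auto simp: generic_def)
  note r = rep_perm_act[OF d a \<sigma>]
  show ?thesis
    unfolding generic_def
  proof (intro conjI allI impI)
    fix m e c s assume s: "rep (std n (d \<circ> \<sigma>)) (perm_act n d a \<sigma>) m e c s"
    have "rep (std n d) a m e c (\<lambda>i. num (\<sigma> (inv num (s i))))" by (rule rep_comp[OF r(2) s])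
    then obtain t where t: "rep (std m e) c n d a t"
      "\<And>i. i \<in> {1..n} \<Longrightarrow> num (\<sigma> (inv num (s (inv num (t i))))) = num i"
      using g unfolding generic_def by blast
    have "rep (std m e) c n (d \<circ> \<sigma>) (perm_act n d a \<sigma>) (\<lambda>i. t (\<sigma> i))"
      using rep_comp[OF t(1) r(2)] by simp
    moreover have "s (inv num (t (\<sigma> i))) = num i" if i: "i \<in> {1..n}" for i
    proof -
      have \<sigma>i: "\<sigma> i \<in> {1..n}" using i permutes_in_image[OF \<sigma>] by blast
      then have "\<sigma> (inv num (s (inv num (t (\<sigma> i))))) = \<sigma> i" using t(2) by simp
      then have "inv num (s (inv num (t (\<sigma> i)))) = i" using permutes_inj[OF \<sigma>] by (auto dest: injD)
      moreover have "inv num (t (\<sigma> i)) \<in> {1..m}" using repD(4)[OF t(1) \<sigma>i] by auto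
      from repD(4)[OF s this] have "s (inv num (t (\<sigma> i))) \<in> num ` {1..n}" by simp
      ultimately show ?thesis by auto
    qed
    ultimately show "\<exists>t. rep (std m e) c n (d \<circ> \<sigma>) (perm_act n d a \<sigma>) t \<and>
        (\<forall>i\<in>{1..n}. s (inv num (t i)) = num i)" by blast
  qed (use repD(2,3)[OF r(2)] in auto)
qed

text \<open>One code for the colour tuples of all arities, as the operations of a signature have to
  be elements of \<open>'u\<close>.\<close>

definition vec_code :: "(nat \<Rightarrow> 'u) \<Rightarrow> 'u" where
  "vec_code = (SOME e. inj_on e (\<Union>n. {1..n} \<rightarrow>\<^sub>E Q) \<and> e ` (\<Union>n. {1..n} \<rightarrow>\<^sub>E Q) \<in> U)"

lemma vec_code: "inj_on vec_code (\<Union>n. {1..n} \<rightarrow>\<^sub>E Q)" "vec_code ` (\<Union>n. {1..n} \<rightarrow>\<^sub>E Q) \<in> U"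
proof -
  have "small (\<Union>n. {1..n::nat} \<rightarrow>\<^sub>E Q)" using Q by (intro small_vectors) (simp add: small_in_U_iff)
  then have "\<exists>e :: (nat \<Rightarrow> 'u) \<Rightarrow> 'u. inj_on e (\<Union>n. {1..n} \<rightarrow>\<^sub>E Q) \<and> e ` (\<Union>n. {1..n} \<rightarrow>\<^sub>E Q) \<in> U"
    by (rule small_coding) blast
  from someI_ex[OF this] show "inj_on vec_code (\<Union>n. {1..n} \<rightarrow>\<^sub>E Q)" "vec_code ` (\<Union>n. {1..n} \<rightarrow>\<^sub>E Q) \<in> U"
    unfolding vec_code_def by auto
qed

text \<open>The colours are stored along with the element, since the same member of
  \<open>'u\<close> may occur in \<open>P (std n d)\<close> for several \<open>d\<close>.\<close>

definition mk_op :: "(nat \<Rightarrow> 'u) \<Rightarrow> 'u \<Rightarrow> 'u" where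
  "mk_op d a = pr (vec_code d, a)"

definition vec :: "'u \<Rightarrow> nat \<Rightarrow> 'u" where
  "vec w = inv_into (\<Union>n. {1..n} \<rightarrow>\<^sub>E Q) vec_code (fst (inv pr w))"

definition elt :: "'u \<Rightarrow> 'u" where
  "elt w = snd (inv pr w)"

lemma elt_mk_op [simp]: "elt (mk_op d a) = a"
  by (simp add: elt_def mk_op_def)

lemma vec_mk_op: "d \<in> {1..n} \<rightarrow>\<^sub>E Q \<Longrightarrow> vec (mk_op d a) = d"
  unfolding vec_def mk_op_def inv_pr fst_conv by (rule inv_into_f_f[OF vec_code(1)]) blast

definition gen_sig :: "('u, 'u) sym_sig" where
  "gen_sig = \<lparr> ops = (\<lambda>n. {mk_op d a |d a. generic n d a}),
               act = (\<lambda>n w \<sigma>. mk_op (vec w \<circ> \<sigma>) (perm_act n (vec w) (elt w) \<sigma>)),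
               bd = (\<lambda>n w. \<lambda>i\<in>{0..n}. if i = 0 then disp (PO (std n (vec w))) (elt w) else vec w i) \<rparr>"

definition gen_val :: "('u, 'u) over \<Rightarrow> nat \<Rightarrow> 'u \<Rightarrow> (nat \<Rightarrow> 'u) \<Rightarrow> 'u" where
  "gen_val X n w x = Pm (std n (vec w)) X (\<lambda>v. x (inv num v)) (elt w)"

lemma genericD: "generic n d a \<Longrightarrow> d \<in> {1..n} \<rightarrow>\<^sub>E Q" "generic n d a \<Longrightarrow> a \<in> PC (std n d)"
  by (simp_all add: generic_def)

lemma gen_opsE:
  assumes "w \<in> ops gen_sig n"
  obtains d a where "w = mk_op d a" "generic n d a" "vec w = d" "elt w = a"
  using assms vec_mk_op[OF genericD(1)] by (auto simp: gen_sig_def)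

lemma gen_ops_in_U: "ops gen_sig n \<in> U"
proof -
  have "small (\<Union>n. {1..n::nat} \<rightarrow>\<^sub>E Q)" using Q by (intro small_vectors) (simp add: small_in_U_iff)
  then have "small ({1..n} \<rightarrow>\<^sub>E Q)" by (rule small_subset) blast
  then have "small (\<Union>d\<in>{1..n} \<rightarrow>\<^sub>E Q. mk_op d ` PC (std n d))"
    by (intro small_UN small_image) (simp_all add: small_in_U_iff over_obj_in_U[OF P_obj[OF std_vector_obj]])
  moreover have "ops gen_sig n \<subseteq> (\<Union>d\<in>{1..n} \<rightarrow>\<^sub>E Q. mk_op d ` PC (std n d))"
  proof
    fix w assume "w \<in> ops gen_sig n"
    then obtain d a where "w = mk_op d a" "generic n d a" by (rule gen_opsE)
    then show "w \<in> (\<Union>d\<in>{1..n} \<rightarrow>\<^sub>E Q. mk_op d ` PC (std n d))"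
      using genericD[of n d a] by (auto intro!: bexI[of _ d])
  qed
  ultimately show ?thesis using small_subset small_in_U_iff by blast
qed

lemma perm_act_comp:
  assumes d: "d \<in> {1..n} \<rightarrow>\<^sub>E Q" and a: "a \<in> PC (std n d)" and \<sigma>: "\<sigma> permutes {1..n}" and \<rho>: "\<rho> permutes {1..n}"
  shows "perm_act n (d \<circ> \<sigma>) (perm_act n d a \<sigma>) \<rho> = perm_act n d a (\<sigma> \<circ> \<rho>)"
proof -
  have "inv (\<sigma> \<circ> \<rho>) = inv \<rho> \<circ> inv \<sigma>" using permutes_bij[OF \<sigma>] permutes_bij[OF \<rho>] by (intro o_inv_distrib)
  then show ?thesis
    using Pm_comp[OF perm_smor[OF d \<sigma>] perm_smor[OF vector_perm[OF d \<sigma>] \<rho>] a]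
    by (simp add: perm_act_def o_assoc)
qed

lemma perm_act_id: "d \<in> {1..n} \<rightarrow>\<^sub>E Q \<Longrightarrow> a \<in> PC (std n d) \<Longrightarrow> perm_act n d a id = a"
proof -
  assume d: "d \<in> {1..n} \<rightarrow>\<^sub>E Q" and a: "a \<in> PC (std n d)"
  have "Pm (std n d) (std n d) (\<lambda>v. num (inv num v)) = Pm (std n d) (std n d) (\<lambda>v. v)"
    by (rule Pm_cong) auto
  then show ?thesis using Pm_id[OF std_vector_obj[OF d] a] by (simp add: perm_act_def)
qed

lemma disp_perm_act:
  assumes d: "d \<in> {1..n} \<rightarrow>\<^sub>E Q" and a: "a \<in> PC (std n d)" and \<sigma>: "\<sigma> permutes {1..n}"
  shows "disp (PO (std n (d \<circ> \<sigma>))) (perm_act n d a \<sigma>) = disp (PO (std n d)) a"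
  unfolding perm_act_def by (rule smor_disp[OF Pm_smor[OF perm_smor[OF d \<sigma>]] a])

lemma is_sym_sig_gen_sig: "is_sym_sig U Q gen_sig"
  unfolding is_sym_sig_def
proof (intro conjI allI ballI impI)
  fix n show "ops gen_sig n \<in> U" by (rule gen_ops_in_U)
  fix w assume "w \<in> ops gen_sig n"
  then obtain d a where w: "w = mk_op d a" "generic n d a" and [simp]: "vec w = d" "elt w = a" by (rule gen_opsE)
  note d = genericD(1)[OF w(2)] and a = genericD(2)[OF w(2)]
  have act: "act gen_sig n w \<sigma> = mk_op (d \<circ> \<sigma>) (perm_act n d a \<sigma>)" for \<sigma> by (simp add: gen_sig_def)
  show "act gen_sig n w id = w" unfolding act using w(1) perm_act_id[OF d a] by simp
  have "disp (PO (std n d)) a \<in> Q" by (rule carr_disp[OF P_obj[OF std_vector_obj[OF d]] a])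
  then show "bd gen_sig n w \<in> {0..n} \<rightarrow>\<^sub>E Q"
    using d by (auto simp: gen_sig_def PiE_iff)
  fix \<sigma> assume \<sigma>: "\<sigma> permutes {1..n}"
  show "act gen_sig n w \<sigma> \<in> ops gen_sig n"
    using generic_perm_act[OF w(2) \<sigma>] unfolding act by (auto simp: gen_sig_def)
  have vec\<sigma>: "vec (act gen_sig n w \<sigma>) = d \<circ> \<sigma>" unfolding act by (rule vec_mk_op[OF vector_perm[OF d \<sigma>]])
  have elt\<sigma>: "elt (act gen_sig n w \<sigma>) = perm_act n d a \<sigma>" by (simp add: act)
  show "bd gen_sig n (act gen_sig n w \<sigma>) = bd gen_sig n w \<circ> \<sigma>"
  proof
    fix i
    have bd: "bd gen_sig n p i = (if i \<in> {0..n} then if i = 0 then disp (PO (std n (vec p))) (elt p) else vec p i else undefined)"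
      for p i by (simp add: gen_sig_def)
    consider "i = 0" | "i \<in> {1..n}" | "n < i" by fastforce
    then show "bd gen_sig n (act gen_sig n w \<sigma>) i = (bd gen_sig n w \<circ> \<sigma>) i"
    proof cases
      case 1
      then have "\<sigma> i = 0" using permutes_not_in[OF \<sigma>, of i] by simp
      then show ?thesis using 1 by (simp add: bd vec\<sigma> elt\<sigma> disp_perm_act[OF d a \<sigma>])
    next
      case 2
      then have "\<sigma> i \<in> {1..n}" using permutes_in_image[OF \<sigma>] by blast
      then show ?thesis using 2 by (simp add: bd vec\<sigma>)
    next
      case 3
      then have "\<sigma> i = i" using permutes_not_in[OF \<sigma>, of i] by simp
      then show ?thesis using 3 by (simp add: bd)
    qed
  qed
  fix \<rho> assume \<rho>: "\<rho> permutes {1..n}"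
  have "act gen_sig n (act gen_sig n w \<sigma>) \<rho> = mk_op (d \<circ> \<sigma> \<circ> \<rho>) (perm_act n (d \<circ> \<sigma>) (perm_act n d a \<sigma>) \<rho>)"
    using vec\<sigma> elt\<sigma> by (simp add: gen_sig_def)
  then show "act gen_sig n (act gen_sig n w \<sigma>) \<rho> = act gen_sig n w (\<sigma> \<circ> \<rho>)"
    by (simp add: act perm_act_comp[OF d a \<sigma> \<rho>] o_assoc)
qed

lemma rep_gen_val:
  assumes X: "X \<in> over_obj U Q" and t: "(n, w, x) \<in> star_tuples gen_sig X"
  shows "rep X (gen_val X n w x) n (vec w) (elt w) x" "generic n (vec w) (elt w)"
proof -
  have w: "w \<in> ops gen_sig n" and x: "x \<in> {1..n} \<rightarrow>\<^sub>E carr X" "\<And>i. i \<in> {1..n} \<Longrightarrow> disp X (x i) = vec w i"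
    using t by (auto simp: star_tuples_def gen_sig_def)
  from w obtain d a where "w = mk_op d a" "generic n d a" "vec w = d" "elt w = a" by (rule gen_opsE)
  then show g: "generic n (vec w) (elt w)" by simp
  show "rep X (gen_val X n w x) n (vec w) (elt w) x"
    unfolding rep_def gen_val_def using X x genericD[OF g] by auto
qed

lemma gen_tuplesI:
  assumes r: "rep X z n d a x" and g: "generic n d a"
  shows "(n, mk_op d a, restrict x {1..n}) \<in> star_tuples gen_sig X"
  using g repD(4,5)[OF r] vec_mk_op[OF genericD(1)[OF g]] by (auto simp: star_tuples_def gen_sig_def)

text \<open>Names exist by \<open>ex_generic\<close> and are unique up to permutation by
  \<open>generic_unique\<close>. Evaluation pushes a generic element along its tuple, so
  compatibility with arrows is functoriality of \<open>P\<close>.\<close>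

lemma gen_presentation: "presentation U pr Q P gen_sig gen_val"
proof -
  interpret signature U pr Q gen_sig by unfold_locales (rule is_sym_sig_gen_sig)
  show ?thesis
  proof unfold_locales
    fix X n w x assume X: "X \<in> over_obj U Q" and t: "(n, w, x) \<in> star_tuples gen_sig X"
    note r = rep_gen_val[OF X t]
    show "gen_val X n w x \<in> PC X" by (rule rep_in[OF r(1)])
    show "disp (PO X) (gen_val X n w x) = bd gen_sig n w 0"
      using smor_disp[OF Pm_smor[OF rep_smor[OF r(1)]] genericD(2)[OF r(2)]] by (simp add: gen_val_def gen_sig_def)
    fix m p y assume t': "(m, p, y) \<in> star_tuples gen_sig X"
    note r' = rep_gen_val[OF X t']
    show "gen_val X n w x = gen_val X m p y \<longleftrightarrow>
      m = n \<and> (\<exists>\<sigma>. \<sigma> permutes {1..n} \<and> p = act gen_sig n w \<sigma> \<and> y = x \<circ> \<sigma>)"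
    proof
      assume "gen_val X n w x = gen_val X m p y"
      then have "rep X (gen_val X n w x) m (vec p) (elt p) y" using r'(1) by simp
      from generic_unique[OF r(1) this r(2) r'(2)]
      obtain \<tau> where m: "m = n" and \<tau>: "\<tau> permutes {1..n}"
        "rep (std m (vec p)) (elt p) n (vec w) (elt w) (\<lambda>i. num (\<tau> i))" "\<And>i. i \<in> {1..n} \<Longrightarrow> y (\<tau> i) = x i"
        by blast
      \<comment> \<open>\<open>generic_unique\<close> gives \<open>y \<circ> \<tau> = x\<close> on
        \<open>{1..n}\<close>, whereas the relation on tuples asks for
        \<open>y = x \<circ> \<sigma>\<close>.\<close>
      define \<sigma> where "\<sigma> = inv \<tau>"
      have \<sigma>: "\<sigma> permutes {1..n}" "inv \<sigma> = \<tau>" unfolding \<sigma>_def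
        using permutes_inv[OF \<tau>(1)] permutes_inv_inv[OF \<tau>(1)] by auto
      have \<sigma>_in: "\<sigma> i \<in> {1..n} \<longleftrightarrow> i \<in> {1..n}" for i using permutes_in_image[OF \<sigma>(1)] .
      have \<tau>\<sigma>: "\<tau> (\<sigma> i) = i" for i using permutes_inverses(1)[OF \<tau>(1)] by (simp add: \<sigma>_def)
      have y: "y = x \<circ> \<sigma>"
      proof
        fix i show "y i = (x \<circ> \<sigma>) i"
        proof (cases "i \<in> {1..n}")
          case True
          then show ?thesis using \<tau>(3)[of "\<sigma> i"] \<sigma>_in \<tau>\<sigma> by simp
        next
          case False
          then show ?thesis
            using tuplesD(2)[OF t] tuplesD(2)[OF t'] permutes_not_in[OF \<sigma>(1) False] unfolding m
            by (simp add: PiE_def extensional_def)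
        qed
      qed
      have vec: "vec p = vec w \<circ> \<sigma>"
      proof
        fix i show "vec p i = (vec w \<circ> \<sigma>) i"
        proof (cases "i \<in> {1..n}")
          case True
          then have "\<sigma> i \<in> {1..n}" using \<sigma>_in by blast
          from repD(5)[OF \<tau>(2) this] show ?thesis using True \<tau>\<sigma> by (simp add: m)
        next
          case False
          then show ?thesis
            using genericD(1)[OF r(2)] genericD(1)[OF r'(2)] permutes_not_in[OF \<sigma>(1) False] unfolding m
            by (simp add: PiE_def extensional_def)
        qed
      qed
      have "elt p = perm_act n (vec w) (elt w) \<sigma>"
        using repD(6)[OF \<tau>(2)] by (simp add: perm_act_def \<sigma>(2) m vec)
      moreover have "p = mk_op (vec p) (elt p)" using tuplesD(1)[OF t'] by (elim gen_opsE) simp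
      ultimately have "p = act gen_sig n w \<sigma>" by (simp add: gen_sig_def vec)
      then show "m = n \<and> (\<exists>\<sigma>. \<sigma> permutes {1..n} \<and> p = act gen_sig n w \<sigma> \<and> y = x \<circ> \<sigma>)"
        using m \<sigma>(1) y by blast
    next
      assume "m = n \<and> (\<exists>\<sigma>. \<sigma> permutes {1..n} \<and> p = act gen_sig n w \<sigma> \<and> y = x \<circ> \<sigma>)"
      then obtain \<sigma> where m: "m = n" and \<sigma>: "\<sigma> permutes {1..n}" and p: "p = act gen_sig n w \<sigma>" and y: "y = x \<circ> \<sigma>"
        by blast
      note d = genericD(1)[OF r(2)] and a = genericD(2)[OF r(2)]
      have "vec p = vec w \<circ> \<sigma>" "elt p = perm_act n (vec w) (elt w) \<sigma>"
        unfolding p using vec_mk_op[OF vector_perm[OF d \<sigma>]] by (simp_all add: gen_sig_def)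
      then have "rep (std m (vec p)) (elt p) n (vec w) (elt w) (\<lambda>i. num (inv \<sigma> i))"
        using rep_perm_act(1)[OF d a \<sigma>] by (simp add: m)
      from rep_comp[OF r'(1) this] have "rep X (gen_val X m p y) n (vec w) (elt w) x"
        by (simp add: y permutes_inverses(1)[OF \<sigma>])
      from repD(6)[OF this] show "gen_val X n w x = gen_val X m p y" by (simp add: gen_val_def)
    qed
  next
    fix X z assume X: "X \<in> over_obj U Q" and z: "z \<in> PC X"
    obtain n d a x where r: "rep X z n d a x" and g: "generic n d a" using ex_generic[OF X z] by blast
    have "rep X z n d a (restrict x {1..n})" by (rule rep_cong[OF r]) simp
    from repD(6)[OF this] have "gen_val X n (mk_op d a) (restrict x {1..n}) = z"
      by (simp add: gen_val_def vec_mk_op[OF genericD(1)[OF g]])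
    then show "\<exists>n w x. (n, w, x) \<in> star_tuples gen_sig X \<and> gen_val X n w x = z"
      using gen_tuplesI[OF r g] by blast
  next
    fix X Y f n w x assume f: "smor Q X Y f" and t: "(n, w, x) \<in> star_tuples gen_sig X"
    note r = rep_gen_val[OF smor_objs(1)[OF f] t]
    have "rep Y (Pm X Y f (gen_val X n w x)) n (vec w) (elt w) (\<lambda>i. f (x i))" by (rule rep_push[OF r(1) f])
    then have "rep Y (Pm X Y f (gen_val X n w x)) n (vec w) (elt w) (compose {1..n} f x)"
      by (rule rep_cong) (simp add: compose_def)
    from repD(6)[OF this] show "Pm X Y f (gen_val X n w x) = gen_val Y n w (compose {1..n} f x)"
      by (simp add: gen_val_def)
  qed
qed

end

section \<open>The characterisation of analytic functors\<close>

context universe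
begin

theorem analytic_functor_iff:
  assumes Q: "Q \<in> U" and P: "is_functor (Slice U Q) (Slice U Q) P"
  shows "analytic_functor U Q P \<longleftrightarrow> finitary U (Slice U Q) (Slice U Q) P \<and>
    weakly_preserves_wide_pullbacks U (Slice U Q) (Slice U Q) P"
proof
  interpret slice_functor U pr Q P by unfold_locales (rule P)
  assume "analytic_functor U Q P"
  then obtain A :: "('u, 'u) sym_sig" and \<phi> where A: "is_sym_sig U Q A" "is_over_iso (Slice U Q) P (star A) \<phi>"
    unfolding analytic_functor_def by blast
  interpret presentation U pr Q P A "\<lambda>X n a x. inv_into (PC X) (\<phi> X) (star_rel A X `` {(n, a, x)})"
    by (rule presentation_of_iso(1)[OF A])
  show "finitary U (Slice U Q) (Slice U Q) P \<and> weakly_preserves_wide_pullbacks U (Slice U Q) (Slice U Q) P"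
    using finitary_P weakly_preserves_P ..
next
  assume "finitary U (Slice U Q) (Slice U Q) P \<and> weakly_preserves_wide_pullbacks U (Slice U Q) (Slice U Q) P"
  then interpret joyal_functor U pr Q P by unfold_locales (use P Q in auto)
  interpret presentation U pr Q P gen_sig gen_val by (rule gen_presentation)
  show "analytic_functor U Q P"
    unfolding analytic_functor_def using P is_sym_sig_gen_sig is_over_iso by blast
qed

end

section \<open>Analytic transformations\<close>

context universe
begin

abbreviation pull_map :: "('u \<Rightarrow> 'u) \<Rightarrow> 'u \<Rightarrow> 'u" where
  "pull_map g z \<equiv> pr (apsnd g (inv pr z))"

lemma carr_pull: "carr (pull_ob pr K u Y) = pr ` {(k, y). k \<in> K \<and> y \<in> carr Y \<and> u k = disp Y y}"
  by (simp add: pull_ob_def Let_def)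

lemma pull_in_iff [simp]: "pr (k, y) \<in> carr (pull_ob pr K u Y) \<longleftrightarrow> k \<in> K \<and> y \<in> carr Y \<and> u k = disp Y y"
  by (auto simp: carr_pull)

lemma disp_pull: "pr (k, y) \<in> carr (pull_ob pr K u Y) \<Longrightarrow> disp (pull_ob pr K u Y) (pr (k, y)) = k"
  by (auto simp: pull_ob_def Let_def)

lemma pullE:
  assumes "z \<in> carr (pull_ob pr K u Y)"
  obtains k y where "z = pr (k, y)" "k \<in> K" "y \<in> carr Y" "u k = disp Y y" "disp (pull_ob pr K u Y) z = k"
proof -
  obtain k y where "z = pr (k, y)" "k \<in> K" "y \<in> carr Y" "u k = disp Y y" using assms by (auto simp: carr_pull)
  moreover from this have "disp (pull_ob pr K u Y) z = k" by (simp add: disp_pull)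
  ultimately show thesis by (rule that)
qed

lemma pull_obj:
  assumes K: "K \<in> U" and Y: "Y \<in> over_obj U Q"
  shows "pull_ob pr K u Y \<in> over_obj U K"
proof -
  have "small (K \<times> carr Y)" using K over_obj_in_U[OF Y] by (intro small_Times) (simp_all add: small_in_U_iff)
  then have "small (carr (pull_ob pr K u Y))"
    by (rule small_subset[OF small_image[of _ pr]]) (auto simp: carr_pull)
  then show ?thesis
    unfolding small_in_U_iff over_obj_def by (auto simp: pull_ob_def Let_def)
qed

lemma pull_smor:
  assumes K: "K \<in> U" and g: "smor Q Y Z g"
  shows "smor K (pull_ob pr K u Y) (pull_ob pr K u Z) (pull_map g)"
  unfolding smor_def
proof (intro conjI ballI pull_obj[OF K smor_objs(1)[OF g]] pull_obj[OF K smor_objs(2)[OF g]])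
  show "pull_map g \<in> carr (pull_ob pr K u Y) \<rightarrow> carr (pull_ob pr K u Z)"
    using smor_in[OF g] smor_disp[OF g] by (auto simp: carr_pull)
  show "disp (pull_ob pr K u Z) (pull_map g z) = disp (pull_ob pr K u Y) z"
    if z: "z \<in> carr (pull_ob pr K u Y)" for z
    using z
  proof (rule pullE)
    fix k y assume "z = pr (k, y)" "k \<in> K" "y \<in> carr Y" "u k = disp Y y" "disp (pull_ob pr K u Y) z = k"
    then show ?thesis using disp_pull[of k "g y" K u Z] smor_in[OF g] smor_disp[OF g] by simp
  qed
qed

lemma pull_mk: "on_ar (pull pr K u) (mk Y Z g) = mk (pull_ob pr K u Y) (pull_ob pr K u Z) (pull_map g)"
proof -
  have "apsnd (fn (mk Y Z g)) (inv pr z) = apsnd g (inv pr z)" if "z \<in> carr (pull_ob pr K u Y)" for z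
    using that by (auto simp: carr_pull)
  then show ?thesis by (simp add: pull_def mk_def[of "pull_ob pr K u Y"] restrict_def fun_eq_iff)
qed

end

section \<open>Natural transformations between presented functors\<close>

locale pulled_transformation = universe U pr +
  p: presentation U pr K P A vp + r: presentation U pr Q R B vr
  for U :: "'u set set" and pr K P A vp Q R B vr +
  fixes u :: "'u \<Rightarrow> 'u" and \<tau> :: "('u, 'u) over \<Rightarrow> ('u, 'u) over_arr"
  assumes K: "K \<in> U" and u: "u \<in> K \<rightarrow> Q"
    and \<tau>: "is_nat_trans (Slice U Q) (Slice U K) (P \<circ>\<^sub>F pull pr K u) (pull pr K u \<circ>\<^sub>F R) \<tau>"
begin

abbreviation "pb Y \<equiv> pull_ob pr K u Y"
abbreviation "t Y \<equiv> fn (\<tau> Y)"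

lemma pb_obj: "Y \<in> over_obj U Q \<Longrightarrow> pb Y \<in> over_obj U K"
  by (rule pull_obj[OF K])

lemma pb_smor: "smor Q Y Z g \<Longrightarrow> smor K (pb Y) (pb Z) (pull_map g)"
  by (rule pull_smor[OF K])

lemma \<tau>_hom: "Y \<in> over_obj U Q \<Longrightarrow> \<tau> Y \<in> hom (Slice U K) (p.PO (pb Y)) (pb (r.PO Y))"
  using \<tau> by (simp add: is_nat_trans_def fcomp_def pull_def)

lemma t_smor: "Y \<in> over_obj U Q \<Longrightarrow> smor K (p.PO (pb Y)) (pb (r.PO Y)) (t Y)"
  by (rule hom_SliceD[OF \<tau>_hom])

lemma \<tau>_mk: "Y \<in> over_obj U Q \<Longrightarrow> \<tau> Y = mk (p.PO (pb Y)) (pb (r.PO Y)) (t Y)"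
  by (rule hom_Slice_mk[OF \<tau>_hom])

lemma left_mk:
  "smor Q Y Z g \<Longrightarrow> on_ar (P \<circ>\<^sub>F pull pr K u) (mk Y Z g) =
    mk (p.PO (pb Y)) (p.PO (pb Z)) (p.Pm (pb Y) (pb Z) (pull_map g))"
  by (simp add: fcomp_def pull_mk p.P_mk[OF pb_smor])

lemma right_mk:
  "smor Q Y Z g \<Longrightarrow> on_ar (pull pr K u \<circ>\<^sub>F R) (mk Y Z g) =
    mk (pb (r.PO Y)) (pb (r.PO Z)) (pull_map (r.Pm Y Z g))"
  by (simp add: fcomp_def r.P_mk pull_mk)

lemma t_natural:
  assumes g: "smor Q Y Z g" and z: "z \<in> p.PC (pb Y)"
  shows "t Z (p.Pm (pb Y) (pb Z) (pull_map g) z) = pull_map (r.Pm Y Z g) (t Y z)"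
proof -
  have "Comp (Slice U K) (\<tau> Z) (on_ar (P \<circ>\<^sub>F pull pr K u) (mk Y Z g)) =
      Comp (Slice U K) (on_ar (pull pr K u \<circ>\<^sub>F R) (mk Y Z g)) (\<tau> Y)"
    using \<tau>[unfolded is_nat_trans_def, THEN conjunct2, rule_format, of "mk Y Z g"] g
    by (simp add: mk_in_Arr_iff)
  then have "mk (p.PO (pb Y)) (pb (r.PO Z)) (\<lambda>z. t Z (p.Pm (pb Y) (pb Z) (pull_map g) z)) =
      mk (p.PO (pb Y)) (pb (r.PO Z)) (\<lambda>z. pull_map (r.Pm Y Z g) (t Y z))"
    unfolding left_mk[OF g] right_mk[OF g]
    by (subst (asm) \<tau>_mk[OF smor_objs(2)[OF g]], subst (asm) \<tau>_mk[OF smor_objs(1)[OF g]])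
      (simp only: Comp_mk_smor[OF p.Pm_smor[OF pb_smor[OF g]]] Comp_mk_smor[OF t_smor[OF smor_objs(1)[OF g]]])
  then show ?thesis using z by (simp add: mk_eq_iff)
qed

lemma weakly_cartesian_iff:
  "weakly_cartesian (Slice U Q) (Slice U K) (P \<circ>\<^sub>F pull pr K u) (pull pr K u \<circ>\<^sub>F R) \<tau> \<longleftrightarrow>
    (\<forall>Y Z g. smor Q Y Z g \<longrightarrow> (\<forall>z\<in>p.PC (pb Z). \<forall>w\<in>carr (pb (r.PO Y)).
        t Z z = pull_map (r.Pm Y Z g) w \<longrightarrow>
        (\<exists>v\<in>p.PC (pb Y). p.Pm (pb Y) (pb Z) (pull_map g) v = z \<and> t Y v = w)))"
proof -
  have sq: "is_weak_pullback (Slice U K) (on_ar (P \<circ>\<^sub>F pull pr K u) (mk Y Z g)) (\<tau> Y) (\<tau> Z)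
      (on_ar (pull pr K u \<circ>\<^sub>F R) (mk Y Z g)) \<longleftrightarrow>
    (\<forall>z\<in>p.PC (pb Z). \<forall>w\<in>carr (pb (r.PO Y)). t Z z = pull_map (r.Pm Y Z g) w \<longrightarrow>
        (\<exists>v\<in>p.PC (pb Y). p.Pm (pb Y) (pb Z) (pull_map g) v = z \<and> t Y v = w))"
    if g: "smor Q Y Z g" for Y Z g
    unfolding left_mk[OF g] right_mk[OF g]
    by (subst \<tau>_mk[OF smor_objs(1)[OF g]], subst \<tau>_mk[OF smor_objs(2)[OF g]],
        rule weak_pullback_iff[OF p.Pm_smor[OF pb_smor[OF g]] t_smor[OF smor_objs(1)[OF g]]
          t_smor[OF smor_objs(2)[OF g]] pb_smor[OF r.Pm_smor[OF g]] t_natural[OF g]])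
  show ?thesis
    unfolding weakly_cartesian_def
  proof (intro iffI allI impI)
    fix Y Z g
    assume W: "\<forall>f\<in>Arr (Slice U Q). is_weak_pullback (Slice U K) (on_ar (P \<circ>\<^sub>F pull pr K u) f)
      (\<tau> (Dom (Slice U Q) f)) (\<tau> (Cod (Slice U Q) f)) (on_ar (pull pr K u \<circ>\<^sub>F R) f)"
      and g: "smor Q Y Z g"
    show "\<forall>z\<in>p.PC (pb Z). \<forall>w\<in>carr (pb (r.PO Y)). t Z z = pull_map (r.Pm Y Z g) w \<longrightarrow>
        (\<exists>v\<in>p.PC (pb Y). p.Pm (pb Y) (pb Z) (pull_map g) v = z \<and> t Y v = w)"
      using bspec[OF W, of "mk Y Z g"] g sq[OF g] by (simp add: mk_in_Arr_iff)
  next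
    assume E: "\<forall>Y Z g. smor Q Y Z g \<longrightarrow> (\<forall>z\<in>p.PC (pb Z). \<forall>w\<in>carr (pb (r.PO Y)).
        t Z z = pull_map (r.Pm Y Z g) w \<longrightarrow>
        (\<exists>v\<in>p.PC (pb Y). p.Pm (pb Y) (pb Z) (pull_map g) v = z \<and> t Y v = w))"
    show "\<forall>f\<in>Arr (Slice U Q). is_weak_pullback (Slice U K) (on_ar (P \<circ>\<^sub>F pull pr K u) f)
      (\<tau> (Dom (Slice U Q) f)) (\<tau> (Cod (Slice U Q) f)) (on_ar (pull pr K u \<circ>\<^sub>F R) f)"
    proof
      fix f assume "f \<in> Arr (Slice U Q)"
      then obtain Y Z g where g: "smor Q Y Z g" "f = mk Y Z g" by (rule Arr_SliceE)
      have "is_weak_pullback (Slice U K) (on_ar (P \<circ>\<^sub>F pull pr K u) (mk Y Z g)) (\<tau> Y) (\<tau> Z)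
        (on_ar (pull pr K u \<circ>\<^sub>F R) (mk Y Z g))"
        unfolding sq[OF g(1)] using E g(1) by blast
      then show "is_weak_pullback (Slice U K) (on_ar (P \<circ>\<^sub>F pull pr K u) f)
        (\<tau> (Dom (Slice U Q) f)) (\<tau> (Cod (Slice U Q) f)) (on_ar (pull pr K u \<circ>\<^sub>F R) f)"
        by (simp add: g(2))
    qed
  qed
qed

text \<open>The formula of \<open>rep_fn\<close>, stated for names instead of classes.\<close>

definition represented_by :: "(nat \<Rightarrow> 'u \<Rightarrow> 'u) \<Rightarrow> bool" where
  "represented_by f \<longleftrightarrow> (\<forall>Y\<in>over_obj U Q. \<forall>n a x. (n, a, x) \<in> star_tuples A (pb Y) \<longrightarrow>
     t Y (vp (pb Y) n a x) = pr (bd A n a 0, vr Y n (f n a) (compose {1..n} (snd \<circ> inv pr) x)))"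

text \<open>The first component of an entry in the pullback is forced to be a colour of
  \<open>a\<close>, so the tuple is determined by its second components.\<close>

lemma pb_tuple:
  assumes "(n, a, x) \<in> star_tuples A (pb Y)" "i \<in> {1..n}"
  shows "x i = pr (bd A n a i, snd (inv pr (x i)))" "snd (inv pr (x i)) \<in> carr Y"
    "u (bd A n a i) = disp Y (snd (inv pr (x i)))"
proof -
  from p.tuplesD(3)[OF assms] obtain k y where "x i = pr (k, y)" "y \<in> carr Y" "u k = disp Y y" "disp (pb Y) (x i) = k"
    by (rule pullE)
  with p.tuplesD(4)[OF assms] show "x i = pr (bd A n a i, snd (inv pr (x i)))" "snd (inv pr (x i)) \<in> carr Y"
    "u (bd A n a i) = disp Y (snd (inv pr (x i)))" by auto
qed

lemma pb_tupleI:
  assumes "a \<in> ops A n" "\<And>i. i \<in> {1..n} \<Longrightarrow> y i \<in> carr Y" "\<And>i. i \<in> {1..n} \<Longrightarrow> u (bd A n a i) = disp Y (y i)"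
  shows "(n, a, \<lambda>i\<in>{1..n}. pr (bd A n a i, y i)) \<in> star_tuples A (pb Y)"
proof (rule p.tuplesI[OF assms(1)])
  have "pr (bd A n a i, y i) \<in> carr (pb Y)" if "i \<in> {1..n}" for i
    using p.bd_in[OF assms(1)] assms(2,3)[OF that] that by auto
  then show "(\<lambda>i\<in>{1..n}. pr (bd A n a i, y i)) \<in> {1..n} \<rightarrow>\<^sub>E carr (pb Y)"
    "\<And>i. i \<in> {1..n} \<Longrightarrow> disp (pb Y) ((\<lambda>i\<in>{1..n}. pr (bd A n a i, y i)) i) = bd A n a i"
    by (simp_all add: disp_pull)
qed

lemma sig_mor_tuple:
  assumes f: "is_sig_mor A B u f" and x: "(n, a, x) \<in> star_tuples A (pb Y)"
  shows "(n, f n a, compose {1..n} (snd \<circ> inv pr) x) \<in> star_tuples B Y"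
proof (rule r.tuplesI)
  show "f n a \<in> ops B n" using f p.tuplesD(1)[OF x] by (simp add: is_sig_mor_def)
  show "compose {1..n} (snd \<circ> inv pr) x \<in> {1..n} \<rightarrow>\<^sub>E carr Y"
    using pb_tuple(2)[OF x] by (auto simp: compose_def)
  show "disp Y (compose {1..n} (snd \<circ> inv pr) x i) = bd B n (f n a) i" if "i \<in> {1..n}" for i
    using f p.tuplesD(1)[OF x] pb_tuple(3)[OF x that] that by (simp add: is_sig_mor_def compose_def)
qed

lemma t_vp:
  assumes Y: "Y \<in> over_obj U Q" and x: "(n, a, x) \<in> star_tuples A (pb Y)"
  obtains s where "t Y (vp (pb Y) n a x) = pr (bd A n a 0, s)" "s \<in> r.PC Y" "u (bd A n a 0) = disp (r.PO Y) s"
proof -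
  have v: "vp (pb Y) n a x \<in> p.PC (pb Y)" by (rule p.val_in[OF pb_obj[OF Y] x])
  from smor_in[OF t_smor[OF Y] v] obtain k s where s: "t Y (vp (pb Y) n a x) = pr (k, s)" "s \<in> r.PC Y"
    "u k = disp (r.PO Y) s" "disp (pb (r.PO Y)) (t Y (vp (pb Y) n a x)) = k" by (rule pullE)
  moreover have "k = bd A n a 0"
    using smor_disp[OF t_smor[OF Y] v] s(4) p.disp_val[OF pb_obj[OF Y] x] by simp
  ultimately show thesis by (intro that[of s]) simp_all
qed

text \<open>In the square of \<open>g\<close>, \<open>val_lift\<close> for \<open>R\<close> names
  the given element of \<open>R Y\<close> with the operation \<open>f n a\<close>. As
  \<open>f\<close> keeps arity and colours, the tuple of that name, paired with the colours of
  \<open>a\<close>, is a tuple in the pullback, and \<open>a\<close> applied to it is the required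
  element.\<close>

lemma weakly_cartesian_if_represented:
  assumes f: "is_sig_mor A B u f" and rep: "represented_by f"
  shows "weakly_cartesian (Slice U Q) (Slice U K) (P \<circ>\<^sub>F pull pr K u) (pull pr K u \<circ>\<^sub>F R) \<tau>"
  unfolding weakly_cartesian_iff
proof (intro allI impI ballI)
  fix Y Z g z w
  assume g: "smor Q Y Z g" and z: "z \<in> p.PC (pb Z)" and w: "w \<in> carr (pb (r.PO Y))"
    and eq: "t Z z = pull_map (r.Pm Y Z g) w"
  have Y: "Y \<in> over_obj U Q" and Z: "Z \<in> over_obj U Q" using smor_objs[OF g] .
  obtain n a x where x: "(n, a, x) \<in> star_tuples A (pb Z)" "z = vp (pb Z) n a x"
    using p.valE[OF pb_obj[OF Z] z] .
  obtain k s where s: "w = pr (k, s)" "s \<in> r.PC Y" using w by (rule pullE)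
  let ?y = "compose {1..n} (snd \<circ> inv pr) x"
  have "pr (bd A n a 0, vr Z n (f n a) ?y) = pr (k, r.Pm Y Z g s)"
    using rep Z x eq by (simp add: represented_by_def s(1))
  then have k: "k = bd A n a 0" and "r.Pm Y Z g s = vr Z n (f n a) ?y" by simp_all
  then obtain y where y: "(n, f n a, y) \<in> star_tuples B Y" "s = vr Y n (f n a) y" "compose {1..n} g y = ?y"
    using r.val_lift[OF g s(2) sig_mor_tuple[OF f x(1)]] by blast
  have gy: "g (y i) = snd (inv pr (x i))" if "i \<in> {1..n}" for i
    using fun_cong[OF y(3), of i] that by (simp add: compose_def)
  let ?v = "\<lambda>i\<in>{1..n}. pr (bd A n a i, y i)"
  have v: "(n, a, ?v) \<in> star_tuples A (pb Y)"
  proof (rule pb_tupleI[OF p.tuplesD(1)[OF x(1)] r.tuplesD(3)[OF y(1)]])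
    show "u (bd A n a i) = disp Y (y i)" if "i \<in> {1..n}" for i
      using f p.tuplesD(1)[OF x(1)] r.tuplesD(4)[OF y(1) that] that by (simp add: is_sig_mor_def)
  qed
  have "compose {1..n} (pull_map g) ?v = x"
    using gy pb_tuple(1)[OF x(1)] p.tuplesD(2)[OF x(1)] by (intro p.compose_eqI) simp_all
  then have "p.Pm (pb Y) (pb Z) (pull_map g) (vp (pb Y) n a ?v) = z"
    using p.Pm_val[OF pb_smor[OF g] v] x(2) by simp
  moreover have "compose {1..n} (snd \<circ> inv pr) ?v = y"
    using r.tuplesD(2)[OF y(1)] by (intro p.compose_eqI) simp_all
  then have "t Y (vp (pb Y) n a ?v) = w"
    using rep Y v by (simp add: represented_by_def s(1) k y(2))
  ultimately show "\<exists>v\<in>p.PC (pb Y). p.Pm (pb Y) (pb Z) (pull_map g) v = z \<and> t Y v = w"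
    using p.val_in[OF pb_obj[OF Y] v] by blast
qed

text \<open>The operation assigned to \<open>a\<close> is read off the value of \<open>\<tau>\<close> at the universal
  tuple of \<open>a\<close>, whose entries in the \<open>Y\<close>-component are the numbers \<open>1, \<dots>, n\<close>.\<close>

abbreviation univ_ob :: "nat \<Rightarrow> 'u \<Rightarrow> ('u, 'u) over" where
  "univ_ob n a \<equiv> r.std n (\<lambda>i. u (bd A n a i))"

abbreviation univ_tuple :: "nat \<Rightarrow> 'u \<Rightarrow> nat \<Rightarrow> 'u" where
  "univ_tuple n a \<equiv> \<lambda>i\<in>{1..n}. pr (bd A n a i, num i)"

abbreviation nums :: "nat \<Rightarrow> nat \<Rightarrow> 'u" where
  "nums n \<equiv> restrict num {1..n}"

lemma univ_obj:
  assumes "a \<in> ops A n"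
  shows "univ_ob n a \<in> over_obj U Q"
  using p.bd_in[OF assms] u by (intro r.std_obj) (auto simp: PiE_iff Pi_iff)

lemma univ_tuple:
  assumes "a \<in> ops A n"
  shows "(n, a, univ_tuple n a) \<in> star_tuples A (pb (univ_ob n a))"
  using assms by (intro pb_tupleI) auto

lemma univ_map:
  assumes Y: "Y \<in> over_obj U Q" and x: "(n, a, x) \<in> star_tuples A (pb Y)"
  shows "smor Q (univ_ob n a) Y (\<lambda>v. snd (inv pr (x (inv num v))))"
    and "compose {1..n} (pull_map (\<lambda>v. snd (inv pr (x (inv num v))))) (univ_tuple n a) = x"
proof -
  show "smor Q (univ_ob n a) Y (\<lambda>v. snd (inv pr (x (inv num v))))"
    using pb_tuple[OF x] by (intro r.std_smor Y) simp_all
  show "compose {1..n} (pull_map (\<lambda>v. snd (inv pr (x (inv num v))))) (univ_tuple n a) = x"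
    using pb_tuple(1)[OF x] p.tuplesD(2)[OF x] by (intro p.compose_eqI) simp_all
qed

text \<open>As in the Yoneda lemma: every tuple is the image of the universal tuple under the map of
  \<open>univ_map\<close>, so naturality determines \<tau> by its values at universal
  tuples.\<close>

lemma t_vp_univ:
  assumes Y: "Y \<in> over_obj U Q" and x: "(n, a, x) \<in> star_tuples A (pb Y)"
  shows "t Y (vp (pb Y) n a x) = pull_map (r.Pm (univ_ob n a) Y (\<lambda>v. snd (inv pr (x (inv num v)))))
    (t (univ_ob n a) (vp (pb (univ_ob n a)) n a (univ_tuple n a)))"
proof -
  have a: "a \<in> ops A n" using p.tuplesD(1)[OF x] .
  note g = univ_map[OF Y x]
  have "vp (pb Y) n a x = p.Pm (pb (univ_ob n a)) (pb Y) (pull_map (\<lambda>v. snd (inv pr (x (inv num v)))))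
      (vp (pb (univ_ob n a)) n a (univ_tuple n a))"
    using p.Pm_val[OF pb_smor[OF g(1)] univ_tuple[OF a]] g(2) by simp
  then show ?thesis
    using t_natural[OF g(1) p.val_in[OF pb_obj[OF univ_obj[OF a]] univ_tuple[OF a]]] by simp
qed

text \<open>The entries of \<open>nums n\<close> are distinct, so only the identity permutation
  fixes this tuple.\<close>

lemma nums_unique:
  assumes Y: "Y \<in> over_obj U Q" and b: "(n, b, nums n) \<in> star_tuples B Y" "(n, b', nums n) \<in> star_tuples B Y"
    and eq: "vr Y n b (nums n) = vr Y n b' (nums n)"
  shows "b = b'"
proof -
  obtain \<sigma> where \<sigma>: "\<sigma> permutes {1..n}" "b' = act B n b \<sigma>" "nums n = nums n \<circ> \<sigma>"
    using r.val_eq_iff[OF Y b] eq by blast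
  have "\<sigma> i = id i" for i
  proof (cases "i \<in> {1..n}")
    case True
    then show ?thesis using fun_cong[OF \<sigma>(3), of i] permutes_in_image[OF \<sigma>(1), of i] by simp
  next
    case False
    then show ?thesis using permutes_not_in[OF \<sigma>(1)] by simp
  qed
  then have "\<sigma> = id" by blast
  then show ?thesis using \<sigma>(2) r.act_id[OF r.tuplesD(1)[OF b(1)]] by simp
qed

text \<open>In the square of \<open>y\<close>, the element named by \<open>b\<close> and
  \<open>nums m\<close> lies over the value \<open>s\<close>, so the universal tuple lifts to some
  \<open>x'\<close>. Its second components form a section of \<open>y\<close>, whence
  \<open>n \<le> m\<close>. The map \<open>?h\<close> given by \<open>x'\<close> carries the name
  \<open>(b, y)\<close> of \<open>s\<close> to a name of the element \<open>?w\<close>, so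
  \<open>?h\<close> after \<open>y\<close> is a bijection, \<open>y\<close> is injective and
  \<open>m \<le> n\<close>. Acting by the inverse of \<open>y\<close> turns its tuple into
  \<open>nums n\<close>.\<close>

lemma ex_operation:
  assumes W: "weakly_cartesian (Slice U Q) (Slice U K) (P \<circ>\<^sub>F pull pr K u) (pull pr K u \<circ>\<^sub>F R) \<tau>"
    and a: "a \<in> ops A n"
  shows "\<exists>b. (n, b, nums n) \<in> star_tuples B (univ_ob n a) \<and>
    t (univ_ob n a) (vp (pb (univ_ob n a)) n a (univ_tuple n a)) = pr (bd A n a 0, vr (univ_ob n a) n b (nums n))"
proof -
  let ?Y = "univ_ob n a" and ?x = "univ_tuple n a"
  have Y: "?Y \<in> over_obj U Q" by (rule univ_obj[OF a])
  note x = univ_tuple[OF a]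
  obtain s where s: "t ?Y (vp (pb ?Y) n a ?x) = pr (bd A n a 0, s)" "s \<in> r.PC ?Y"
    "u (bd A n a 0) = disp (r.PO ?Y) s" using t_vp[OF Y x] .
  obtain m b y where y: "(m, b, y) \<in> star_tuples B ?Y" "s = vr ?Y m b y" using r.valE[OF Y s(2)] .
  let ?Z = "r.std m (bd B m b)" and ?g = "\<lambda>v. y (inv num v)"
  have b: "b \<in> ops B m" using r.tuplesD(1)[OF y(1)] .
  have Z: "?Z \<in> over_obj U Q" using r.bd_in[OF b] by (intro r.std_obj) auto
  have g: "smor Q ?Z ?Y ?g" using r.tuplesD(3,4)[OF y(1)] by (intro r.std_smor Y)
  have nums: "(m, b, nums m) \<in> star_tuples B ?Z" by (rule r.tuplesI[OF b]) auto
  let ?w = "vr ?Z m b (nums m)"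
  have "compose {1..m} ?g (nums m) = y" using r.tuplesD(2)[OF y(1)] by (intro p.compose_eqI) simp_all
  then have gw: "r.Pm ?Z ?Y ?g ?w = s" using r.Pm_val[OF g nums] y(2) by simp
  have "bd A n a 0 \<in> K" using p.bd_in[OF a] by auto
  moreover have "disp (r.PO ?Z) ?w = u (bd A n a 0)"
    using r.disp_val[OF Z nums] r.disp_val[OF Y y(1)] y(2) s(3) by simp
  ultimately have "pr (bd A n a 0, ?w) \<in> carr (pb (r.PO ?Z))" using r.val_in[OF Z nums] by simp
  moreover have "t ?Y (vp (pb ?Y) n a ?x) = pull_map (r.Pm ?Z ?Y ?g) (pr (bd A n a 0, ?w))"
    by (simp add: s(1) gw)
  ultimately obtain v where v: "v \<in> p.PC (pb ?Z)" "p.Pm (pb ?Z) (pb ?Y) (pull_map ?g) v = vp (pb ?Y) n a ?x"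
    "t ?Z v = pr (bd A n a 0, ?w)"
    using W[unfolded weakly_cartesian_iff, rule_format, OF g p.val_in[OF pb_obj[OF Y] x]] by blast
  obtain x' where x': "(n, a, x') \<in> star_tuples A (pb ?Z)" "v = vp (pb ?Z) n a x'" "compose {1..n} (pull_map ?g) x' = ?x"
    using p.val_lift[OF pb_smor[OF g] v(1) x v(2)] .
  define c where "c i = snd (inv pr (x' i))" for i
  have c: "c i \<in> num ` {1..m}" "y (inv num (c i)) = num i" if i: "i \<in> {1..n}" for i
  proof -
    show "c i \<in> num ` {1..m}" using pb_tuple(2)[OF x'(1) i] by (simp add: c_def)
    have "pull_map ?g (x' i) = pr (bd A n a i, num i)" using fun_cong[OF x'(3), of i] i by (simp add: compose_def)
    moreover have "pull_map ?g (x' i) = pr (bd A n a i, y (inv num (c i)))"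
      by (subst pb_tuple(1)[OF x'(1) i]) (simp add: c_def)
    ultimately show "y (inv num (c i)) = num i" by simp
  qed
  define \<rho> where "\<rho> i = (if i \<in> {1..n} then inv num (c i) else i)" for i
  have \<rho>: "\<rho> i \<in> {1..m}" "y (\<rho> i) = num i" if "i \<in> {1..n}" for i
    using c[OF that] that by (auto simp: \<rho>_def)
  have \<rho>_inj: "inj_on \<rho> {1..n}" by (rule inj_on_inverseI[of _ "\<lambda>i. inv num (y i)"]) (simp add: \<rho>(2))
  have "\<rho> ` {1..n} \<subseteq> {1..m}" using \<rho>(1) by blast
  then have nm: "n \<le> m" using card_inj_on_le[OF \<rho>_inj, of "{1..m}"] by simp
  let ?h = "\<lambda>v. snd (inv pr (x' (inv num v)))"
  have h: "smor Q ?Y ?Z ?h" by (rule univ_map(1)[OF Z x'(1)])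
  \<comment> \<open>The value of \<tau> at \<open>v\<close> is known in two ways: by naturality from
    the universal tuple, and from the choice of \<open>v\<close>.\<close>
  have "pr (bd A n a 0, r.Pm ?Y ?Z ?h s) = pr (bd A n a 0, ?w)"
    using t_vp_univ[OF Z x'(1)] v(3) by (simp add: s(1) flip: x'(2))
  then have "vr ?Z m b (compose {1..m} ?h y) = ?w" using r.Pm_val[OF h y(1)] y(2) by simp
  then obtain \<sigma> where \<sigma>: "\<sigma> permutes {1..m}" "nums m = compose {1..m} ?h y \<circ> \<sigma>"
    using r.val_eq_iff[OF Z r.tuples_map[OF y(1) h] nums] by blast
  have \<sigma>_in: "\<sigma> i \<in> {1..m}" if "i \<in> {1..m}" for i using permutes_in_image[OF \<sigma>(1)] that by blast
  have hy: "?h (y (\<sigma> i)) = num i" if "i \<in> {1..m}" for i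
    using fun_cong[OF \<sigma>(2), of i] that \<sigma>_in[OF that] by (simp add: compose_def)
  have "inj_on (\<lambda>i. y (\<sigma> i)) {1..m}"
  proof (rule inj_onI)
    fix i j assume ij: "i \<in> {1..m}" "j \<in> {1..m}" "y (\<sigma> i) = y (\<sigma> j)"
    have "num i = num j" using hy[OF ij(1)] hy[OF ij(2)] by (simp only: ij(3))
    then show "i = j" by simp
  qed
  moreover have "(\<lambda>i. y (\<sigma> i)) ` {1..m} \<subseteq> num ` {1..n}" using r.tuplesD(3)[OF y(1)] \<sigma>_in by auto
  ultimately have "card {1..m} \<le> card (num ` {1..n})" by (intro card_inj_on_le) auto
  also have "\<dots> = n" using card_image[OF inj_on_subset[OF inj_num subset_UNIV], of "{1..n}"] by simp
  finally have m: "m = n" using nm by simp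
  have "\<rho> ` {1..n} = {1..n}" using \<open>\<rho> ` {1..n} \<subseteq> {1..m}\<close> \<rho>_inj by (intro endo_inj_surj) (auto simp: m)
  then have "bij_betw \<rho> {1..n} {1..n}" using \<rho>_inj by (simp add: bij_betw_def)
  then have perm: "\<rho> permutes {1..m}" unfolding m by (rule bij_imp_permutes) (simp only: \<rho>_def if_False)
  have y\<rho>: "y \<circ> \<rho> = nums n"
  proof
    fix i show "(y \<circ> \<rho>) i = nums n i"
    proof (cases "i \<in> {1..n}")
      case True
      then show ?thesis using \<rho>(2) by simp
    next
      case False
      then have "\<rho> i = i" "y i = undefined"
        using PiE_arb[OF r.tuplesD(2)[OF y(1)], of i] unfolding m by (simp_all only: \<rho>_def if_False not_False_eq_True)
      then show ?thesis using False by (simp only: o_apply restrict_def if_False)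
    qed
  qed
  have "(n, act B m b \<rho>, nums n) \<in> star_tuples B ?Y"
    using r.tuples_act[OF y(1) perm] y\<rho> m by simp
  moreover have "s = vr ?Y n (act B m b \<rho>) (nums n)"
    using r.val_eq_iff[OF Y y(1) r.tuples_act[OF y(1) perm]] perm y(2) y\<rho> m by auto
  ultimately show ?thesis using s(1) by blast
qed

lemma represented_if_weakly_cartesian:
  assumes W: "weakly_cartesian (Slice U Q) (Slice U K) (P \<circ>\<^sub>F pull pr K u) (pull pr K u \<circ>\<^sub>F R) \<tau>"
  shows "\<exists>f. is_sig_mor A B u f \<and> represented_by f"
proof -
  define f where "f n a = (SOME b. (n, b, nums n) \<in> star_tuples B (univ_ob n a) \<and>
    t (univ_ob n a) (vp (pb (univ_ob n a)) n a (univ_tuple n a)) = pr (bd A n a 0, vr (univ_ob n a) n b (nums n)))"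
    for n a
  have f: "(n, f n a, nums n) \<in> star_tuples B (univ_ob n a)"
    and t_univ: "t (univ_ob n a) (vp (pb (univ_ob n a)) n a (univ_tuple n a)) =
      pr (bd A n a 0, vr (univ_ob n a) n (f n a) (nums n))" if "a \<in> ops A n" for n a
    using someI_ex[OF ex_operation[OF W that]] unfolding f_def by blast+
  have rep: "represented_by f"
    unfolding represented_by_def
  proof (intro ballI allI impI)
    fix Y n a x assume Y: "Y \<in> over_obj U Q" and x: "(n, a, x) \<in> star_tuples A (pb Y)"
    have a: "a \<in> ops A n" using p.tuplesD(1)[OF x] .
    let ?h = "\<lambda>v. snd (inv pr (x (inv num v)))"
    have "compose {1..n} ?h (nums n) = compose {1..n} (snd \<circ> inv pr) x"
      by (simp add: compose_def restrict_def fun_eq_iff)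
    then show "t Y (vp (pb Y) n a x) = pr (bd A n a 0, vr Y n (f n a) (compose {1..n} (snd \<circ> inv pr) x))"
      using t_vp_univ[OF Y x] r.Pm_val[OF univ_map(1)[OF Y x] f[OF a]] by (simp add: t_univ[OF a])
  qed
  have "is_sig_mor A B u f"
    unfolding is_sig_mor_def
  proof (intro conjI allI ballI impI)
    fix n a assume a: "a \<in> ops A n"
    show fa: "f n a \<in> ops B n" using r.tuplesD(1)[OF f[OF a]] .
    show "bd B n (f n a) i = u (bd A n a i)" if "i \<in> {0..n}" for i
    proof (cases "i = 0")
      case True
      obtain s where "t (univ_ob n a) (vp (pb (univ_ob n a)) n a (univ_tuple n a)) = pr (bd A n a 0, s)"
        "u (bd A n a 0) = disp (r.PO (univ_ob n a)) s" using t_vp[OF univ_obj[OF a] univ_tuple[OF a]] by blast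
      then show ?thesis using r.disp_val[OF univ_obj[OF a] f[OF a]] True by (simp add: t_univ[OF a])
    next
      case False
      then have "i \<in> {1..n}" using that by auto
      then show ?thesis using r.tuplesD(4)[OF f[OF a]] by fastforce
    qed
    fix \<sigma> assume \<sigma>: "\<sigma> permutes {1..n}"
    let ?a = "act A n a \<sigma>"
    let ?Y = "univ_ob n ?a" and ?x = "univ_tuple n ?a"
    have a\<sigma>: "?a \<in> ops A n" by (rule p.act_in[OF a \<sigma>])
    have Y: "?Y \<in> over_obj U Q" by (rule univ_obj[OF a\<sigma>])
    note x = univ_tuple[OF a\<sigma>]
    have inv: "inv \<sigma> permutes {1..n}" by (rule permutes_inv[OF \<sigma>])
    have "act A n ?a (inv \<sigma>) = a"
      using p.act_act[OF a \<sigma> inv] permutes_inv_o(1)[OF \<sigma>] p.act_id[OF a] by simp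
    with p.tuples_act[OF x inv] have x': "(n, a, ?x \<circ> inv \<sigma>) \<in> star_tuples A (pb ?Y)" by simp
    \<comment> \<open>Equivariance: the universal element of \<open>?a\<close> is also named by
      \<open>a\<close> with the permuted tuple. Computing \<tau> from both names gives one element
      of \<open>R ?Y\<close>, named over the tuple \<open>nums n\<close> by \<open>f n ?a\<close>
      and by the translate of \<open>f n a\<close>; \<open>nums_unique\<close> equates the
      two.\<close>
    have v: "vp (pb ?Y) n ?a ?x = vp (pb ?Y) n a (?x \<circ> inv \<sigma>)"
      using \<open>act A n ?a (inv \<sigma>) = a\<close> inv by (subst p.val_eq_iff[OF pb_obj[OF Y] x x']) metis
    have inv_in: "inv \<sigma> i \<in> {1..n} \<longleftrightarrow> i \<in> {1..n}" for i using permutes_in_image[OF inv] .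
    have y: "compose {1..n} (snd \<circ> inv pr) (?x \<circ> inv \<sigma>) = nums n \<circ> inv \<sigma>"
      using inv_in by (auto simp: compose_def fun_eq_iff)
    have "t ?Y (vp (pb ?Y) n a (?x \<circ> inv \<sigma>)) = pr (bd A n a 0, vr ?Y n (f n a) (nums n \<circ> inv \<sigma>))"
      using rep Y x' y by (simp add: represented_by_def)
    moreover have "t ?Y (vp (pb ?Y) n ?a ?x) = pr (bd A n ?a 0, vr ?Y n (f n ?a) (nums n))"
      by (rule t_univ[OF a\<sigma>])
    ultimately have eq: "vr ?Y n (f n a) (nums n \<circ> inv \<sigma>) = vr ?Y n (f n ?a) (nums n)" using v by simp
    have fx: "(n, f n a, nums n \<circ> inv \<sigma>) \<in> star_tuples B ?Y"
    proof (rule r.tuplesI[OF fa])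
      show "nums n \<circ> inv \<sigma> \<in> {1..n} \<rightarrow>\<^sub>E carr ?Y"
        using inv_in by (auto simp: PiE_iff extensional_def)
      show "disp ?Y ((nums n \<circ> inv \<sigma>) i) = bd B n (f n a) i" if i: "i \<in> {1..n}" for i
      proof -
        have "bd A n ?a (inv \<sigma> i) = bd A n a i"
          by (simp add: p.bd_act[OF a \<sigma>] permutes_inverses(1)[OF \<sigma>])
        moreover have "bd B n (f n a) i = u (bd A n a i)" using r.tuplesD(4)[OF f[OF a] i] i by simp
        ultimately show ?thesis using inv_in[of i] i by simp
      qed
    qed
    have "(n, act B n (f n a) \<sigma>, nums n \<circ> inv \<sigma> \<circ> \<sigma>) \<in> star_tuples B ?Y" by (rule r.tuples_act[OF fx \<sigma>])
    moreover have n\<sigma>: "nums n \<circ> inv \<sigma> \<circ> \<sigma> = nums n" using permutes_inv_o(2)[OF \<sigma>] by (simp add: o_assoc[symmetric])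
    ultimately have ft: "(n, act B n (f n a) \<sigma>, nums n) \<in> star_tuples B ?Y" by simp
    have "vr ?Y n (f n a) (nums n \<circ> inv \<sigma>) = vr ?Y n (act B n (f n a) \<sigma>) (nums n)"
      by (subst r.val_eq_iff[OF Y fx ft]) (intro conjI refl exI[of _ \<sigma>] \<sigma> n\<sigma>[symmetric])
    then show "f n ?a = act B n (f n a) \<sigma>" using eq nums_unique[OF Y f[OF a\<sigma>] ft] by simp
  qed
  with rep show ?thesis by blast
qed

lemma rep_fn_cls:
  assumes f: "is_sig_mor A B u f" and x: "(n, a, x) \<in> star_tuples A (pb Y)"
  shows "rep_fn pr A B f Y (p.cls (pb Y) n a x) = (bd A n a 0, r.cls Y n (f n a) (compose {1..n} (snd \<circ> inv pr) x))"
proof -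
  let ?y = "compose {1..n} (snd \<circ> inv pr) x"
  have *: "r.cls Y m (f m b) (compose {1..m} (snd \<circ> inv pr) y) = r.cls Y n (f n a) ?y"
    if mem: "(m, b, y) \<in> p.cls (pb Y) n a x" for m b y
  proof -
    obtain \<sigma> where \<sigma>: "\<sigma> permutes {1..n}" and m: "m = n" "b = act A n a \<sigma>" "y = x \<circ> \<sigma>"
      using mem by (auto simp: p.star_rel_iff)
    have y: "compose {1..m} (snd \<circ> inv pr) y = ?y \<circ> \<sigma>"
      using permutes_in_image[OF \<sigma>] by (auto simp: compose_def m fun_eq_iff)
    have fb: "f m b = act B n (f n a) \<sigma>" using f p.tuplesD(1)[OF x] \<sigma> by (simp add: is_sig_mor_def m)
    show ?thesis
      unfolding m(1) y[unfolded m(1)] fb[unfolded m(1)]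
      using r.tuples_act[OF sig_mor_tuple[OF f x] \<sigma>] sig_mor_tuple[OF f x] \<sigma>
      by (subst eq_commute, subst r.cls_eq_iff) auto
  qed
  have "(\<Union>(m, b, y)\<in>p.cls (pb Y) n a x. r.cls Y m (f m b) (compose {1..m} (snd \<circ> inv pr) y)) =
    (\<Union>t\<in>p.cls (pb Y) n a x. r.cls Y n (f n a) ?y)"
    using * by (intro SUP_cong) auto
  also have "\<dots> = r.cls Y n (f n a) ?y" using p.cls_self[OF x] by blast
  finally show ?thesis by (simp add: rep_fn_def p.root_colour_cls[OF x])
qed

text \<open>Passes between names and classes. The first components agree by \<open>t_vp\<close>, and
  injectivity of \<open>\<psi> Y\<close> settles the second ones.\<close>

lemma represented_by_iff:
  assumes f: "is_sig_mor A B u f"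
    and \<phi>: "\<And>X n a x. X \<in> over_obj U K \<Longrightarrow> (n, a, x) \<in> star_tuples A X \<Longrightarrow> \<phi> X (vp X n a x) = p.cls X n a x"
    and \<psi>: "is_over_iso (Slice U Q) R (star B) \<psi>"
      "\<And>X n a x. X \<in> over_obj U Q \<Longrightarrow> (n, a, x) \<in> star_tuples B X \<Longrightarrow> \<psi> X (vr X n a x) = r.cls X n a x"
  shows "represented_by f \<longleftrightarrow> (\<forall>Y\<in>Obj (Slice U Q). \<forall>z\<in>p.PC (pb Y).
    apsnd (\<psi> Y) (inv pr (t Y z)) = rep_fn pr A B f Y (\<phi> (pb Y) z))"
proof -
  have eq: "apsnd (\<psi> Y) (inv pr (t Y (vp (pb Y) n a x))) = rep_fn pr A B f Y (\<phi> (pb Y) (vp (pb Y) n a x)) \<longleftrightarrow>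
      t Y (vp (pb Y) n a x) = pr (bd A n a 0, vr Y n (f n a) (compose {1..n} (snd \<circ> inv pr) x))"
    if Y: "Y \<in> over_obj U Q" and x: "(n, a, x) \<in> star_tuples A (pb Y)" for Y n a x
  proof -
    obtain s where s: "t Y (vp (pb Y) n a x) = pr (bd A n a 0, s)" "s \<in> r.PC Y" using t_vp[OF Y x] by blast
    have y: "(n, f n a, compose {1..n} (snd \<circ> inv pr) x) \<in> star_tuples B Y" by (rule sig_mor_tuple[OF f x])
    have "inj_on (\<psi> Y) (r.PC Y)" using \<psi>(1) Y by (simp add: is_over_iso_def bij_betw_def)
    then have "\<psi> Y s = r.cls Y n (f n a) (compose {1..n} (snd \<circ> inv pr) x) \<longleftrightarrow>
        s = vr Y n (f n a) (compose {1..n} (snd \<circ> inv pr) x)"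
      unfolding \<psi>(2)[OF Y y, symmetric] by (rule inj_on_eq_iff[OF _ s(2) r.val_in[OF Y y]])
    then show ?thesis
      unfolding \<phi>[OF pb_obj[OF Y] x] rep_fn_cls[OF f x] s(1) inv_pr pr_eq_iff apsnd_conv prod.inject by blast
  qed
  show ?thesis
  proof
    assume rep: "represented_by f"
    show "\<forall>Y\<in>Obj (Slice U Q). \<forall>z\<in>p.PC (pb Y). apsnd (\<psi> Y) (inv pr (t Y z)) = rep_fn pr A B f Y (\<phi> (pb Y) z)"
    proof (intro ballI)
      fix Y z assume "Y \<in> Obj (Slice U Q)" and z: "z \<in> p.PC (pb Y)"
      then have Y: "Y \<in> over_obj U Q" by simp
      obtain n a x where x: "(n, a, x) \<in> star_tuples A (pb Y)" "z = vp (pb Y) n a x" using p.valE[OF pb_obj[OF Y] z] .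
      then show "apsnd (\<psi> Y) (inv pr (t Y z)) = rep_fn pr A B f Y (\<phi> (pb Y) z)"
        using rep Y unfolding x(2) eq[OF Y x(1)] represented_by_def by blast
    qed
  next
    assume E: "\<forall>Y\<in>Obj (Slice U Q). \<forall>z\<in>p.PC (pb Y). apsnd (\<psi> Y) (inv pr (t Y z)) = rep_fn pr A B f Y (\<phi> (pb Y) z)"
    show "represented_by f"
      unfolding represented_by_def
    proof (intro ballI allI impI)
      fix Y n a x assume Y: "Y \<in> over_obj U Q" and x: "(n, a, x) \<in> star_tuples A (pb Y)"
      then show "t Y (vp (pb Y) n a x) = pr (bd A n a 0, vr Y n (f n a) (compose {1..n} (snd \<circ> inv pr) x))"
        using E p.val_in[OF pb_obj[OF Y] x] unfolding eq[OF Y x, symmetric] by simp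
    qed
  qed
qed

end

section \<open>The characterisation of analytic transformations\<close>

context universe
begin

theorem analytic_transformation_iff:
  assumes K: "K \<in> U" and P: "analytic_functor U K P" and R: "analytic_functor U Q R" and u: "u \<in> K \<rightarrow> Q"
    and \<tau>: "is_nat_trans (Slice U Q) (Slice U K) (P \<circ>\<^sub>F pull pr K u) (pull pr K u \<circ>\<^sub>F R) \<tau>"
  shows "analytic_transformation U pr K Q u P R \<tau> \<longleftrightarrow>
    weakly_cartesian (Slice U Q) (Slice U K) (P \<circ>\<^sub>F pull pr K u) (pull pr K u \<circ>\<^sub>F R) \<tau>"
proof -
  interpret p: slice_functor U pr K P by unfold_locales (use P in \<open>simp add: analytic_functor_def\<close>)
  interpret r: slice_functor U pr Q R by unfold_locales (use R in \<open>simp add: analytic_functor_def\<close>)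
  show ?thesis
  proof
    assume "analytic_transformation U pr K Q u P R \<tau>"
    then obtain A B :: "('u, 'u) sym_sig" and \<phi> \<psi> f
      where A: "is_sym_sig U K A" "is_over_iso (Slice U K) P (star A) \<phi>"
        and B: "is_sym_sig U Q B" "is_over_iso (Slice U Q) R (star B) \<psi>"
        and f: "is_sig_mor A B u f"
        and eq: "\<forall>Y\<in>Obj (Slice U Q). \<forall>z\<in>p.PC (pull_ob pr K u Y).
           apsnd (\<psi> Y) (inv pr (fn (\<tau> Y) z)) = rep_fn pr A B f Y (\<phi> (pull_ob pr K u Y) z)"
      unfolding analytic_transformation_def by blast
    interpret T: pulled_transformation U pr K P A "\<lambda>X n a x. inv_into (p.PC X) (\<phi> X) (star_rel A X `` {(n, a, x)})"
      Q R B "\<lambda>X n a x. inv_into (r.PC X) (\<psi> X) (star_rel B X `` {(n, a, x)})" u \<tau>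
      by (intro pulled_transformation.intro pulled_transformation_axioms.intro universe_axioms
          p.presentation_of_iso(1)[OF A] r.presentation_of_iso(1)[OF B] K u \<tau>)
    have "T.represented_by f"
      using T.represented_by_iff[OF f p.presentation_of_iso(2)[OF A] B(2) r.presentation_of_iso(2)[OF B]] eq by blast
    then show "weakly_cartesian (Slice U Q) (Slice U K) (P \<circ>\<^sub>F pull pr K u) (pull pr K u \<circ>\<^sub>F R) \<tau>"
      by (rule T.weakly_cartesian_if_represented[OF f])
  next
    assume W: "weakly_cartesian (Slice U Q) (Slice U K) (P \<circ>\<^sub>F pull pr K u) (pull pr K u \<circ>\<^sub>F R) \<tau>"
    \<comment> \<open>Some presentations of \<open>P\<close> and \<open>R\<close> have to be
      exhibited, and any will do: weak cartesianness produces \<open>f\<close> for every choice of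
      them.\<close>
    obtain A :: "('u, 'u) sym_sig" and \<phi> where A: "is_sym_sig U K A" "is_over_iso (Slice U K) P (star A) \<phi>"
      using P unfolding analytic_functor_def by blast
    obtain B :: "('u, 'u) sym_sig" and \<psi> where B: "is_sym_sig U Q B" "is_over_iso (Slice U Q) R (star B) \<psi>"
      using R unfolding analytic_functor_def by blast
    interpret T: pulled_transformation U pr K P A "\<lambda>X n a x. inv_into (p.PC X) (\<phi> X) (star_rel A X `` {(n, a, x)})"
      Q R B "\<lambda>X n a x. inv_into (r.PC X) (\<psi> X) (star_rel B X `` {(n, a, x)})" u \<tau>
      by (intro pulled_transformation.intro pulled_transformation_axioms.intro universe_axioms
          p.presentation_of_iso(1)[OF A] r.presentation_of_iso(1)[OF B] K u \<tau>)
    obtain f where f: "is_sig_mor A B u f" "T.represented_by f" using T.represented_if_weakly_cartesian[OF W] by blast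
    then have "\<forall>Y\<in>Obj (Slice U Q). \<forall>z\<in>p.PC (pull_ob pr K u Y).
        apsnd (\<psi> Y) (inv pr (fn (\<tau> Y) z)) = rep_fn pr A B f Y (\<phi> (pull_ob pr K u Y) z)"
      using T.represented_by_iff[OF f(1) p.presentation_of_iso(2)[OF A] B(2) r.presentation_of_iso(2)[OF B]] by blast
    with \<tau> A B f(1) show "analytic_transformation U pr K Q u P R \<tau>"
      unfolding analytic_transformation_def by blast
  qed
qed

end

theorem theorem7p5:
  fixes U :: "'u set set" and pr :: "'u \<times> 'u \<Rightarrow> 'u"
  assumes "set_universe U pr"
  shows "(\<forall>Q\<in>U. \<forall>P. is_functor (Slice U Q) (Slice U Q) P \<longrightarrow>
            (analytic_functor U Q P \<longleftrightarrow>
               finitary U (Slice U Q) (Slice U Q) P \<and>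
               weakly_preserves_wide_pullbacks U (Slice U Q) (Slice U Q) P)) \<and>
         (\<forall>K\<in>U. \<forall>Q\<in>U. \<forall>P R u \<tau>.
            analytic_functor U K P \<longrightarrow> analytic_functor U Q R \<longrightarrow> u \<in> K \<rightarrow> Q \<longrightarrow>
            is_nat_trans (Slice U Q) (Slice U K) (P \<circ>\<^sub>F pull pr K u) (pull pr K u \<circ>\<^sub>F R) \<tau> \<longrightarrow>
            (analytic_transformation U pr K Q u P R \<tau> \<longleftrightarrow>
               weakly_cartesian (Slice U Q) (Slice U K) (P \<circ>\<^sub>F pull pr K u) (pull pr K u \<circ>\<^sub>F R) \<tau>))"
proof -
  interpret universe U pr by unfold_locales (rule assms)
  show ?thesis using analytic_functor_iff analytic_transformation_iff by blast
qed

end
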